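(* Let $a>b>0$, $c>0$, and let $\mathbb{E}_0=\{(x,y,z):\frac{x^2}{a^2}+\frac{y^2}{b^2}+\frac{z^2}{c^2}=1\}\subset\mathbb{R}^{2,1}$ be the ellipsoid in the Minkowski 3-space. Then: (a) The curves $c_x=\{x=0\}\cap\mathbb{E}_0$ and $c_z=\{z=0\}\cap\mathbb{E}_0$ are principal lines. (b) $\mathbb{E}_0$ has exactly four spacelike umbilic points, namely $\left(\pm a\sqrt{\frac{a^2-b^2}{a^2+c^2}},\,0,\,\pm c\sqrt{\frac{b^2+c^2}{a^2+c^2}}\right)$ (all choices of signs). (c) The umbilic points are of type $D_1$. (d) The curve $c_y=\{y=0\}\cap\mathbb{E}_0$ is, apart from the umbilic points lying on it, a union of principal lines. Moreover, these principal lines are the separatrices of the umbilic points. (e) The tropic of $\mathbb{E}_0$ is composed of two disjoint regular closed curves. Moreover, these curves are principal lines. (f) The principal lines are globally defined, i.e. the set $LPL$ of $\mathbb{E}_0$ is empty.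
   Context: The Minkowski 3-space $\mathbb{R}^{2,1}$ is $\mathbb{R}^3$ with $\langle p,q\rangle=p_1q_1+p_2q_2-p_3q_3$; the vector product is characterized by $\langle p\times q,r\rangle=\det(p,q,r)$ for all $r$; $\|p\|=\sqrt{|\langle p,p\rangle|}$. For a local parametrization $X(u,v)$ of a smooth surface, $E=\langle X_u,X_u\rangle$, $F=\langle X_u,X_v\rangle$, $G=\langle X_v,X_v\rangle$. The surface is Riemannian (spacelike) at points where $EG-F^2>0$, Lorentzian (timelike) where $EG-F^2<0$; the tropic $LD$ is the set of points where $EG-F^2=0$ (lightlike tangent plane). Off the tropic let $N=\pm\frac{X_u\times X_v}{\|X_u\times X_v\|}$, $e=\langle X_{uu},N\rangle$, $f=\langle X_{uv},N\rangle$, $g=\langle X_{vv},N\rangle$. The equation of principal lines is $$L_1\,dv^2+M_1\,du\,dv+N_1\,du^2=0,$$ with $L_1=\|X_u\times X_v\|(Fg-Gf)$, $M_1=\|X_u\times X_v\|(Eg-Ge)$, $N_1=\|X_u\times X_v\|(Ef-Fe)$. It extends to the tropic, since up to a common sign (irrelevant by homogeneity) $\|X_u\times X_v\|\,e,\ \|X_u\times X_v\|\,f,\ \|X_u\times X_v\|\,g$ are $\langle X_{uu},X_u\times X_v\rangle,\ \langle X_{uv},X_u\times X_v\rangle,\ \langle X_{vv},X_u\times X_v\rangle$. Umbilic points are the points where $L_1=M_1=N_1=0$; an umbilic point is spacelike if it lies in the Riemannian part. A smooth curve is a principal line if it satisfies the equation of principal lines and contains no umbilic points. $LPL$ is the set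 of non-umbilic points at which the discriminant $M_1^2-4L_1N_1$ vanishes (the equation determines a unique direction). Type $D_1$: near an umbilic point with coordinates $(u_0,v_0)$, consider in $\mathbb{R}^2\times\mathbb{RP}^1$ the set $S$ of pairs (point, direction $[du:dv]$) satisfying the equation of principal lines. In the chart $p=dv/du$, $S$ is $\{\mathcal{F}(u,v,p)=0\}$ with $\mathcal{F}=L_1p^2+M_1p+N_1$, and the Lie–Cartan field is $Y=(\mathcal{F}_p,\ p\mathcal{F}_p,\ -(\mathcal{F}_u+p\mathcal{F}_v))$, tangent to $S$; in the chart $q=du/dv$, with $\mathcal{G}=L_1+M_1q+N_1q^2$, it is $Z=(q\mathcal{G}_q,\ \mathcal{G}_q,\ -(q\mathcal{G}_u+\mathcal{G}_v))$. These define a line field on $S$ whose integral curves project to the principal lines. The umbilic point is (Darbouxian) of type $D_1$ if $S$ is a regular surface near the fibre $\{(u_0,v_0)\}\times\mathbb{RP}^1$ and this field has exactly one singular point on that fibre, which is a hyperbolic saddle of the field restricted to $S$. The separatrices of a $D_1$ umbilic point are the principal lines that tend to the umbilic point, i.e. the projections of the saddle separatrices not contained in the fibre (extended maximally as principal lines). *)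

theory Defs
  imports "HOL-Analysis.Analysis"
begin

section \<open>Minkowski 3-space\<close>

definition mink :: "real^3 \<Rightarrow> real^3 \<Rightarrow> real" where
  "mink p q = p$1 * q$1 + p$2 * q$2 - p$3 * q$3"

definition mnorm :: "real^3 \<Rightarrow> real" where
  "mnorm p = sqrt \<bar>mink p p\<bar>"

text \<open>The Minkowski vector product is the Euclidean one with the sign of the third coordinate
  changed; \<open>mcross_unique\<close> is the defining property.\<close>

definition mcross :: "real^3 \<Rightarrow> real^3 \<Rightarrow> real^3" where
  "mcross p q = vector [p$2 * q$3 - p$3 * q$2, p$3 * q$1 - p$1 * q$3, - (p$1 * q$2 - p$2 * q$1)]"

lemma mink_mcross: "mink (mcross p q) r = det (vector [p, q, r])"
  by (simp add: mink_def mcross_def det_3 vector_3 algebra_simps)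

lemma mcross_unique: "(\<forall>r. mink w r = det (vector [p, q, r])) \<longleftrightarrow> w = mcross p q"
proof
  assume A: "\<forall>r. mink w r = det (vector [p, q, r])"
  have "mink w r = mink (mcross p q) r" for r
    using A by (simp add: mink_mcross)
  from this[of "vector [1,0,0]"] this[of "vector [0,1,0]"] this[of "vector [0,0,1]"]
  show "w = mcross p q"
    by (simp add: mink_def vector_3 vec_eq_iff forall_3)
qed (simp add: mink_mcross)

lemma mink_mcross_self:
  "mink (mcross p q) (mcross p q) = - (mink p p * mink q q - (mink p q)\<^sup>2)"
  by (simp add: mink_def mcross_def vector_3 power2_eq_square algebra_simps)


section \<open>Smooth maps and local parametrizations\<close>

primrec ck_on :: "nat \<Rightarrow> 'a::euclidean_space set \<Rightarrow> ('a \<Rightarrow> 'b::real_normed_vector) \<Rightarrow> bool" where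
  "ck_on 0 U f \<longleftrightarrow> continuous_on U f"
| "ck_on (Suc k) U f \<longleftrightarrow>
     f differentiable_on U \<and> (\<forall>w. ck_on k U (\<lambda>x. frechet_derivative f (at x) w))"

text \<open>To be used for open \<open>U\<close> only.\<close>

definition smooth_on :: "'a::euclidean_space set \<Rightarrow> ('a \<Rightarrow> 'b::real_normed_vector) \<Rightarrow> bool" where
  "smooth_on U f \<longleftrightarrow> (\<forall>k. ck_on k U f)"

definition du :: "(real \<times> real \<Rightarrow> 'b::real_normed_vector) \<Rightarrow> real \<times> real \<Rightarrow> 'b" where
  "du X = (\<lambda>(u, v). vector_derivative (\<lambda>s. X (s, v)) (at u))"

definition dv :: "(real \<times> real \<Rightarrow> 'b::real_normed_vector) \<Rightarrow> real \<times> real \<Rightarrow> 'b" where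
  "dv X = (\<lambda>(u, v). vector_derivative (\<lambda>s. X (u, s)) (at v))"

definition local_param :: "(real^3) set \<Rightarrow> (real \<times> real) set \<Rightarrow> (real \<times> real \<Rightarrow> real^3) \<Rightarrow> bool" where
  "local_param S U X \<longleftrightarrow>
     open U \<and> smooth_on U X \<and> openin (top_of_set S) (X ` U) \<and>
     (\<exists>Y. homeomorphism U (X ` U) X Y) \<and>
     (\<forall>q\<in>U. cross3 (du X q) (dv X q) \<noteq> 0)"

definition local_param_at ::
    "(real^3) set \<Rightarrow> (real \<times> real) set \<Rightarrow> (real \<times> real \<Rightarrow> real^3) \<Rightarrow> real \<times> real \<Rightarrow> real^3 \<Rightarrow> bool" where
  "local_param_at S U X q p \<longleftrightarrow> local_param S U X \<and> q \<in> U \<and> X q = p"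


section \<open>Fundamental forms and the equation of principal lines\<close>

type_synonym param = "real \<times> real \<Rightarrow> real^3"

definition coefE :: "param \<Rightarrow> real \<times> real \<Rightarrow> real" where
  "coefE X q = mink (du X q) (du X q)"

definition coefF :: "param \<Rightarrow> real \<times> real \<Rightarrow> real" where
  "coefF X q = mink (du X q) (dv X q)"

definition coefG :: "param \<Rightarrow> real \<times> real \<Rightarrow> real" where
  "coefG X q = mink (dv X q) (dv X q)"

definition metric_disc :: "param \<Rightarrow> real \<times> real \<Rightarrow> real" where
  "metric_disc X q = coefE X q * coefG X q - (coefF X q)\<^sup>2"

text \<open>The following are \<open>e\<close>, \<open>f\<close>, \<open>g\<close> multiplied by the Minkowski norm of \<open>X\<^sub>u \<times> X\<^sub>v\<close>;
  unlike \<open>e\<close>, \<open>f\<close>, \<open>g\<close> they make sense on the tropic as well.\<close>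

definition barE :: "param \<Rightarrow> real \<times> real \<Rightarrow> real" where
  "barE X q = mink (du (du X) q) (mcross (du X q) (dv X q))"

definition barF :: "param \<Rightarrow> real \<times> real \<Rightarrow> real" where
  "barF X q = mink (dv (du X) q) (mcross (du X q) (dv X q))"

definition barG :: "param \<Rightarrow> real \<times> real \<Rightarrow> real" where
  "barG X q = mink (dv (dv X) q) (mcross (du X q) (dv X q))"

definition L1 :: "param \<Rightarrow> real \<times> real \<Rightarrow> real" where
  "L1 X q = coefF X q * barG X q - coefG X q * barF X q"

definition M1 :: "param \<Rightarrow> real \<times> real \<Rightarrow> real" where
  "M1 X q = coefE X q * barG X q - coefG X q * barE X q"

definition N1 :: "param \<Rightarrow> real \<times> real \<Rightarrow> real" where
  "N1 X q = coefE X q * barF X q - coefF X q * barE X q"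

text \<open>Off the tropic these are the coefficients formed with the unit normal \<open>N\<close>.\<close>

lemma principal_coefficients_off_tropic:
  fixes X :: param and q :: "real \<times> real"
  defines "n \<equiv> mcross (du X q) (dv X q)"
  defines "N \<equiv> (1 / mnorm n) *\<^sub>R n"
  defines "e \<equiv> mink (du (du X) q) N" and "f \<equiv> mink (dv (du X) q) N" and "g \<equiv> mink (dv (dv X) q) N"
  assumes "metric_disc X q \<noteq> 0"
  shows "L1 X q = mnorm n * (coefF X q * g - coefG X q * f)"
    and "M1 X q = mnorm n * (coefE X q * g - coefG X q * e)"
    and "N1 X q = mnorm n * (coefE X q * f - coefF X q * e)"
proof -
  have "mink n n = - metric_disc X q"
    unfolding n_def mink_mcross_self metric_disc_def coefE_def coefF_def coefG_def by simp
  then have nz: "mnorm n \<noteq> 0" using assms by (simp add: mnorm_def)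
  have scale: "mink w N = mink w n / mnorm n" for w
    unfolding N_def by (simp add: mink_def diff_divide_distrib add_divide_distrib)
  show "L1 X q = mnorm n * (coefF X q * g - coefG X q * f)"
    and "M1 X q = mnorm n * (coefE X q * g - coefG X q * e)"
    and "N1 X q = mnorm n * (coefE X q * f - coefF X q * e)"
    unfolding L1_def M1_def N1_def barE_def barF_def barG_def e_def f_def g_def scale
    using nz by (simp_all add: n_def[symmetric] field_simps)
qed

text \<open>Replacing a local parametrization by another one at the same point multiplies \<open>EG - F\<^sup>2\<close>
  by a positive number, and turns the principal quadratic form into a nonzero multiple of its
  pullback. Hence in the following definitions "some local parametrization at \<open>p\<close>" amounts to
  "every local parametrization at \<open>p\<close>".\<close>

definition spacelike_point :: "(real^3) set \<Rightarrow> real^3 \<Rightarrow> bool" where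
  "spacelike_point S p \<longleftrightarrow> (\<exists>U X q. local_param_at S U X q p \<and> metric_disc X q > 0)"

definition tropic :: "(real^3) set \<Rightarrow> (real^3) set" where
  "tropic S = {p. \<exists>U X q. local_param_at S U X q p \<and> metric_disc X q = 0}"

definition umbilic :: "(real^3) set \<Rightarrow> real^3 \<Rightarrow> bool" where
  "umbilic S p \<longleftrightarrow>
     (\<exists>U X q. local_param_at S U X q p \<and> L1 X q = 0 \<and> M1 X q = 0 \<and> N1 X q = 0)"

definition LPL :: "(real^3) set \<Rightarrow> (real^3) set" where
  "LPL S = {p. \<not> umbilic S p \<and>
     (\<exists>U X q. local_param_at S U X q p \<and> (M1 X q)\<^sup>2 - 4 * L1 X q * N1 X q = 0)}"

definition principal_direction :: "(real^3) set \<Rightarrow> real^3 \<Rightarrow> real^3 \<Rightarrow> bool" where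
  "principal_direction S p w \<longleftrightarrow>
     (\<exists>U X q a b. local_param_at S U X q p \<and> w = a *\<^sub>R du X q + b *\<^sub>R dv X q \<and>
        L1 X q * b\<^sup>2 + M1 X q * a * b + N1 X q * a\<^sup>2 = 0)"


section \<open>Principal lines\<close>

text \<open>Smooth curves are images of immersions of the whole line: every open interval is diffeomorphic
  to it, and a closed curve is the image of a periodic immersion.\<close>

definition principal_immersion :: "(real^3) set \<Rightarrow> (real \<Rightarrow> real^3) \<Rightarrow> bool" where
  "principal_immersion S \<gamma> \<longleftrightarrow>
     smooth_on UNIV \<gamma> \<and>
     (\<forall>t. vector_derivative \<gamma> (at t) \<noteq> 0 \<and> \<gamma> t \<in> S \<and> \<not> umbilic S (\<gamma> t) \<and>
          principal_direction S (\<gamma> t) (vector_derivative \<gamma> (at t)))"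

definition principal_line :: "(real^3) set \<Rightarrow> (real^3) set \<Rightarrow> bool" where
  "principal_line S C \<longleftrightarrow> (\<exists>\<gamma>. principal_immersion S \<gamma> \<and> C = range \<gamma>)"

definition maximal_principal_line :: "(real^3) set \<Rightarrow> (real^3) set \<Rightarrow> bool" where
  "maximal_principal_line S C \<longleftrightarrow>
     principal_line S C \<and> (\<forall>C'. principal_line S C' \<and> C \<subseteq> C' \<longrightarrow> C' = C)"

definition regular_closed_curve :: "(real^3) set \<Rightarrow> bool" where
  "regular_closed_curve C \<longleftrightarrow>
     (\<exists>\<gamma> T. T > 0 \<and> smooth_on UNIV \<gamma> \<and> (\<forall>t. vector_derivative \<gamma> (at t) \<noteq> 0) \<and>
        (\<forall>t. \<gamma> (t + T) = \<gamma> t) \<and> inj_on \<gamma> {0..<T} \<and> C = range \<gamma>)"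


section \<open>Lie--Cartan fields and umbilic points of type D1\<close>

definition lcF :: "param \<Rightarrow> real \<times> real \<times> real \<Rightarrow> real" where
  "lcF X = (\<lambda>(u, v, p). L1 X (u, v) * p\<^sup>2 + M1 X (u, v) * p + N1 X (u, v))"

definition lcG :: "param \<Rightarrow> real \<times> real \<times> real \<Rightarrow> real" where
  "lcG X = (\<lambda>(u, v, q). L1 X (u, v) + M1 X (u, v) * q + N1 X (u, v) * q\<^sup>2)"

abbreviation D3 :: "(real \<times> real \<times> real \<Rightarrow> 'b::real_normed_vector) \<Rightarrow>
    real \<times> real \<times> real \<Rightarrow> real \<times> real \<times> real \<Rightarrow> 'b" where
  "D3 H s \<equiv> frechet_derivative H (at s)"

definition lcY :: "param \<Rightarrow> real \<times> real \<times> real \<Rightarrow> real \<times> real \<times> real" where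
  "lcY X = (\<lambda>(u, v, p). let D = D3 (lcF X) (u, v, p) in
     (D (0, 0, 1), p * D (0, 0, 1), - (D (1, 0, 0) + p * D (0, 1, 0))))"

definition lcZ :: "param \<Rightarrow> real \<times> real \<times> real \<Rightarrow> real \<times> real \<times> real" where
  "lcZ X = (\<lambda>(u, v, q). let D = D3 (lcG X) (u, v, q) in
     (q * D (0, 0, 1), D (0, 0, 1), - (q * D (1, 0, 0) + D (0, 1, 0))))"

text \<open>At a zero \<open>s\<close> of a field \<open>V\<close> tangent to the regular surface \<open>{H = 0}\<close>, the linear part of \<open>V\<close>
  maps the tangent plane, i.e. the kernel of \<open>D3 H s\<close>, to itself; the zero is a hyperbolic saddle
  of the restricted field if the two eigenvalues on this plane are real of opposite signs.\<close>

definition hyperbolic_saddle_on ::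
    "(real \<times> real \<times> real \<Rightarrow> real) \<Rightarrow> (real \<times> real \<times> real \<Rightarrow> real \<times> real \<times> real) \<Rightarrow>
     real \<times> real \<times> real \<Rightarrow> bool" where
  "hyperbolic_saddle_on H V s \<longleftrightarrow>
     H s = 0 \<and> V s = 0 \<and>
     (\<exists>w1 w2 m1 m2. m1 < 0 \<and> 0 < m2 \<and> w1 \<noteq> 0 \<and> w2 \<noteq> 0 \<and>
        D3 H s w1 = 0 \<and> D3 H s w2 = 0 \<and>
        D3 V s w1 = m1 *\<^sub>R w1 \<and> D3 V s w2 = m2 *\<^sub>R w2)"

text \<open>At an umbilic point the whole fibre lies on the Lie--Cartan surface. It is covered by the chart
  \<open>p = dv/du\<close> together with the single point \<open>q = du/dv = 0\<close> of the other chart.\<close>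

definition regular_along_fibre :: "param \<Rightarrow> real \<Rightarrow> real \<Rightarrow> bool" where
  "regular_along_fibre X u0 v0 \<longleftrightarrow>
     (\<forall>p. D3 (lcF X) (u0, v0, p) \<noteq> (\<lambda>_. 0)) \<and> D3 (lcG X) (u0, v0, 0) \<noteq> (\<lambda>_. 0)"

definition unique_saddle_slope :: "param \<Rightarrow> real \<Rightarrow> real \<Rightarrow> real \<Rightarrow> bool" where
  "unique_saddle_slope X u0 v0 p0 \<longleftrightarrow>
     {p. lcY X (u0, v0, p) = 0} = {p0} \<and> lcZ X (u0, v0, 0) \<noteq> 0 \<and>
     hyperbolic_saddle_on (lcF X) (lcY X) (u0, v0, p0)"

definition unique_saddle_vertical :: "param \<Rightarrow> real \<Rightarrow> real \<Rightarrow> bool" where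
  "unique_saddle_vertical X u0 v0 \<longleftrightarrow>
     {p. lcY X (u0, v0, p) = 0} = {} \<and> lcZ X (u0, v0, 0) = 0 \<and>
     hyperbolic_saddle_on (lcG X) (lcZ X) (u0, v0, 0)"

definition D1_in :: "(real^3) set \<Rightarrow> (real \<times> real) set \<Rightarrow> param \<Rightarrow> real \<Rightarrow> real \<Rightarrow> real^3 \<Rightarrow> bool" where
  "D1_in S U X u0 v0 p \<longleftrightarrow>
     local_param_at S U X (u0, v0) p \<and>
     L1 X (u0, v0) = 0 \<and> M1 X (u0, v0) = 0 \<and> N1 X (u0, v0) = 0 \<and>
     regular_along_fibre X u0 v0 \<and>
     ((\<exists>p0. unique_saddle_slope X u0 v0 p0) \<or> unique_saddle_vertical X u0 v0)"

definition type_D1 :: "(real^3) set \<Rightarrow> real^3 \<Rightarrow> bool" where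
  "type_D1 S p \<longleftrightarrow> (\<exists>U X u0 v0. D1_in S U X u0 v0 p)"


section \<open>Separatrices\<close>

text \<open>Since a curve can be traversed backwards, only its end at \<open>t = \<infinity>\<close> has to be considered.\<close>

definition separatrix :: "(real^3) set \<Rightarrow> real^3 \<Rightarrow> (real^3) set \<Rightarrow> bool" where
  "separatrix S p C \<longleftrightarrow>
     type_D1 S p \<and> maximal_principal_line S C \<and>
     (\<exists>\<gamma>. principal_immersion S \<gamma> \<and> C = range \<gamma> \<and> (\<gamma> \<longlongrightarrow> p) at_top)"

text \<open>The second description of separatrices: maximal principal lines having an end whose lift, given by
  position and tangent direction, is a separatrix of the saddle on the Lie--Cartan surface. Such a lift
  is an integral curve of the line field outside the fibre, so it only has to tend to the saddle.
  Here \<open>(a t, b t)\<close> are the components \<open>(du, dv)\<close> of the velocity of the curve.\<close>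

definition lift_tends_to_saddle ::
    "(real \<times> real) set \<Rightarrow> param \<Rightarrow> real \<Rightarrow> real \<Rightarrow> (real \<Rightarrow> real^3) \<Rightarrow> bool" where
  "lift_tends_to_saddle U X u0 v0 \<gamma> \<longleftrightarrow>
     (\<exists>u v a b.
        (\<forall>\<^sub>F t in at_top. (u t, v t) \<in> U \<and> \<gamma> t = X (u t, v t) \<and>
           vector_derivative \<gamma> (at t) = a t *\<^sub>R du X (u t, v t) + b t *\<^sub>R dv X (u t, v t)) \<and>
        ((\<exists>p0. unique_saddle_slope X u0 v0 p0 \<and> (\<forall>\<^sub>F t in at_top. a t \<noteq> 0) \<and>
            ((\<lambda>t. (u t, v t, b t / a t)) \<longlongrightarrow> (u0, v0, p0)) at_top) \<or>
         (unique_saddle_vertical X u0 v0 \<and> (\<forall>\<^sub>F t in at_top. b t \<noteq> 0) \<and>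
            ((\<lambda>t. (u t, v t, a t / b t)) \<longlongrightarrow> (u0, v0, 0)) at_top)))"

definition saddle_separatrix :: "(real^3) set \<Rightarrow> real^3 \<Rightarrow> (real^3) set \<Rightarrow> bool" where
  "saddle_separatrix S p C \<longleftrightarrow>
     maximal_principal_line S C \<and>
     (\<exists>U X u0 v0 \<gamma>. D1_in S U X u0 v0 p \<and> principal_immersion S \<gamma> \<and> C = range \<gamma> \<and>
        lift_tends_to_saddle U X u0 v0 \<gamma>)"


section \<open>The ellipsoid\<close>

definition ellipsoid :: "real \<Rightarrow> real \<Rightarrow> real \<Rightarrow> (real^3) set" where
  "ellipsoid a b c = {p. (p$1)\<^sup>2 / a\<^sup>2 + (p$2)\<^sup>2 / b\<^sup>2 + (p$3)\<^sup>2 / c\<^sup>2 = 1}"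

end

theory Submission
  imports Defs "HOL-Real_Asymp.Real_Asymp"
begin

text \<open>
  Write \<open>\<xi>(p) = (x/a\<^sup>2, y/b\<^sup>2, -z/c\<^sup>2)\<close>, half the Minkowski gradient of the quadratic function defining
  the ellipsoid. It is a linear map of \<open>p\<close>, called \<open>shape\<close> below, and it is self-adjoint for the Minkowski
  product; every normal \<open>X\<^sub>u \<times> X\<^sub>v\<close> is a multiple \<open>\<mu> \<xi>(p)\<close>. Differentiating \<open>\<langle>X\<^sub>u, \<xi>(X)\<rangle> = 0\<close> and
  \<open>\<langle>X\<^sub>v, \<xi>(X)\<rangle> = 0\<close> expresses the second fundamental form through \<open>\<xi>\<close>, and the equation of principal lines
  turns into \<open>det(w, \<xi>(w), \<xi>(p)) = 0\<close>, that is, with \<open>P = a\<^sup>2 - b\<^sup>2\<close>, \<open>Q = a\<^sup>2 + c\<^sup>2 = P + R\<close> and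
  \<open>R = b\<^sup>2 + c\<^sup>2\<close>,
  \<open>P z w\<^sub>1 w\<^sub>2 - Q y w\<^sub>1 w\<^sub>3 + R x w\<^sub>2 w\<^sub>3 = 0\<close> (\<open>principal_equation_eq_form\<close>). This holds on the tropic as well
  and reduces everything that happens at a point to algebra.

  The discriminant of this form on the tangent plane is a positive multiple of
  \<open>(R X\<^sup>2 - P Z\<^sup>2)\<^sup>2 + Q\<^sup>2 Y\<^sup>4 + 2 Q Y\<^sup>2 (R X\<^sup>2 + P Z\<^sup>2)\<close> with \<open>X = x/a\<close>, \<open>Y = y/b\<close>, \<open>Z = z/c\<close>
  (\<open>principal_discriminant\<close>). It vanishes only if \<open>y = 0\<close> and \<open>R X\<^sup>2 = P Z\<^sup>2\<close>, and there the form is zero.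
  So these four points are all the umbilic points, they are spacelike, and \<open>LPL\<close> is empty.

  The section \<open>x = 0\<close> has velocities with \<open>w\<^sub>1 = 0\<close> and \<open>z = 0\<close> has velocities with \<open>w\<^sub>3 = 0\<close>, so all three terms
  vanish. Along a curve in the tropic \<open>w\<close>, \<open>\<xi>(w)\<close> and \<open>\<xi>(p)\<close> are all orthogonal to the lightlike vector
  \<open>\<xi>(p)\<close>, so the determinant vanishes too (\<open>tropic_curve_principal\<close>).

  For type \<open>D\<^sub>1\<close>, in the chart that writes the ellipsoid as a graph over the \<open>xy\<close>-plane, with \<open>x = a u\<close> and
  \<open>y = b v\<close>, the equation of principal lines is a nonvanishing factor times
  \<open>- R u v p\<^sup>2 + (P - Q u\<^sup>2 + R v\<^sup>2) p + Q u v\<close>. On the Lie--Cartan surface the factor does not change zeros, and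
  it only rescales the linear part at a zero. On the fibre over an umbilic point the only zero is
  \<open>p = 0\<close>, with eigenvalues in the ratio \<open>-2 : 1\<close> (\<open>umbilic_D1\<close>).

  The section \<open>y = 0\<close> without the umbilic points consists of four arcs. That they are exactly the separatrices
  rests on two facts. First, for a principal immersion the equation reads \<open>Y' (P Z X' + R X Z') = Q X' Z' Y\<close>,
  a linear differential equation for \<open>Y\<close> near any time with \<open>Y = Y' = 0\<close>; so a principal line touching the plane
  \<open>y = 0\<close> stays in it (\<open>cy_invariant\<close>). Hence the arcs are maximal: a principal line containing an
  arc meets the plane in uncountably many points, so not every contact is transversal. Second, a principal line
  tending to an umbilic point must lie in \<open>y = 0\<close> (\<open>limit_umbilic_imp_cy\<close>). The confocal quadrics supply a first
  integral: in the functions \<open>\<tau> = P X\<^sup>2 - R Z\<^sup>2 + R - P\<close> and \<open>R P Y\<^sup>2\<close> the principal lines satisfy Clairaut's equation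
  and run along straight lines \<open>r\<^sup>2 - r \<tau> - R P Y\<^sup>2 = 0\<close>. A line with \<open>r \<noteq> 0\<close> misses the image \<open>(0, 0)\<close> of the umbilic
  points, and a point with \<open>y \<noteq> 0\<close> lies only on lines with \<open>r \<noteq> 0\<close>. Both facts are instances of one principle, that a
  function with \<open>f' g = h f\<close> and \<open>g \<noteq> 0\<close> at its double zeros vanishes identically once it has a double zero
  (\<open>first_order_zero_propagation\<close>).
\<close>

section \<open>Smooth maps\<close>

lemma ck_on_cong:
  assumes "open U" "\<And>x. x \<in> U \<Longrightarrow> f x = g x" "ck_on k U f"
  shows "ck_on k U g"
  using assms(2,3)
proof (induction k arbitrary: f g)
  case 0
  then show ?case by (simp cong: continuous_on_cong)
next
  case (Suc k)
  have fd: "f differentiable (at x)" if "x \<in> U" for x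
    using Suc.prems(2) that assms(1) by (simp add: differentiable_on_eq_differentiable_at)
  have gd: "(g has_derivative frechet_derivative f (at x)) (at x)" if "x \<in> U" for x
    using fd[OF that] Suc.prems(1) assms(1) that
    by (metis frechet_derivative_works has_derivative_transform_within_open)
  then have "g differentiable_on U"
    using assms(1) by (auto simp: differentiable_on_eq_differentiable_at differentiable_def)
  moreover have "ck_on k U (\<lambda>x. frechet_derivative g (at x) w)" for w
  proof (rule Suc.IH)
    show "ck_on k U (\<lambda>x. frechet_derivative f (at x) w)" using Suc.prems(2) by simp
    show "frechet_derivative f (at x) w = frechet_derivative g (at x) w" if "x \<in> U" for x
      using frechet_derivative_at[OF gd[OF that]] by simp
  qed
  ultimately show ?case by simp
qed

lemma ck_on_SucI:
  assumes "open U" "\<And>x. x \<in> U \<Longrightarrow> (f has_derivative f' x) (at x)"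
    and "\<And>w. ck_on k U (\<lambda>x. f' x w)"
  shows "ck_on (Suc k) U f"
proof -
  have "f differentiable_on U"
    using assms(1,2) by (auto simp: differentiable_on_eq_differentiable_at differentiable_def)
  moreover have "ck_on k U (\<lambda>x. frechet_derivative f (at x) w)" for w
    by (rule ck_on_cong[OF assms(1) _ assms(3)[of w]])
       (use frechet_derivative_at[OF assms(2)] in \<open>simp\<close>)
  ultimately show ?thesis by simp
qed

lemma ck_on_SucD:
  assumes "open U" "ck_on (Suc k) U f"
  shows "x \<in> U \<Longrightarrow> (f has_derivative frechet_derivative f (at x)) (at x)"
    and "ck_on k U (\<lambda>x. frechet_derivative f (at x) w)"
  using assms
  by (auto simp: differentiable_on_eq_differentiable_at frechet_derivative_works[symmetric])

lemma ck_on_Suc_imp: "open U \<Longrightarrow> ck_on (Suc k) U f \<Longrightarrow> ck_on k U f"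
proof (induction k arbitrary: f)
  case 0
  then show ?case by (simp add: differentiable_imp_continuous_on)
next
  case (Suc k)
  show ?case
    by (rule ck_on_SucI[OF \<open>open U\<close> ck_on_SucD(1)[OF Suc.prems]]; (assumption)?)
       (rule Suc.IH[OF \<open>open U\<close> ck_on_SucD(2)[OF Suc.prems]])
qed

lemma ck_on_const:
  assumes "open U" shows "ck_on k U (\<lambda>_. c)"
proof (induction k arbitrary: c)
  case (Suc k)
  show ?case by (rule ck_on_SucI[OF assms has_derivative_const]) (rule Suc.IH)
qed simp

lemma smooth_on_const: "open U \<Longrightarrow> smooth_on U (\<lambda>_. c)"
  by (simp add: smooth_on_def ck_on_const)

lemma smooth_on_bounded_linear:
  assumes "open U" "bounded_linear f"
  shows "smooth_on U f"
  unfolding smooth_on_def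
proof
  fix k
  show "ck_on k U f"
  proof (cases k)
    case 0
    then show ?thesis using assms(2) by (simp add: linear_continuous_on)
  next
    case (Suc m)
    show ?thesis unfolding Suc
      by (rule ck_on_SucI[OF assms(1) bounded_linear_imp_has_derivative[OF assms(2)]])
         (rule ck_on_const[OF assms(1)])
  qed
qed

lemma ck_on_add:
  assumes "open U" shows "ck_on k U f \<Longrightarrow> ck_on k U g \<Longrightarrow> ck_on k U (\<lambda>x. f x + g x)"
proof (induction k arbitrary: f g)
  case 0
  then show ?case by (simp add: continuous_on_add)
next
  case (Suc k)
  note d = ck_on_SucD[OF assms Suc.prems(1)] ck_on_SucD[OF assms Suc.prems(2)]
  show ?case
    by (rule ck_on_SucI[OF assms has_derivative_add[OF d(1) d(3)]]; (assumption)?) (rule Suc.IH[OF d(2) d(4)])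
qed

lemma ck_on_scaleR:
  fixes f :: "'a::euclidean_space \<Rightarrow> real"
  assumes "open U" shows "ck_on k U f \<Longrightarrow> ck_on k U g \<Longrightarrow> ck_on k U (\<lambda>x. f x *\<^sub>R g x)"
proof (induction k arbitrary: f g)
  case 0
  then show ?case by (simp add: continuous_on_scaleR)
next
  case (Suc k)
  note d = ck_on_SucD[OF assms Suc.prems(1)] ck_on_SucD[OF assms Suc.prems(2)]
  note e = ck_on_Suc_imp[OF assms Suc.prems(1)] ck_on_Suc_imp[OF assms Suc.prems(2)]
  show ?case
    by (rule ck_on_SucI[OF assms has_derivative_scaleR[OF d(1) d(3)]]; (assumption)?)
       (rule ck_on_add[OF assms Suc.IH[OF e(1) d(4)] Suc.IH[OF d(2) e(2)]])
qed

text \<open>The outer functions range over a family closed under differentiation, because the induction on \<open>k\<close> replaces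
  \<open>\<phi>\<close> by its derivative. The families used are the multiples of real powers and the span of sine and cosine.\<close>

lemma ck_on_compose:
  fixes f :: "'a::euclidean_space \<Rightarrow> real" and \<Phi> :: "(real \<Rightarrow> real) set"
  assumes "open U" "f ` U \<subseteq> V"
    and closed: "\<And>\<phi>. \<phi> \<in> \<Phi> \<Longrightarrow> \<exists>\<phi>'\<in>\<Phi>. \<forall>y\<in>V. (\<phi> has_real_derivative \<phi>' y) (at y)"
  shows "ck_on k U f \<Longrightarrow> \<phi> \<in> \<Phi> \<Longrightarrow> ck_on k U (\<lambda>x. \<phi> (f x))"
proof (induction k arbitrary: \<phi>)
  case 0
  obtain \<phi>' where "\<forall>y\<in>V. (\<phi> has_real_derivative \<phi>' y) (at y)" using closed[OF 0(2)] by (elim bexE)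
  then have "continuous_on V \<phi>"
    by (intro continuous_at_imp_continuous_on ballI) (blast intro: DERIV_isCont)
  then show ?case using 0 assms(2) by (auto intro: continuous_on_compose2)
next
  case (Suc k)
  note d = ck_on_SucD[OF assms(1) Suc.prems(1)]
  note e = ck_on_Suc_imp[OF assms(1) Suc.prems(1)]
  obtain \<phi>' where \<phi>': "\<phi>' \<in> \<Phi>" "\<And>y. y\<in>V \<Longrightarrow> (\<phi> has_real_derivative \<phi>' y) (at y)"
    using closed[OF Suc.prems(2)] by (elim bexE) simp
  have D: "((\<lambda>x. \<phi> (f x)) has_derivative (\<lambda>w. \<phi>' (f x) *\<^sub>R frechet_derivative f (at x) w)) (at x)"
    if "x \<in> U" for x
    using has_derivative_compose[OF d(1)[OF that] \<phi>'(2)[unfolded has_field_derivative_def]]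
      assms(2) that by (auto simp: image_subset_iff)
  show ?case
    by (rule ck_on_SucI[OF assms(1) D]; (assumption)?) (rule ck_on_scaleR[OF assms(1) Suc.IH[OF e \<phi>'(1)] d(2)])
qed

lemma smooth_on_add:
  "open U \<Longrightarrow> smooth_on U f \<Longrightarrow> smooth_on U g \<Longrightarrow> smooth_on U (\<lambda>x. f x + g x)"
  by (simp add: smooth_on_def ck_on_add)

lemma smooth_on_scaleR:
  fixes f :: "'a::euclidean_space \<Rightarrow> real"
  shows "open U \<Longrightarrow> smooth_on U f \<Longrightarrow> smooth_on U g \<Longrightarrow> smooth_on U (\<lambda>x. f x *\<^sub>R g x)"
  by (simp add: smooth_on_def ck_on_scaleR)

lemma smooth_on_mult:
  fixes f :: "'a::euclidean_space \<Rightarrow> real"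
  shows "open U \<Longrightarrow> smooth_on U f \<Longrightarrow> smooth_on U g \<Longrightarrow> smooth_on U (\<lambda>x. f x * g x)"
  using smooth_on_scaleR[of U f g] by simp

lemma smooth_on_diff:
  fixes f :: "'a::euclidean_space \<Rightarrow> real"
  assumes "open U" "smooth_on U f" "smooth_on U g" shows "smooth_on U (\<lambda>x. f x - g x)"
  using smooth_on_add[OF assms(1,2) smooth_on_mult[OF assms(1) smooth_on_const[OF assms(1), of "-1"] assms(3)]]
  by simp

lemma smooth_on_cong:
  "open U \<Longrightarrow> (\<And>x. x \<in> U \<Longrightarrow> f x = g x) \<Longrightarrow> smooth_on U f \<Longrightarrow> smooth_on U g"
  unfolding smooth_on_def using ck_on_cong by blast

lemma smooth_on_powr:
  fixes f :: "'a::euclidean_space \<Rightarrow> real"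
  assumes "open U" "smooth_on U f" "\<And>x. x \<in> U \<Longrightarrow> f x > 0"
  shows "smooth_on U (\<lambda>x. f x powr r)"
proof -
  define \<Phi> :: "(real \<Rightarrow> real) set" where "\<Phi> = {\<lambda>y. c * y powr r | c r. True}"
  have \<Phi>I: "(\<lambda>y. c * y powr r) \<in> \<Phi>" for c r unfolding \<Phi>_def by blast
  have 1: "ck_on k U (\<lambda>x. (\<lambda>y. 1 * y powr r) (f x))" for k
  proof (rule ck_on_compose[OF assms(1), of f "{0<..}" \<Phi>])
    show "\<exists>\<phi>'\<in>\<Phi>. \<forall>y\<in>{0<..}. (\<phi> has_real_derivative \<phi>' y) (at y)" if \<phi>_in: "\<phi> \<in> \<Phi>" for \<phi>
    proof -
      obtain c r where \<phi>: "\<phi> = (\<lambda>y. c * y powr r)" using \<phi>_in unfolding \<Phi>_def by blast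
      show ?thesis
        by (rule bexI[OF _ \<Phi>I[of "c * r" "r - 1"]]) (auto simp: \<phi> intro!: derivative_eq_intros)
    qed
  qed (use assms \<Phi>I[of 1 r] in \<open>auto simp: smooth_on_def\<close>)
  then show ?thesis by (simp add: smooth_on_def)
qed

lemma smooth_on_sqrt:
  fixes f :: "'a::euclidean_space \<Rightarrow> real"
  assumes "open U" "smooth_on U f" "\<And>x. x \<in> U \<Longrightarrow> f x > 0"
  shows "smooth_on U (\<lambda>x. sqrt (f x))"
  by (rule smooth_on_cong[OF assms(1) _ smooth_on_powr[OF assms, of "1/2"]])
     (use assms(3) in \<open>auto simp: powr_half_sqrt less_imp_le\<close>)

lemma smooth_on_inverse:
  fixes f :: "'a::euclidean_space \<Rightarrow> real"
  assumes "open U" "smooth_on U f" "\<And>x. x \<in> U \<Longrightarrow> f x > 0"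
  shows "smooth_on U (\<lambda>x. inverse (f x))"
  by (rule smooth_on_cong[OF assms(1) _ smooth_on_powr[OF assms, of "-1"]])
     (use assms(3) in \<open>auto simp: powr_minus less_imp_le\<close>)

lemma smooth_on_cos_sin:
  shows smooth_on_cos: "smooth_on UNIV (cos :: real \<Rightarrow> real)"
    and smooth_on_sin: "smooth_on UNIV (sin :: real \<Rightarrow> real)"
proof -
  define \<Phi> :: "(real \<Rightarrow> real) set" where "\<Phi> = {\<lambda>y. c * cos y + d * sin y | c d. True}"
  have \<Phi>I: "(\<lambda>y. c * cos y + d * sin y) \<in> \<Phi>" for c d unfolding \<Phi>_def by blast
  have 1: "ck_on k UNIV (\<lambda>x::real. \<phi> (id x))" if "\<phi> \<in> \<Phi>" for k \<phi>
  proof (rule ck_on_compose[of UNIV id UNIV \<Phi>, OF _ _ _ _ that])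
    show "\<exists>\<phi>'\<in>\<Phi>. \<forall>y\<in>UNIV. (\<phi> has_real_derivative \<phi>' y) (at y)" if \<phi>_in: "\<phi> \<in> \<Phi>" for \<phi>
    proof -
      obtain c d where \<phi>: "\<phi> = (\<lambda>y. c * cos y + d * sin y)" using \<phi>_in unfolding \<Phi>_def by blast
      show ?thesis
        by (rule bexI[OF _ \<Phi>I[of d "- c"]]) (auto simp: \<phi> intro!: derivative_eq_intros)
    qed
    show "ck_on k UNIV (id :: real \<Rightarrow> real)"
      using smooth_on_bounded_linear[of UNIV "id :: real \<Rightarrow> real"] by (simp add: smooth_on_def id_def)
  qed auto
  from 1[OF \<Phi>I[of 1 0]] 1[OF \<Phi>I[of 0 1]]
  show "smooth_on UNIV (cos :: real \<Rightarrow> real)" "smooth_on UNIV (sin :: real \<Rightarrow> real)"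
    by (simp_all add: smooth_on_def)
qed

lemma vector_3_axes:
  "(vector [x, y, z] :: real^3) = x *\<^sub>R axis 1 1 + y *\<^sub>R axis 2 1 + z *\<^sub>R axis 3 1"
  by (simp add: vec_eq_iff forall_3 vector_3 axis_def)

lemma smooth_on_vector_3:
  assumes "open U" "smooth_on U f" "smooth_on U g" "smooth_on U h"
  shows "smooth_on U (\<lambda>t. vector [f t, g t, h t] :: real^3)"
  unfolding vector_3_axes
  by (intro smooth_on_add smooth_on_scaleR smooth_on_const assms)

lemma smooth_on_ck1:
  assumes "open U" "smooth_on U f"
  shows "x \<in> U \<Longrightarrow> (f has_derivative frechet_derivative f (at x)) (at x)"
    and "smooth_on U (\<lambda>x. frechet_derivative f (at x) w)"
  using assms ck_on_SucD[of U _ f] unfolding smooth_on_def by blast+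

lemma smooth_on_UNIV_vector_derivative:
  fixes f :: "real \<Rightarrow> 'b::real_normed_vector"
  assumes "smooth_on UNIV f"
  shows "(f has_vector_derivative vector_derivative f (at t)) (at t)"
    and "continuous_on UNIV (\<lambda>t. vector_derivative f (at t))"
proof -
  have d: "(f has_vector_derivative frechet_derivative f (at t) 1) (at t)" for t
  proof -
    note D = smooth_on_ck1(1)[OF open_UNIV assms UNIV_I, of t]
    have "frechet_derivative f (at t) h = h *\<^sub>R frechet_derivative f (at t) 1" for h
      using linear_scale[OF has_derivative_linear[OF D], of h 1] by simp
    then have "frechet_derivative f (at t) = (\<lambda>h. h *\<^sub>R frechet_derivative f (at t) 1)"
      by (rule ext)
    then show ?thesis unfolding has_vector_derivative_def using D by simp
  qed
  have e: "frechet_derivative f (at t) 1 = vector_derivative f (at t)" for t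
    using vector_derivative_at[OF d] by simp
  show "(f has_vector_derivative vector_derivative f (at t)) (at t)" using d by (simp add: e)
  have "ck_on 0 UNIV (\<lambda>t. frechet_derivative f (at t) 1)"
    using smooth_on_ck1(2)[OF open_UNIV assms] by (simp only: smooth_on_def)
  then show "continuous_on UNIV (\<lambda>t. vector_derivative f (at t))" by (simp add: e)
qed

section \<open>Partial derivatives and graph charts\<close>

lemma partial_derivatives_eq:
  assumes "(X has_derivative D) (at q)"
  shows "du X q = D (1, 0)" and "dv X q = D (0, 1)"
proof -
  obtain u v where q: "q = (u, v)" by force
  interpret D: bounded_linear D using assms by (rule has_derivative_bounded_linear)
  have "((\<lambda>s. X (s, v)) has_derivative (\<lambda>h. D (h, 0))) (at u)"
    by (rule has_derivative_compose[of "\<lambda>s. (s, v)" "\<lambda>h. (h, 0)" u UNIV X D])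
       (use assms in \<open>simp_all add: q has_derivative_Pair\<close>)
  moreover have "(\<lambda>h. D (h, 0)) = (\<lambda>h. h *\<^sub>R D (1, 0))"
  proof
    fix h show "D (h, 0) = h *\<^sub>R D (1, 0)" using D.scaleR[of h "(1, 0)"] by simp
  qed
  ultimately show "du X q = D (1, 0)"
    by (simp add: du_def q has_vector_derivative_def vector_derivative_at)
  have "((\<lambda>s. X (u, s)) has_derivative (\<lambda>h. D (0, h))) (at v)"
    by (rule has_derivative_compose[of "\<lambda>s. (u, s)" "\<lambda>h. (0, h)" v UNIV X D])
       (use assms in \<open>simp_all add: q has_derivative_Pair\<close>)
  moreover have "(\<lambda>h. D (0, h)) = (\<lambda>h. h *\<^sub>R D (0, 1))"
  proof
    fix h show "D (0, h) = h *\<^sub>R D (0, 1)" using D.scaleR[of h "(0, 1)"] by simp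
  qed
  ultimately show "dv X q = D (0, 1)"
    by (simp add: dv_def q has_vector_derivative_def vector_derivative_at)
qed

lemma has_derivative_du_dv:
  assumes "(X has_derivative D) (at q)"
  shows "(X has_derivative (\<lambda>w. fst w *\<^sub>R du X q + snd w *\<^sub>R dv X q)) (at q)"
proof -
  interpret D: bounded_linear D using assms by (rule has_derivative_bounded_linear)
  have "D w = fst w *\<^sub>R du X q + snd w *\<^sub>R dv X q" for w
  proof -
    have "w = fst w *\<^sub>R (1, 0) + snd w *\<^sub>R (0, 1)" by (simp add: prod_eq_iff)
    then show ?thesis by (metis D.add D.scaleR partial_derivatives_eq[OF assms])
  qed
  then have "D = (\<lambda>w. fst w *\<^sub>R du X q + snd w *\<^sub>R dv X q)" by (rule ext)
  then show ?thesis using assms by simp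
qed

lemma smooth_on_du_dv:
  assumes "open U" "smooth_on U X"
  shows "smooth_on U (du X)" and "smooth_on U (dv X)"
proof -
  note d = partial_derivatives_eq[OF smooth_on_ck1(1)[OF assms]]
  show "smooth_on U (du X)"
    by (rule smooth_on_cong[OF assms(1) _ smooth_on_ck1(2)[OF assms, of "(1,0)"]]) (simp add: d)
  show "smooth_on U (dv X)"
    by (rule smooth_on_cong[OF assms(1) _ smooth_on_ck1(2)[OF assms, of "(0,1)"]]) (simp add: d)
qed

lemma smooth_has_derivative:
  assumes "open U" "smooth_on U X" "q \<in> U"
  shows "(X has_derivative (\<lambda>w. fst w *\<^sub>R du X q + snd w *\<^sub>R dv X q)) (at q)"
  using has_derivative_du_dv[OF smooth_on_ck1(1)[OF assms]] .

definition unit_disc :: "(real \<times> real) set" where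
  "unit_disc = {(u, v). u\<^sup>2 + v\<^sup>2 < 1}"

text \<open>With \<open>e1\<close>, \<open>e2\<close>, \<open>e3\<close> the semi-axes in any order and the last one of either sign, these six charts cover
  the ellipsoid, and one verification serves them all.\<close>

definition graph_chart :: "real^3 \<Rightarrow> real^3 \<Rightarrow> real^3 \<Rightarrow> real \<times> real \<Rightarrow> real^3" where
  "graph_chart e1 e2 e3 = (\<lambda>(u, v). u *\<^sub>R e1 + v *\<^sub>R e2 + sqrt (1 - u\<^sup>2 - v\<^sup>2) *\<^sub>R e3)"

definition frame_sphere :: "real^3 \<Rightarrow> real^3 \<Rightarrow> real^3 \<Rightarrow> (real^3) set" where
  "frame_sphere e1 e2 e3 =
     {x *\<^sub>R e1 + y *\<^sub>R e2 + z *\<^sub>R e3 | x y z. x\<^sup>2 + y\<^sup>2 + z\<^sup>2 = 1}"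

lemma open_unit_disc: "open unit_disc"
  unfolding unit_disc_def case_prod_unfold
  by (intro open_Collect_less continuous_intros)

lemma smooth_on_graph_height:
  "smooth_on unit_disc (\<lambda>q. 1 - (fst q)\<^sup>2 - (snd q)\<^sup>2)"
  unfolding power2_eq_square
  by (intro smooth_on_diff smooth_on_mult smooth_on_const smooth_on_bounded_linear open_unit_disc
      bounded_linear_fst bounded_linear_snd)

lemma smooth_on_graph_chart: "smooth_on unit_disc (graph_chart e1 e2 e3)"
proof -
  have "smooth_on unit_disc (\<lambda>q. fst q *\<^sub>R e1 + snd q *\<^sub>R e2 + sqrt (1 - (fst q)\<^sup>2 - (snd q)\<^sup>2) *\<^sub>R e3)"
    by (intro smooth_on_add smooth_on_scaleR smooth_on_const smooth_on_bounded_linear open_unit_disc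
        bounded_linear_fst bounded_linear_snd smooth_on_sqrt smooth_on_graph_height)
       (auto simp: unit_disc_def)
  then show ?thesis by (simp add: graph_chart_def case_prod_unfold)
qed

text \<open>The \<open>e1\<close> and \<open>e2\<close> components of the partial derivatives are constant, so the coordinates of a tangent vector in the
  chart are just its first two components in the frame.\<close>

lemma graph_chart_partial_derivatives:
  assumes "(u, v) \<in> unit_disc"
  defines "h \<equiv> sqrt (1 - u\<^sup>2 - v\<^sup>2)"
  shows "du (graph_chart e1 e2 e3) (u, v) = e1 - (u / h) *\<^sub>R e3"
    and "dv (graph_chart e1 e2 e3) (u, v) = e2 - (v / h) *\<^sub>R e3"
proof -
  have pos: "1 - u\<^sup>2 - v\<^sup>2 > 0" using assms(1) by (simp add: unit_disc_def)
  then have "h > 0" by (simp add: h_def)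
  have "((\<lambda>q. 1 - (fst q)\<^sup>2 - (snd q)\<^sup>2) has_derivative (\<lambda>w. - (2 * u * fst w) - 2 * v * snd w)) (at (u, v))"
    unfolding power2_eq_square
    by (rule has_derivative_eq_rhs[OF has_derivative_diff[OF has_derivative_diff[OF has_derivative_const
          has_derivative_mult[OF has_derivative_fst has_derivative_fst]]
          has_derivative_mult[OF has_derivative_snd has_derivative_snd]]];
        (rule has_derivative_ident)?) (auto simp: fun_eq_iff algebra_simps)
  moreover have "DERIV sqrt (1 - (fst (u, v))\<^sup>2 - (snd (u, v))\<^sup>2) :> inverse h / 2"
    using DERIV_real_sqrt[OF pos] by (simp add: h_def)
  ultimately have "((\<lambda>q. sqrt (1 - (fst q)\<^sup>2 - (snd q)\<^sup>2)) has_derivative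
      (\<lambda>w. (- (2 * u * fst w) - 2 * v * snd w) * (inverse h / 2))) (at (u, v))"
    by (rule DERIV_compose_FDERIV[rotated])
  then have "((\<lambda>q. fst q *\<^sub>R e1 + snd q *\<^sub>R e2 + sqrt (1 - (fst q)\<^sup>2 - (snd q)\<^sup>2) *\<^sub>R e3) has_derivative
     (\<lambda>w. fst w *\<^sub>R e1 + snd w *\<^sub>R e2 + ((- (2 * u * fst w) - 2 * v * snd w) * (inverse h / 2)) *\<^sub>R e3)) (at (u, v))"
    by (intro has_derivative_add has_derivative_scaleR_left bounded_linear_imp_has_derivative
        bounded_linear_fst bounded_linear_snd)
  then have "((\<lambda>q. fst q *\<^sub>R e1 + snd q *\<^sub>R e2 + sqrt (1 - (fst q)\<^sup>2 - (snd q)\<^sup>2) *\<^sub>R e3) has_derivative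
     (\<lambda>w. fst w *\<^sub>R e1 + snd w *\<^sub>R e2 + (- (u * fst w + v * snd w) / h) *\<^sub>R e3)) (at (u, v))"
  proof (rule has_derivative_eq_rhs)
    have "(- (2 * u * x) - 2 * v * y) * (inverse h / 2) = - (u * x + v * y) / h" for x y
      using \<open>h > 0\<close> by (simp add: field_simps)
    then show "(\<lambda>w. fst w *\<^sub>R e1 + snd w *\<^sub>R e2 +
         ((- (2 * u * fst w) - 2 * v * snd w) * (inverse h / 2)) *\<^sub>R e3) =
       (\<lambda>w. fst w *\<^sub>R e1 + snd w *\<^sub>R e2 + (- (u * fst w + v * snd w) / h) *\<^sub>R e3)"
      by (simp only:)
  qed
  then have "(graph_chart e1 e2 e3 has_derivative
     (\<lambda>w. fst w *\<^sub>R e1 + snd w *\<^sub>R e2 + (- (u * fst w + v * snd w) / h) *\<^sub>R e3)) (at (u, v))"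
    by (simp add: graph_chart_def case_prod_unfold)
  from partial_derivatives_eq[OF this]
  show "du (graph_chart e1 e2 e3) (u, v) = e1 - (u / h) *\<^sub>R e3"
    and "dv (graph_chart e1 e2 e3) (u, v) = e2 - (v / h) *\<^sub>R e3" by simp_all
qed

text \<open>The inverse chart is the restriction of a linear map: the dual basis of \<open>e1\<close>, \<open>e2\<close>, \<open>e3\<close> is given by the cross
  products divided by the determinant.\<close>

lemma local_param_graph_chart:
  assumes ndg: "cross3 e1 e2 \<bullet> e3 \<noteq> 0"
  shows "local_param (frame_sphere e1 e2 e3) unit_disc (graph_chart e1 e2 e3)"
    and "graph_chart e1 e2 e3 ` unit_disc =
      {p \<in> frame_sphere e1 e2 e3. (cross3 e1 e2 \<bullet> p) / (cross3 e1 e2 \<bullet> e3) > 0}"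
proof -
  let ?S = "frame_sphere e1 e2 e3" and ?X = "graph_chart e1 e2 e3" and ?U = unit_disc
  define \<delta> where "\<delta> = cross3 e1 e2 \<bullet> e3"
  \<comment> \<open>The dual basis, up to the factor \<open>\<delta>\<close>.\<close>
  define f1 f2 f3 where "f1 = cross3 e2 e3" and "f2 = cross3 e3 e1" and "f3 = cross3 e1 e2"
  have \<delta>: "\<delta> \<noteq> 0" using ndg by (simp add: \<delta>_def)
  have dots: "f1 \<bullet> e1 = \<delta>" "f1 \<bullet> e2 = 0" "f1 \<bullet> e3 = 0" "f2 \<bullet> e1 = 0" "f2 \<bullet> e2 = \<delta>" "f2 \<bullet> e3 = 0"
    "f3 \<bullet> e1 = 0" "f3 \<bullet> e2 = 0" "f3 \<bullet> e3 = \<delta>"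
    by (simp_all add: f1_def f2_def f3_def \<delta>_def cross3_def inner_vec_def sum_3 vector_3 algebra_simps)
  define Y where "Y p = (f1 \<bullet> p / \<delta>, f2 \<bullet> p / \<delta>)" for p
  have coords: "f1 \<bullet> (x *\<^sub>R e1 + y *\<^sub>R e2 + z *\<^sub>R e3) / \<delta> = x"
    "f2 \<bullet> (x *\<^sub>R e1 + y *\<^sub>R e2 + z *\<^sub>R e3) / \<delta> = y"
    "f3 \<bullet> (x *\<^sub>R e1 + y *\<^sub>R e2 + z *\<^sub>R e3) / \<delta> = z" for x y z
    using \<delta> by (simp_all add: inner_add_right dots)
  have img: "?X ` ?U = {p \<in> ?S. f3 \<bullet> p / \<delta> > 0}"
  proof (intro equalityI subsetI)
    fix p assume "p \<in> ?X ` ?U"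
    then obtain u v where uv: "u\<^sup>2 + v\<^sup>2 < 1" "p = ?X (u, v)" by (auto simp: unit_disc_def)
    have "p \<in> ?S"
      unfolding frame_sphere_def mem_Collect_eq
      by (rule exI[of _ u], rule exI[of _ v], rule exI[of _ "sqrt (1 - u\<^sup>2 - v\<^sup>2)"])
         (use uv in \<open>simp add: graph_chart_def\<close>)
    then show "p \<in> {p \<in> ?S. f3 \<bullet> p / \<delta> > 0}"
      using uv by (simp add: graph_chart_def coords)
  next
    fix p assume "p \<in> {p \<in> ?S. f3 \<bullet> p / \<delta> > 0}"
    then obtain x y z where xyz: "p = x *\<^sub>R e1 + y *\<^sub>R e2 + z *\<^sub>R e3" "x\<^sup>2 + y\<^sup>2 + z\<^sup>2 = 1" "z > 0"
      by (auto simp: frame_sphere_def coords)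
    have "z\<^sup>2 > 0" using xyz by simp
    moreover have "sqrt (1 - x\<^sup>2 - y\<^sup>2) = z"
      using xyz by (intro real_sqrt_unique) (auto simp: algebra_simps)
    ultimately show "p \<in> ?X ` ?U"
      using xyz by (intro image_eqI[of _ _ "(x, y)"]) (auto simp: graph_chart_def unit_disc_def)
  qed
  then show "?X ` ?U = {p \<in> ?S. (cross3 e1 e2 \<bullet> p) / (cross3 e1 e2 \<bullet> e3) > 0}"
    by (simp add: f3_def \<delta>_def)
  have "?X ` ?U = ?S \<inter> {p. f3 \<bullet> p / \<delta> > 0}" using img by auto
  moreover have "open {p. f3 \<bullet> p / \<delta> > 0}"
    unfolding divide_inverse by (intro open_Collect_less continuous_intros)
  ultimately have opn: "openin (top_of_set ?S) (?X ` ?U)"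
    by (simp add: openin_open_Int)
  have "homeomorphism ?U (?X ` ?U) ?X Y"
  proof
    show "continuous_on ?U ?X"
      using smooth_on_graph_chart[of e1 e2 e3] by (simp add: smooth_on_def) (metis ck_on.simps(1))
    show "continuous_on (?X ` ?U) Y"
      unfolding Y_def divide_inverse by (intro continuous_intros)
    have YX: "Y (?X q) = q" for q
      by (cases q) (simp add: Y_def graph_chart_def coords)
    show "Y ` ?X ` ?U \<subseteq> ?U" by (auto simp: YX)
    show "\<And>x. x \<in> ?U \<Longrightarrow> Y (?X x) = x" by (rule YX)
    show "\<And>y. y \<in> ?X ` ?U \<Longrightarrow> ?X (Y y) = y" by (auto simp: YX)
  qed auto
  moreover have "cross3 (du ?X q) (dv ?X q) \<noteq> 0" if "q \<in> ?U" for q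
  proof -
    obtain u v where q: "q = (u, v)" by force
    have "cross3 (e1 - s *\<^sub>R e3) (e2 - t *\<^sub>R e3) \<bullet> e3 = \<delta>" for s t
      by (simp add: \<delta>_def cross3_def inner_vec_def sum_3 vector_3 algebra_simps)
    then show ?thesis
      using graph_chart_partial_derivatives[of u v e1 e2 e3] that \<delta> q
      by (metis inner_zero_left)
  qed
  ultimately show "local_param ?S ?U ?X"
    unfolding local_param_def using open_unit_disc smooth_on_graph_chart opn by blast
qed

section \<open>Zeros of functions along a curve\<close>

lemma linear_ode_zero_near:
  fixes f k :: "real \<Rightarrow> real"
  assumes "x < y" "t0 \<in> {x<..<y}" "f t0 = 0"
    and "\<And>t. t \<in> {x..y} \<Longrightarrow> (f has_real_derivative k t * f t) (at t)"
    and "continuous_on {x..y} k"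
    and "t \<in> {x..y}"
  shows "f t = 0"
proof -
  \<comment> \<open>\<open>exp (- K)\<close> is an integrating factor.\<close>
  obtain K where K: "\<And>t. t \<in> {x..y} \<Longrightarrow> (K has_vector_derivative k t) (at t within {x..y})"
    using antiderivative_continuous[OF assms(5)] by blast
  have "\<exists>C. \<forall>s\<in>{x..y}. f s * exp (- K s) = C"
  proof (rule has_derivative_zero_constant)
    show "((\<lambda>s. f s * exp (- K s)) has_derivative (\<lambda>_. 0)) (at s within {x..y})" if "s \<in> {x..y}" for s
    proof -
      have "(K has_real_derivative k s) (at s within {x..y})"
        using K[OF that] by (simp add: has_real_derivative_iff_has_vector_derivative)
      then have "((\<lambda>s. f s * exp (- K s)) has_real_derivative
          (k s * f s) * exp (- K s) + (exp (- K s) * (- k s)) * f s) (at s within {x..y})"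
        by (intro derivative_intros has_field_derivative_at_within[OF assms(4)[OF that]])
      then show ?thesis by (simp add: has_field_derivative_def algebra_simps lambda_zero)
    qed
  qed simp
  then obtain C where C: "\<And>s. s \<in> {x..y} \<Longrightarrow> f s * exp (- K s) = C" by blast
  have "C = 0" using C[of t0] assms(2,3) by simp
  then show ?thesis using C[OF assms(6)] by simp
qed

text \<open>The set of double zeros is closed. It is also open: near a double zero \<open>f' = (h / g) f\<close> is a linear differential
  equation with continuous coefficient. Mere zeros of \<open>f\<close> do not propagate: \<open>g\<close> may vanish at a simple zero.\<close>

lemma first_order_zero_propagation:
  fixes f f' g h :: "real \<Rightarrow> real"
  assumes "open I" "connected I" and "t0 \<in> I" "f t0 = 0" "f' t0 = 0"
    and der: "\<And>t. t \<in> I \<Longrightarrow> (f has_real_derivative f' t) (at t)"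
    and ode: "\<And>t. t \<in> I \<Longrightarrow> f' t * g t = h t * f t"
    and cont: "continuous_on I f'" "continuous_on I g" "continuous_on I h"
    and nz: "\<And>t. t \<in> I \<Longrightarrow> f t = 0 \<Longrightarrow> f' t = 0 \<Longrightarrow> g t \<noteq> 0"
    and "t \<in> I"
  shows "f t = 0"
proof -
  define Z where "Z = {t \<in> I. f t = 0 \<and> f' t = 0}"
  have cf: "continuous_on I f"
    using der by (intro continuous_at_imp_continuous_on ballI) (blast intro: DERIV_isCont)
  have "closedin (top_of_set I) {t \<in> I. f t = 0}" "closedin (top_of_set I) {t \<in> I. f' t = 0}"
    using continuous_closedin_preimage_constant[OF cf, of 0]
      continuous_closedin_preimage_constant[OF cont(1), of 0] by simp_all
  then have "closedin (top_of_set I) ({t \<in> I. f t = 0} \<inter> {t \<in> I. f' t = 0})" by (rule closedin_Int)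
  then have "closedin (top_of_set I) Z" by (simp add: Z_def Collect_conj_eq Int_ac)
  moreover have "openin (top_of_set I) Z"
  proof (subst openin_open_eq[OF \<open>open I\<close>], intro conjI)
    show "Z \<subseteq> I" by (auto simp: Z_def)
    show "open Z"
      unfolding open_contains_ball
    proof
      fix s assume s: "s \<in> Z"
      then have "s \<in> I" "g s \<noteq> 0" using nz by (auto simp: Z_def)
      moreover have "open {t \<in> I. g t \<noteq> 0}"
      proof -
        have "open (- {0 :: real})" by (rule open_Compl) simp
        from continuous_open_preimage[OF cont(2) \<open>open I\<close> this]
        have "open (I \<inter> g -` (- {0}))" .
        moreover have "I \<inter> g -` (- {0}) = {t \<in> I. g t \<noteq> 0}" by auto
        ultimately show ?thesis by simp
      qed
      ultimately obtain e where e: "e > 0" "cball s e \<subseteq> {t \<in> I. g t \<noteq> 0}"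
        using open_contains_cball_eq[of "{t \<in> I. g t \<noteq> 0}"] by blast
      have sub: "{s - e..s + e} \<subseteq> {t \<in> I. g t \<noteq> 0}"
        using e(2) by (simp add: cball_eq_atLeastAtMost)
      have "f t = 0" if "t \<in> {s - e..s + e}" for t
      proof (rule linear_ode_zero_near[of "s - e" "s + e" s f "\<lambda>t. h t / g t"])
        show "(f has_real_derivative h t / g t * f t) (at t)" if "t \<in> {s - e..s + e}" for t
        proof -
          have tI: "t \<in> I" "g t \<noteq> 0" using sub that by auto
          have "h t / g t * f t = f' t" using ode[OF tI(1)] tI(2) by (simp add: field_simps)
          then show ?thesis using der[OF tI(1)] by simp
        qed
        show "continuous_on {s - e..s + e} (\<lambda>t. h t / g t)"
          using sub by (intro continuous_on_divide continuous_on_subset[OF cont(3)]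
              continuous_on_subset[OF cont(2)]) auto
      qed (use e s that in \<open>auto simp: Z_def\<close>)
      moreover have "f' t = 0" if "t \<in> ball s e" for t
      proof -
        have "t \<in> {s - e..s + e}" using that by (auto simp: ball_eq_greaterThanLessThan)
        then have "t \<in> I" using sub by blast
        have "((\<lambda>_. 0) has_real_derivative f' t) (at t)"
          by (rule has_field_derivative_transform_within_open[OF der[OF \<open>t \<in> I\<close>] open_ball that])
             (use \<open>\<And>t. t \<in> {s - e..s + e} \<Longrightarrow> f t = 0\<close> in \<open>auto simp: ball_eq_greaterThanLessThan\<close>)
        then show ?thesis using DERIV_unique[OF _ DERIV_const] by blast
      qed
      moreover have "ball s e \<subseteq> {s - e..s + e}" "{s - e..s + e} \<subseteq> I"
        using sub by (auto simp: ball_eq_greaterThanLessThan)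
      ultimately have "ball s e \<subseteq> Z" unfolding Z_def by blast
      then show "\<exists>e>0. ball s e \<subseteq> Z" using e(1) by blast
    qed
  qed
  ultimately have "Z = {} \<or> Z = I" using \<open>connected I\<close> by (auto simp: connected_clopen)
  then have "Z = I" using assms(3-5) by (auto simp: Z_def)
  then show ?thesis using \<open>t \<in> I\<close> by (auto simp: Z_def)
qed

text \<open>Used to recognize tangency: a curve that meets a plane in uncountably many points is somewhere tangent to it.\<close>

lemma countable_simple_zeros:
  fixes f f' :: "real \<Rightarrow> real"
  assumes "\<And>t. (f has_real_derivative f' t) (at t)"
    and "\<And>t. f t = 0 \<Longrightarrow> f' t \<noteq> 0"
  shows "countable {t. f t = 0}"
proof -
  have "\<not> t islimpt {t. f t = 0}" for t
  proof
    assume L: "t islimpt {t. f t = 0}"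
    have "continuous_on UNIV f"
      by (intro continuous_at_imp_continuous_on ballI DERIV_isCont[OF assms(1)])
    then have cl: "closed {t. f t = 0}"
      using continuous_closed_preimage_constant[of UNIV f 0] by simp
    then have "f t = 0" using L closed_limpt by blast
    from L obtain x where x: "\<And>n. x n \<in> {t. f t = 0} - {t}" "x \<longlonglongrightarrow> t"
      by (auto simp: islimpt_sequential)
    have "((\<lambda>y. (f y - f t) / (y - t)) \<longlongrightarrow> f' t) (at t)"
      using assms(1)[of t] by (simp add: has_field_derivative_iff)
    then have "(\<lambda>n. (f (x n) - f t) / (x n - t)) \<longlonglongrightarrow> f' t"
      using x unfolding tendsto_at_iff_sequentially comp_def by fast
    then have "f' t = 0" using x(1) \<open>f t = 0\<close> by (simp add: LIMSEQ_const_iff)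
    then show False using assms(2) \<open>f t = 0\<close> by blast
  qed
  then have "{t. f t = 0} sparse_in UNIV" unfolding sparse_in_def by blast
  from sparse_imp_countable[OF open_UNIV this] show ?thesis by simp
qed

lemma nonvanishing_same_sign:
  fixes f :: "real \<Rightarrow> real"
  assumes "continuous_on UNIV f" "\<And>t. f t \<noteq> 0" "f s > 0"
  shows "f t > 0"
proof (rule ccontr)
  assume "\<not> f t > 0"
  then have "f t < 0" using assms(2)[of t] by auto
  have "connected (range f)" by (rule connected_continuous_image[OF assms(1)]) simp
  then have "0 \<in> range f"
    using connectedD_interval[of "range f" "f t" "f s" 0] \<open>f t < 0\<close> assms(3) by auto
  then show False using assms(2) by (metis imageE)
qed

section \<open>Curves given by coordinates\<close>

lemma has_vector_derivative_vector_3: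
  assumes "(f has_real_derivative f') (at t)" "(g has_real_derivative g') (at t)"
    "(h has_real_derivative h') (at t)"
  shows "((\<lambda>t. vector [f t, g t, h t] :: real^3) has_vector_derivative vector [f', g', h']) (at t)"
  unfolding vector_3_axes using assms
  by (auto intro!: derivative_eq_intros simp: has_real_derivative_iff_has_vector_derivative)

lemma tendsto_vector_3:
  assumes "(f \<longlongrightarrow> x) F" "(g \<longlongrightarrow> y) F" "(h \<longlongrightarrow> z) F"
  shows "((\<lambda>t. vector [f t, g t, h t] :: real^3) \<longlongrightarrow> vector [x, y, z]) F"
  unfolding vector_3_axes by (intro tendsto_intros assms)

lemma smooth_on_real_derivative:
  fixes f :: "real \<Rightarrow> real"
  assumes "smooth_on UNIV f"
  obtains f' where "\<And>t. (f has_real_derivative f' t) (at t)"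
proof -
  have "(f has_real_derivative vector_derivative f (at t)) (at t)" for t
    using smooth_on_UNIV_vector_derivative(1)[OF assms]
    by (simp add: has_real_derivative_iff_has_vector_derivative)
  then show ?thesis by (rule that)
qed

lemma smooth_on_id: "smooth_on UNIV (\<lambda>t::real. t)"
  by (rule smooth_on_bounded_linear) (simp_all add: bounded_linear_ident)

text \<open>\<open>s(t) = r t / sqrt(1 + t\<^sup>2)\<close> maps the line diffeomorphically onto an interval, so \<open>(s, w)\<close> immerses the whole line onto
  an open arc of the unit circle.\<close>

lemma arc_functions:
  fixes r :: real
  assumes "0 < r" "r < 1"
  obtains s w s' w' :: "real \<Rightarrow> real" where
    "smooth_on UNIV s" "smooth_on UNIV w"
    "\<And>t. (s has_real_derivative s' t) (at t)" "\<And>t. (w has_real_derivative w' t) (at t)"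
    "\<And>t. s' t \<noteq> 0" "\<And>t. (s t)\<^sup>2 + (w t)\<^sup>2 = 1" "\<And>t. w t > 0"
    "range s = {-r<..<r}" "(s \<longlongrightarrow> r) at_top" "(w \<longlongrightarrow> sqrt (1 - r\<^sup>2)) at_top"
proof -
  define h :: "real \<Rightarrow> real" where "h t = sqrt (1 + t\<^sup>2)" for t
  have pos: "1 + t\<^sup>2 > 0" for t :: real by (simp add: add_pos_nonneg)
  have h: "h t > 0" "(h t)\<^sup>2 = 1 + t\<^sup>2" for t using pos[of t] by (simp_all add: h_def)
  have ht: "\<bar>t\<bar> < h t" for t
    by (rule power2_less_imp_less) (use h[of t] in auto)
  define s where "s t = r * t * inverse (h t)" for t
  have s2: "(s t)\<^sup>2 < r\<^sup>2" for t
  proof -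
    have "\<bar>s t\<bar> = r * (\<bar>t\<bar> / h t)" using h(1)[of t] assms by (simp add: s_def abs_mult divide_inverse)
    also have "\<dots> < r * 1" using assms ht[of t] h(1)[of t] by (intro mult_strict_left_mono) auto
    finally show ?thesis using assms by (simp add: abs_less_iff abs_le_square_iff power2_strict_mono)
  qed
  have r2: "r\<^sup>2 < 1" using assms by (simp add: power_less_one_iff)
  define w where "w t = sqrt (1 - (s t)\<^sup>2)" for t
  have w0: "1 - (s t)\<^sup>2 > 0" for t using s2[of t] r2 by linarith
  have sm_h: "smooth_on UNIV h"
    unfolding h_def[abs_def] power2_eq_square
    by (intro smooth_on_sqrt smooth_on_add smooth_on_mult smooth_on_const smooth_on_id open_UNIV)
       (use pos in \<open>simp add: power2_eq_square\<close>)
  have sm_s: "smooth_on UNIV s"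
    unfolding s_def[abs_def]
    by (intro smooth_on_mult smooth_on_const smooth_on_id smooth_on_inverse sm_h h open_UNIV)
  have sm_w: "smooth_on UNIV w"
    unfolding w_def[abs_def]
    by (intro smooth_on_sqrt smooth_on_diff smooth_on_const w0 open_UNIV)
       (simp add: power2_eq_square smooth_on_mult sm_s)
  define s' where "s' t = r / (h t) ^ 3" for t
  have dh: "(h has_real_derivative t / h t) (at t)" for t
  proof -
    have "((\<lambda>t. 1 + t\<^sup>2) has_real_derivative 2 * t) (at t)"
      by (auto intro!: derivative_eq_intros)
    from DERIV_chain2[OF DERIV_real_sqrt[OF pos] this]
    show ?thesis unfolding h_def[abs_def] by (rule DERIV_cong) (simp add: field_simps)
  qed
  have ds: "(s has_real_derivative s' t) (at t)" for t
  proof -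
    have "(s has_real_derivative r * inverse (h t) + (- (inverse (h t) * (t / h t) * inverse (h t))) * (r * t)) (at t)"
      unfolding s_def[abs_def]
      by (rule DERIV_cong[OF DERIV_mult[OF DERIV_cmult[OF DERIV_ident, of r] DERIV_inverse'[OF dh]]])
         (use h(1)[of t] in auto)
    also have "r * inverse (h t) + (- (inverse (h t) * (t / h t) * inverse (h t))) * (r * t) = s' t"
    proof -
      have "r * inverse (h t) + (- (inverse (h t) * (t / h t) * inverse (h t))) * (r * t)
          = r * ((h t)\<^sup>2 - t\<^sup>2) / (h t) ^ 3"
        using h(1)[of t] by (simp add: field_simps power2_eq_square power3_eq_cube)
      then show ?thesis by (simp add: h(2) s'_def)
    qed
    finally show ?thesis .
  qed
  obtain w' where dw: "\<And>t. (w has_real_derivative w' t) (at t)"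
    using smooth_on_real_derivative[OF sm_w] by blast
  have rng: "range s = {-r<..<r}"
  proof (intro equalityI subsetI)
    fix y assume "y \<in> range s"
    then obtain t where "y = s t" by blast
    then have "\<bar>y\<bar> < \<bar>r\<bar>" using s2[of t] abs_le_square_iff[of r "s t"] by linarith
    then show "y \<in> {-r<..<r}" using assms by auto
  next
    fix y assume y: "y \<in> {-r<..<r}"
    define e where "e = y / r"
    have e: "\<bar>e\<bar> < 1" using y assms by (auto simp: e_def abs_less_iff field_simps)
    then have e2: "1 - e\<^sup>2 > 0" by (simp add: abs_square_less_1)
    define t where "t = e / sqrt (1 - e\<^sup>2)"
    have "1 + t\<^sup>2 = 1 / (1 - e\<^sup>2)" using e2 by (simp add: t_def power_divide field_simps)
    then have "h t = 1 / sqrt (1 - e\<^sup>2)" by (simp add: h_def real_sqrt_divide)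
    then have "s t = r * e" using e2 by (simp add: s_def t_def)
    then have "y = s t" using assms by (simp add: e_def)
    then show "y \<in> range s" by blast
  qed
  have ls: "(s \<longlongrightarrow> r) at_top"
  proof -
    have "((\<lambda>t. r * t * inverse (sqrt (1 + t\<^sup>2))) \<longlongrightarrow> r) at_top"
      using assms by real_asymp
    then show ?thesis by (simp add: s_def[abs_def] h_def)
  qed
  have lw: "(w \<longlongrightarrow> sqrt (1 - r\<^sup>2)) at_top"
    unfolding w_def[abs_def] by (intro tendsto_intros ls)
  show ?thesis
  proof (rule that[OF sm_s sm_w ds dw _ _ _ rng ls lw])
    show "s' t \<noteq> 0" for t using h(1)[of t] assms by (simp add: s'_def)
    show "w t > 0" for t using w0[of t] by (simp add: w_def)
    show "(s t)\<^sup>2 + (w t)\<^sup>2 = 1" for t using w0[of t] by (simp add: w_def)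
  qed
qed

lemma cos_sin_derivatives:
  "(cos has_real_derivative - sin t) (at t)" "(sin has_real_derivative cos t) (at t)"
  "((\<lambda>t. k * cos t) has_real_derivative - k * sin t) (at t)"
  "((\<lambda>t. k * sin t) has_real_derivative k * cos t) (at t)" for k t :: real
  by (auto intro!: derivative_eq_intros)

lemma sq_root_cases: "x\<^sup>2 = y \<Longrightarrow> x = sqrt y \<or> x = - sqrt y" for x y :: real
  by (auto simp: real_sqrt_abs abs_if split: if_splits)

section \<open>The principal quadratic form of the ellipsoid\<close>

lemma bounded_bilinear_mink: "bounded_bilinear mink"
  by (subst bilinear_conv_bounded_bilinear[symmetric])
     (auto simp: bilinear_def mink_def intro!: linearI; simp add: algebra_simps)

lemma mink_sym: "mink p q = mink q p"
  by (simp add: mink_def mult.commute)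

text \<open>The Lagrange identity; the sign is opposite to the Euclidean one.\<close>

lemma mink_mcross_mcross:
  "mink (mcross u v) (mcross w z) = mink u z * mink v w - mink u w * mink v z"
  by (simp add: mink_def mcross_def vector_3 algebra_simps)

locale mink_ellipsoid =
  fixes a b c :: real
  assumes a_gt_b: "a > b" and b_pos: "b > 0" and c_pos: "c > 0"
begin

lemma a_pos: "a > 0" using a_gt_b b_pos by simp

lemmas axes_pos = a_pos b_pos c_pos

abbreviation E0 :: "(real^3) set" where "E0 \<equiv> ellipsoid a b c"

text \<open>The Minkowski ellipsoid behaves like a Euclidean one with squared semi-axes \<open>a\<^sup>2\<close>, \<open>b\<^sup>2\<close>, \<open>-c\<^sup>2\<close>; \<open>P\<close>, \<open>Q\<close>, \<open>R\<close>
  are the differences of these three numbers.\<close>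

definition P :: real where "P = a\<^sup>2 - b\<^sup>2"
definition Q :: real where "Q = a\<^sup>2 + c\<^sup>2"
definition R :: real where "R = b\<^sup>2 + c\<^sup>2"

lemma P_pos: "P > 0" using a_gt_b b_pos by (simp add: P_def power_strict_mono)
lemma Q_pos: "Q > 0" using a_pos by (simp add: Q_def add_pos_nonneg)
lemma R_pos: "R > 0" using b_pos by (simp add: R_def add_pos_nonneg)
lemma Q_eq: "Q = P + R" by (simp add: P_def Q_def R_def)

text \<open>At a point this is half the Minkowski gradient of the defining quadratic function, hence normal to the ellipsoid; on
  tangent vectors it is the derivative of that normal.\<close>

definition shape :: "real^3 \<Rightarrow> real^3" where
  "shape v = vector [v$1 / a\<^sup>2, v$2 / b\<^sup>2, - (v$3 / c\<^sup>2)]"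

text \<open>Multiplied by \<open>- 1 / (a b c)\<^sup>2\<close> this is \<open>det(w, shape w, shape p)\<close>; see \<open>mink_shape_mcross_shape\<close>.\<close>

definition principal_form :: "real^3 \<Rightarrow> real^3 \<Rightarrow> real" where
  "principal_form p w = P * p$3 * w$1 * w$2 - Q * p$2 * w$1 * w$3 + R * p$1 * w$2 * w$3"

lemma bounded_linear_shape: "bounded_linear shape"
  by (subst linear_conv_bounded_linear[symmetric])
     (auto intro!: linearI simp: shape_def vec_eq_iff forall_3 vector_3 add_divide_distrib)

lemma shape_sym: "mink (shape v) w = mink v (shape w)"
  by (simp add: mink_def shape_def vector_3)

lemma mem_E0: "p \<in> E0 \<longleftrightarrow> (p$1 / a)\<^sup>2 + (p$2 / b)\<^sup>2 + (p$3 / c)\<^sup>2 = 1"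
  by (simp add: ellipsoid_def power_divide)

lemma mem_E0_shape: "p \<in> E0 \<longleftrightarrow> mink (shape p) p = 1"
  by (simp add: ellipsoid_def shape_def mink_def vector_3 power2_eq_square)

lemma tangent_eq: "mink (shape p) w = p$1 * w$1 / a\<^sup>2 + p$2 * w$2 / b\<^sup>2 + p$3 * w$3 / c\<^sup>2"
  by (simp add: shape_def mink_def vector_3)

lemma mcross_parallel_shape:
  assumes "p \<in> E0" "mink (shape p) u = 0" "mink (shape p) v = 0" "cross3 u v \<noteq> 0"
  obtains \<mu> where "\<mu> \<noteq> 0" "mcross u v = \<mu> *\<^sub>R shape p"
proof -
  define g where "g = (vector [p$1 / a\<^sup>2, p$2 / b\<^sup>2, p$3 / c\<^sup>2] :: real^3)"
  have g: "g \<bullet> u = 0" "g \<bullet> v = 0"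
    using assms(2,3) by (simp_all add: g_def shape_def mink_def inner_vec_def sum_3 vector_3)
  have "g \<noteq> 0"
  proof
    assume "g = 0"
    then have "p = 0" using axes_pos by (simp add: g_def vec_eq_iff forall_3 vector_3)
    then show False using assms(1) by (simp add: mem_E0)
  qed
  have "cross3 g (cross3 u v) = 0"
    by (simp add: Lagrange g)
  then have "collinear {0, g, cross3 u v}" by (simp only: cross_eq_0)
  then have "g = 0 \<or> cross3 u v = 0 \<or> (\<exists>\<mu>. cross3 u v = \<mu> *\<^sub>R g)"
    by (simp only: collinear_lemma)
  then obtain \<mu> where \<mu>: "cross3 u v = \<mu> *\<^sub>R g"
    using \<open>g \<noteq> 0\<close> assms(4) by blast
  have "mcross u v = \<mu> *\<^sub>R shape p"
    using \<mu> by (simp add: g_def shape_def mcross_def cross3_def vec_eq_iff forall_3 vector_3)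
  moreover have "\<mu> \<noteq> 0" using \<mu> assms(4) by auto
  ultimately show ?thesis using that by blast
qed

text \<open>The last three identities arise by differentiating the orthogonality of \<open>X\<^sub>u\<close> and \<open>X\<^sub>v\<close> to the normal
  \<open>shape (X)\<close>: they trade the second derivatives of an arbitrary parametrization for its first derivatives.\<close>

lemma parametrization_facts:
  assumes "local_param_at E0 U X q p"
  shows "p \<in> E0" and "mink (shape p) (du X q) = 0" and "mink (shape p) (dv X q) = 0"
    and "mink (du (du X) q) (shape p) = - mink (shape (du X q)) (du X q)"
    and "mink (dv (du X) q) (shape p) = - mink (shape (du X q)) (dv X q)"
    and "mink (dv (dv X) q) (shape p) = - mink (shape (dv X q)) (dv X q)"
proof -
  have U: "open U" "q \<in> U" "X q = p" and sm: "smooth_on U X" and on: "\<And>r. r \<in> U \<Longrightarrow> X r \<in> E0"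
    using assms openin_imp_subset by (fastforce simp: local_param_at_def local_param_def)+
  show "p \<in> E0" using on U by blast
  interpret m: bounded_bilinear mink by (rule bounded_bilinear_mink)
  interpret S: bounded_linear shape by (rule bounded_linear_shape)
  have dX: "(X has_derivative (\<lambda>w. fst w *\<^sub>R du X r + snd w *\<^sub>R dv X r)) (at r)" if "r \<in> U" for r
    by (rule smooth_has_derivative[OF U(1) sm that])
  have tangent: "mink (shape (X r)) (fst w *\<^sub>R du X r + snd w *\<^sub>R dv X r) = 0" if "r \<in> U" for r w
  proof -
    let ?D = "\<lambda>w. fst w *\<^sub>R du X r + snd w *\<^sub>R dv X r"
    have "((\<lambda>r. mink (shape (X r)) (X r)) has_derivative
        (\<lambda>w. mink (shape (X r)) (?D w) + mink (shape (?D w)) (X r))) (at r)"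
      by (intro m.FDERIV S.has_derivative dX that)
    moreover have "((\<lambda>r. mink (shape (X r)) (X r)) has_derivative (\<lambda>w. 0)) (at r)"
      by (rule has_derivative_transform_within_open[OF has_derivative_const U(1) that])
         (use on mem_E0_shape in auto)
    ultimately have "(\<lambda>w. mink (shape (X r)) (?D w) + mink (shape (?D w)) (X r)) = (\<lambda>w. 0)"
      by (rule has_derivative_unique)
    then have "mink (shape (X r)) (?D w) + mink (shape (?D w)) (X r) = 0" by meson
    moreover have "mink (shape (?D w)) (X r) = mink (shape (X r)) (?D w)"
      using shape_sym mink_sym by metis
    ultimately show ?thesis by simp
  qed
  have tdu: "mink (shape (X r)) (du X r) = 0" and tdv: "mink (shape (X r)) (dv X r) = 0" if "r \<in> U" for r
    using tangent[OF that, of "(1,0)"] tangent[OF that, of "(0,1)"] by simp_all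
  show "mink (shape p) (du X q) = 0" and "mink (shape p) (dv X q) = 0"
    using tdu[OF U(2)] tdv[OF U(2)] U(3) by simp_all
  have diff2: "mink (shape p) (fst w *\<^sub>R du V q + snd w *\<^sub>R dv V q)
      + mink (shape (fst w *\<^sub>R du X q + snd w *\<^sub>R dv X q)) (V q) = 0"
    if V: "smooth_on U V" "\<And>r. r \<in> U \<Longrightarrow> mink (shape (X r)) (V r) = 0" for V w
  proof -
    let ?D = "\<lambda>w. fst w *\<^sub>R du X q + snd w *\<^sub>R dv X q" and ?E = "\<lambda>w. fst w *\<^sub>R du V q + snd w *\<^sub>R dv V q"
    have "((\<lambda>r. mink (shape (X r)) (V r)) has_derivative
        (\<lambda>w. mink (shape (X q)) (?E w) + mink (shape (?D w)) (V q))) (at q)"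
      by (intro m.FDERIV S.has_derivative dX smooth_has_derivative[OF U(1) V(1)] U)
    moreover have "((\<lambda>r. mink (shape (X r)) (V r)) has_derivative (\<lambda>w. 0)) (at q)"
      by (rule has_derivative_transform_within_open[OF has_derivative_const U(1,2)]) (use V(2) in auto)
    ultimately have "(\<lambda>w. mink (shape (X q)) (?E w) + mink (shape (?D w)) (V q)) = (\<lambda>w. 0)"
      by (rule has_derivative_unique)
    then show ?thesis using U(3) by meson
  qed
  note duu = diff2[OF smooth_on_du_dv(1)[OF U(1) sm] tdu] and dvv = diff2[OF smooth_on_du_dv(2)[OF U(1) sm] tdv]
  show "mink (du (du X) q) (shape p) = - mink (shape (du X q)) (du X q)"
    using duu[of "(1,0)"] by (simp add: mink_sym)
  show "mink (dv (du X) q) (shape p) = - mink (shape (du X q)) (dv X q)"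
    using duu[of "(0,1)"] shape_sym mink_sym by (simp add: mink_sym)
  show "mink (dv (dv X) q) (shape p) = - mink (shape (dv X q)) (dv X q)"
    using dvv[of "(0,1)"] by (simp add: mink_sym)
qed

lemma mink_shape_mcross_shape:
  "mink (shape p) (mcross w (shape w)) = - (principal_form p w / (a\<^sup>2 * b\<^sup>2 * c\<^sup>2))"
proof -
  \<comment> \<open>With reciprocal squares as variables the identity becomes polynomial.\<close>
  define i j k where "i = 1 / a\<^sup>2" and "j = 1 / b\<^sup>2" and "k = 1 / c\<^sup>2"
  have PQR: "P * (i * j * k) = k * (j - i)" "Q * (i * j * k) = j * (k + i)" "R * (i * j * k) = i * (k + j)"
    using axes_pos by (simp_all add: i_def j_def k_def P_def Q_def R_def field_simps)
  have "principal_form p w / (a\<^sup>2 * b\<^sup>2 * c\<^sup>2) = principal_form p w * (i * j * k)" by (simp add: i_def j_def k_def)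
  also have "\<dots> = P * (i * j * k) * (p$3 * w$1 * w$2) - Q * (i * j * k) * (p$2 * w$1 * w$3)
      + R * (i * j * k) * (p$1 * w$2 * w$3)"
    by (simp add: principal_form_def algebra_simps)
  also have "\<dots> = - mink (shape p) (mcross w (shape w))"
    unfolding PQR by (simp add: mink_def mcross_def shape_def vector_3 i_def j_def k_def algebra_simps)
  finally show ?thesis by simp
qed

text \<open>By \<open>parametrization_facts\<close> the left-hand side is \<open>- \<mu>\<close> times the determinant of the two linear forms
  \<open>\<langle>w, \<cdot>\<rangle>\<close> and \<open>\<langle>shape w, \<cdot>\<rangle>\<close> on the basis \<open>X\<^sub>u\<close>, \<open>X\<^sub>v\<close>, and the Lagrange identity turns this into a
  triple product.\<close>

lemma principal_equation_eq_form:
  assumes "local_param_at E0 U X q p" "mcross (du X q) (dv X q) = \<mu> *\<^sub>R shape p"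
  shows "L1 X q * B\<^sup>2 + M1 X q * A * B + N1 X q * A\<^sup>2 =
    - (\<mu>\<^sup>2 / (a\<^sup>2 * b\<^sup>2 * c\<^sup>2)) * principal_form p (A *\<^sub>R du X q + B *\<^sub>R dv X q)"
proof -
  interpret m: bounded_bilinear mink by (rule bounded_bilinear_mink)
  interpret S: bounded_linear shape by (rule bounded_linear_shape)
  define u v where "u = du X q" and "v = dv X q"
  define w where "w = A *\<^sub>R u + B *\<^sub>R v"
  note facts = parametrization_facts[OF assms(1)]
  have bar: "barE X q = - \<mu> * mink (shape u) u" "barF X q = - \<mu> * mink (shape u) v"
    "barG X q = - \<mu> * mink (shape v) v"
    using facts by (simp_all add: barE_def barF_def barG_def assms(2) m.scaleR_right u_def v_def)
  have sv: "mink (shape v) u = mink (shape u) v" using shape_sym mink_sym by metis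
  have "L1 X q * B\<^sup>2 + M1 X q * A * B + N1 X q * A\<^sup>2 =
      - \<mu> * (mink w u * mink (shape w) v - mink w v * mink (shape w) u)"
    unfolding L1_def M1_def N1_def bar coefE_def coefF_def coefG_def
      w_def u_def[symmetric] v_def[symmetric]
    by (simp add: S.add S.scaleR m.add_left m.scaleR_left sv mink_sym[of v u])
       (simp add: algebra_simps power2_eq_square)
  also have "\<dots> = \<mu> * mink (mcross u v) (mcross w (shape w))"
    by (simp add: mink_mcross_mcross mink_sym algebra_simps)
  also have "\<dots> = \<mu>\<^sup>2 * mink (shape p) (mcross w (shape w))"
    using assms(2) by (simp add: u_def v_def m.scaleR_left power2_eq_square)
  finally show ?thesis by (simp add: mink_shape_mcross_shape w_def u_def v_def)
qed

text \<open>The discriminant of the principal form on the tangent plane, up to a positive factor, arranged so that every summand is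
  visibly nonnegative.\<close>

definition Delta :: "real^3 \<Rightarrow> real" where
  "Delta p = (R * (p$1 / a)\<^sup>2 - P * (p$3 / c)\<^sup>2)\<^sup>2 + (Q * (p$2 / b)\<^sup>2)\<^sup>2
     + 2 * Q * (p$2 / b)\<^sup>2 * (R * (p$1 / a)\<^sup>2 + P * (p$3 / c)\<^sup>2)"

lemma Delta_eq_0_iff:
  "Delta p = 0 \<longleftrightarrow> p$2 = 0 \<and> R * (p$1 / a)\<^sup>2 = P * (p$3 / c)\<^sup>2"
proof
  assume D: "Delta p = 0"
  have "2 * Q * (p$2 / b)\<^sup>2 * (R * (p$1 / a)\<^sup>2 + P * (p$3 / c)\<^sup>2) \<ge> 0"
    using P_pos Q_pos R_pos by (intro mult_nonneg_nonneg add_nonneg_nonneg) auto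
  then have "(R * (p$1 / a)\<^sup>2 - P * (p$3 / c)\<^sup>2)\<^sup>2 = 0" "(Q * (p$2 / b)\<^sup>2)\<^sup>2 = 0"
    using D zero_le_power2[of "R * (p$1 / a)\<^sup>2 - P * (p$3 / c)\<^sup>2"] zero_le_power2[of "Q * (p$2 / b)\<^sup>2"]
    unfolding Delta_def by linarith+
  then show "p$2 = 0 \<and> R * (p$1 / a)\<^sup>2 = P * (p$3 / c)\<^sup>2" using Q_pos b_pos by simp
qed (simp add: Delta_def)

text \<open>For a quadratic form with matrix \<open>A\<close>, the discriminant of its restriction to the plane spanned by \<open>u\<close>, \<open>v\<close> is
  \<open>-4\<close> times the value of the adjugate of \<open>A\<close> at the Euclidean product \<open>u \<times> v\<close>, and here this product is a multiple of the
  Euclidean gradient \<open>(x/a\<^sup>2, y/b\<^sup>2, z/c\<^sup>2)\<close>.\<close>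

lemma principal_discriminant:
  assumes "local_param_at E0 U X q p" "mcross (du X q) (dv X q) = \<mu> *\<^sub>R shape p"
  shows "(M1 X q)\<^sup>2 - 4 * L1 X q * N1 X q = (\<mu>\<^sup>2 / (a\<^sup>2 * b\<^sup>2 * c\<^sup>2))\<^sup>2 * \<mu>\<^sup>2 * Delta p"
proof -
  define \<kappa> where "\<kappa> = \<mu>\<^sup>2 / (a\<^sup>2 * b\<^sup>2 * c\<^sup>2)"
  define u v where "u = du X q" and "v = dv X q"
  note form = principal_equation_eq_form[OF assms, folded \<kappa>_def u_def v_def]
  have N: "N1 X q = - \<kappa> * principal_form p u" using form[of 0 1] by simp
  have L: "L1 X q = - \<kappa> * principal_form p v" using form[of 1 0] by simp
  have M: "M1 X q = - \<kappa> * (principal_form p (u + v) - principal_form p u - principal_form p v)"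
    using form[of 1 1] N L by (simp add: algebra_simps)
  have cr: "u$2 * v$3 - u$3 * v$2 = \<mu> * (p$1 / a\<^sup>2)" "u$3 * v$1 - u$1 * v$3 = \<mu> * (p$2 / b\<^sup>2)"
    "u$1 * v$2 - u$2 * v$1 = \<mu> * (p$3 / c\<^sup>2)"
    using assms(2) by (simp_all add: u_def v_def mcross_def shape_def vec_eq_iff forall_3 vector_3)
  have disc: "(principal_form p (u + v) - principal_form p u - principal_form p v)\<^sup>2 - 4 * principal_form p u * principal_form p v =
      (R * p$1 * (u$2 * v$3 - u$3 * v$2))\<^sup>2 + (Q * p$2 * (u$3 * v$1 - u$1 * v$3))\<^sup>2
      + (P * p$3 * (u$1 * v$2 - u$2 * v$1))\<^sup>2
      + 2 * Q * R * p$1 * p$2 * (u$2 * v$3 - u$3 * v$2) * (u$3 * v$1 - u$1 * v$3)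
      - 2 * P * R * p$1 * p$3 * (u$2 * v$3 - u$3 * v$2) * (u$1 * v$2 - u$2 * v$1)
      + 2 * P * Q * p$2 * p$3 * (u$3 * v$1 - u$1 * v$3) * (u$1 * v$2 - u$2 * v$1)"
    unfolding principal_form_def by (simp add: algebra_simps power2_eq_square)
  also have "\<dots> = \<mu>\<^sup>2 * Delta p"
    unfolding cr Delta_def by (simp add: power2_eq_square algebra_simps)
  finally have "(principal_form p (u + v) - principal_form p u - principal_form p v)\<^sup>2 - 4 * principal_form p u * principal_form p v = \<mu>\<^sup>2 * Delta p" .
  moreover have "(M1 X q)\<^sup>2 - 4 * L1 X q * N1 X q =
      \<kappa>\<^sup>2 * ((principal_form p (u + v) - principal_form p u - principal_form p v)\<^sup>2 - 4 * principal_form p u * principal_form p v)"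
    unfolding N L M by (simp add: power2_eq_square algebra_simps)
  ultimately show ?thesis by (simp add: \<kappa>_def)
qed

lemma local_param_mcross:
  assumes "local_param_at E0 U X q p"
  obtains \<mu> where "\<mu> \<noteq> 0" "mcross (du X q) (dv X q) = \<mu> *\<^sub>R shape p"
proof -
  have "cross3 (du X q) (dv X q) \<noteq> 0"
    using assms by (auto simp: local_param_at_def local_param_def)
  then show ?thesis
    using mcross_parallel_shape[OF parametrization_facts(1-3)[OF assms]] that by blast
qed

lemma metric_disc_eq:
  assumes "local_param_at E0 U X q p" "mcross (du X q) (dv X q) = \<mu> *\<^sub>R shape p"
  shows "metric_disc X q = - \<mu>\<^sup>2 * mink (shape p) (shape p)"
proof -
  interpret m: bounded_bilinear mink by (rule bounded_bilinear_mink)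
  show ?thesis
    using mink_mcross_self[of "du X q" "dv X q"]
    by (simp add: assms(2) metric_disc_def coefE_def coefF_def coefG_def m.scaleR_left m.scaleR_right
        power2_eq_square)
qed

subsection \<open>Charts\<close>

lemma graph_chart_at:
  assumes S: "E0 = frame_sphere e1 e2 e3" and ndg: "cross3 e1 e2 \<bullet> e3 \<noteq> 0"
    and p: "p = x *\<^sub>R e1 + y *\<^sub>R e2 + z *\<^sub>R e3" "x\<^sup>2 + y\<^sup>2 + z\<^sup>2 = 1" "z > 0"
    and w: "w = w1 *\<^sub>R e1 + w2 *\<^sub>R e2 + w3 *\<^sub>R e3" "x * w1 + y * w2 + z * w3 = 0"
  shows "local_param_at E0 unit_disc (graph_chart e1 e2 e3) (x, y) p"
    and "w = w1 *\<^sub>R du (graph_chart e1 e2 e3) (x, y) + w2 *\<^sub>R dv (graph_chart e1 e2 e3) (x, y)"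
proof -
  have "z\<^sup>2 > 0" using p by simp
  then have "x\<^sup>2 + y\<^sup>2 < 1" using p(2) by linarith
  then have mem: "(x, y) \<in> unit_disc" by (simp add: unit_disc_def)
  have z: "sqrt (1 - x\<^sup>2 - y\<^sup>2) = z"
    using p by (intro real_sqrt_unique) (auto simp: algebra_simps)
  show "local_param_at E0 unit_disc (graph_chart e1 e2 e3) (x, y) p"
    using local_param_graph_chart(1)[OF ndg] mem
    by (simp add: local_param_at_def S graph_chart_def p(1) z)
  have w3: "w3 = - (x / z) * w1 - (y / z) * w2" using w(2) p(3) by (simp add: field_simps)
  show "w = w1 *\<^sub>R du (graph_chart e1 e2 e3) (x, y) + w2 *\<^sub>R dv (graph_chart e1 e2 e3) (x, y)"
    unfolding graph_chart_partial_derivatives[OF mem] z w(1) w3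
    by (simp add: vec_eq_iff algebra_simps)
qed

lemma E0_frames:
  assumes "\<sigma> = 1 \<or> \<sigma> = -1"
  shows "E0 = frame_sphere (a *\<^sub>R axis 1 1) (b *\<^sub>R axis 2 1) ((\<sigma> * c) *\<^sub>R axis 3 1)"
    and "E0 = frame_sphere (b *\<^sub>R axis 2 1) (c *\<^sub>R axis 3 1) ((\<sigma> * a) *\<^sub>R axis 1 1)"
    and "E0 = frame_sphere (c *\<^sub>R axis 3 1) (a *\<^sub>R axis 1 1) ((\<sigma> * b) *\<^sub>R axis 2 1)"
proof -
  have s: "\<sigma> * \<sigma> = 1" "(\<sigma> * r)\<^sup>2 = r\<^sup>2" for r using assms by auto
  have nz: "a \<noteq> 0" "b \<noteq> 0" "c \<noteq> 0" using axes_pos by auto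
  have "p = (p$1 / a) *\<^sub>R a *\<^sub>R axis 1 1 + (p$2 / b) *\<^sub>R b *\<^sub>R axis 2 1 + (\<sigma> * (p$3 / c)) *\<^sub>R (\<sigma> * c) *\<^sub>R axis 3 1"
    "p = (p$2 / b) *\<^sub>R b *\<^sub>R axis 2 1 + (p$3 / c) *\<^sub>R c *\<^sub>R axis 3 1 + (\<sigma> * (p$1 / a)) *\<^sub>R (\<sigma> * a) *\<^sub>R axis 1 1"
    "p = (p$3 / c) *\<^sub>R c *\<^sub>R axis 3 1 + (p$1 / a) *\<^sub>R a *\<^sub>R axis 1 1 + (\<sigma> * (p$2 / b)) *\<^sub>R (\<sigma> * b) *\<^sub>R axis 2 1" for p :: "real^3"
    using s(1) nz by (simp_all add: vec_eq_iff forall_3 axis_def)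
  note rep = this
  show "E0 = frame_sphere (a *\<^sub>R axis 1 1) (b *\<^sub>R axis 2 1) ((\<sigma> * c) *\<^sub>R axis 3 1)"
  proof (intro equalityI subsetI)
    fix p assume "p \<in> E0"
    then have "(p$1 / a)\<^sup>2 + (p$2 / b)\<^sup>2 + (\<sigma> * (p$3 / c))\<^sup>2 = 1" using assms by (auto simp: mem_E0)
    then show "p \<in> frame_sphere (a *\<^sub>R axis 1 1) (b *\<^sub>R axis 2 1) ((\<sigma> * c) *\<^sub>R axis 3 1)"
      unfolding frame_sphere_def using rep(1)[of p] by blast
  qed (use nz in \<open>auto simp: frame_sphere_def mem_E0 axis_def s(2) mult.assoc[symmetric] mult.commute[of _ \<sigma>]\<close>)
  show "E0 = frame_sphere (b *\<^sub>R axis 2 1) (c *\<^sub>R axis 3 1) ((\<sigma> * a) *\<^sub>R axis 1 1)"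
  proof (intro equalityI subsetI)
    fix p assume "p \<in> E0"
    then have "(p$2 / b)\<^sup>2 + (p$3 / c)\<^sup>2 + (\<sigma> * (p$1 / a))\<^sup>2 = 1" using assms by (auto simp: mem_E0)
    then show "p \<in> frame_sphere (b *\<^sub>R axis 2 1) (c *\<^sub>R axis 3 1) ((\<sigma> * a) *\<^sub>R axis 1 1)"
      unfolding frame_sphere_def using rep(2)[of p] by blast
  qed (use nz in \<open>auto simp: frame_sphere_def mem_E0 axis_def s(2) mult.assoc[symmetric] mult.commute[of _ \<sigma>]\<close>)
  show "E0 = frame_sphere (c *\<^sub>R axis 3 1) (a *\<^sub>R axis 1 1) ((\<sigma> * b) *\<^sub>R axis 2 1)"
  proof (intro equalityI subsetI)
    fix p assume "p \<in> E0"
    then have "(p$3 / c)\<^sup>2 + (p$1 / a)\<^sup>2 + (\<sigma> * (p$2 / b))\<^sup>2 = 1" using assms by (auto simp: mem_E0)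
    then show "p \<in> frame_sphere (c *\<^sub>R axis 3 1) (a *\<^sub>R axis 1 1) ((\<sigma> * b) *\<^sub>R axis 2 1)"
      unfolding frame_sphere_def using rep(3)[of p] by blast
  qed (use nz in \<open>auto simp: frame_sphere_def mem_E0 axis_def s(2) mult.assoc[symmetric] mult.commute[of _ \<sigma>]\<close>)
qed

text \<open>One of the three coordinates of \<open>p\<close> is nonzero; solve for that one.\<close>

lemma tangent_vector_in_chart:
  assumes "p \<in> E0" "mink (shape p) w = 0"
  obtains U X q A B where "local_param_at E0 U X q p" "w = A *\<^sub>R du X q + B *\<^sub>R dv X q"
proof -
  define x y z where "x = p$1 / a" and "y = p$2 / b" and "z = p$3 / c"
  define w1 w2 w3 where "w1 = w$1 / a" and "w2 = w$2 / b" and "w3 = w$3 / c"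
  have nz: "a \<noteq> 0" "b \<noteq> 0" "c \<noteq> 0" using axes_pos by auto
  have sph: "x\<^sup>2 + y\<^sup>2 + z\<^sup>2 = 1" using assms(1) by (simp add: mem_E0 x_def y_def z_def)
  have tan: "x * w1 + y * w2 + z * w3 = 0"
    using assms(2) by (simp add: tangent_eq x_def y_def z_def w1_def w2_def w3_def power2_eq_square)
  have s: "sgn r = 1 \<or> sgn r = -1" "sgn r * sgn r = 1" "sgn r * r > 0" "(sgn r * r)\<^sup>2 = r\<^sup>2" if "r \<noteq> 0" for r :: real
    using that by (auto simp: sgn_if)
  consider "z \<noteq> 0" | "x \<noteq> 0" | "y \<noteq> 0" using sph by fastforce
  then show ?thesis
  proof cases
    case 1
    have "cross3 (a *\<^sub>R axis 1 1) (b *\<^sub>R axis 2 1) \<bullet> ((sgn z * c) *\<^sub>R axis 3 1) \<noteq> 0"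
      using nz 1 by (simp add: cross3_def inner_vec_def sum_3 vector_3 axis_def sgn_zero_iff)
    moreover have "p = x *\<^sub>R a *\<^sub>R axis 1 1 + y *\<^sub>R b *\<^sub>R axis 2 1 + (sgn z * z) *\<^sub>R (sgn z * c) *\<^sub>R axis 3 1"
      "w = w1 *\<^sub>R a *\<^sub>R axis 1 1 + w2 *\<^sub>R b *\<^sub>R axis 2 1 + (sgn z * w3) *\<^sub>R (sgn z * c) *\<^sub>R axis 3 1"
      using s[OF 1] nz by (auto simp: vec_eq_iff forall_3 axis_def x_def y_def z_def w1_def w2_def w3_def)
    moreover have "x\<^sup>2 + y\<^sup>2 + (sgn z * z)\<^sup>2 = 1" using sph s[OF 1] by simp
    moreover have "x * w1 + y * w2 + (sgn z * z) * (sgn z * w3) = 0"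
      using s(2)[OF 1] tan by (metis mult.assoc mult.left_commute mult_1)
    ultimately show ?thesis
      using graph_chart_at[OF E0_frames(1)[OF s(1)[OF 1]]] s(3)[OF 1] that by meson
  next
    case 2
    have "cross3 (b *\<^sub>R axis 2 1) (c *\<^sub>R axis 3 1) \<bullet> ((sgn x * a) *\<^sub>R axis 1 1) \<noteq> 0"
      using nz 2 by (simp add: cross3_def inner_vec_def sum_3 vector_3 axis_def sgn_zero_iff)
    moreover have "p = y *\<^sub>R b *\<^sub>R axis 2 1 + z *\<^sub>R c *\<^sub>R axis 3 1 + (sgn x * x) *\<^sub>R (sgn x * a) *\<^sub>R axis 1 1"
      "w = w2 *\<^sub>R b *\<^sub>R axis 2 1 + w3 *\<^sub>R c *\<^sub>R axis 3 1 + (sgn x * w1) *\<^sub>R (sgn x * a) *\<^sub>R axis 1 1"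
      using s[OF 2] nz by (auto simp: vec_eq_iff forall_3 axis_def x_def y_def z_def w1_def w2_def w3_def)
    moreover have "y\<^sup>2 + z\<^sup>2 + (sgn x * x)\<^sup>2 = 1" using sph s[OF 2] by simp
    moreover have "(sgn x * x) * (sgn x * w1) = x * w1"
      using s(2)[OF 2] by (metis mult.assoc mult.left_commute mult_1)
    then have "y * w2 + z * w3 + (sgn x * x) * (sgn x * w1) = 0"
      using tan by (simp only: add_ac)
    ultimately show ?thesis
      using graph_chart_at[OF E0_frames(2)[OF s(1)[OF 2]]] s(3)[OF 2] that by meson
  next
    case 3
    have "cross3 (c *\<^sub>R axis 3 1) (a *\<^sub>R axis 1 1) \<bullet> ((sgn y * b) *\<^sub>R axis 2 1) \<noteq> 0"
      using nz 3 by (simp add: cross3_def inner_vec_def sum_3 vector_3 axis_def sgn_zero_iff)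
    moreover have "p = z *\<^sub>R c *\<^sub>R axis 3 1 + x *\<^sub>R a *\<^sub>R axis 1 1 + (sgn y * y) *\<^sub>R (sgn y * b) *\<^sub>R axis 2 1"
      "w = w3 *\<^sub>R c *\<^sub>R axis 3 1 + w1 *\<^sub>R a *\<^sub>R axis 1 1 + (sgn y * w2) *\<^sub>R (sgn y * b) *\<^sub>R axis 2 1"
      using s[OF 3] nz by (auto simp: vec_eq_iff forall_3 axis_def x_def y_def z_def w1_def w2_def w3_def)
    moreover have "z\<^sup>2 + x\<^sup>2 + (sgn y * y)\<^sup>2 = 1" using sph s[OF 3] by simp
    moreover have "(sgn y * y) * (sgn y * w2) = y * w2"
      using s(2)[OF 3] by (metis mult.assoc mult.left_commute mult_1)
    then have "z * w3 + x * w1 + (sgn y * y) * (sgn y * w2) = 0"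
      using tan by (simp only: add_ac)
    ultimately show ?thesis
      using graph_chart_at[OF E0_frames(3)[OF s(1)[OF 3]]] s(3)[OF 3] that by meson
  qed
qed

lemma ex_local_param:
  assumes "p \<in> E0" obtains U X q where "local_param_at E0 U X q p"
proof -
  have "mink (shape p) 0 = 0" by (simp add: mink_def)
  from tangent_vector_in_chart[OF assms this] show ?thesis using that by metis
qed

subsection \<open>Pointwise classification\<close>

lemma principal_direction_iff:
  "principal_direction E0 p w \<longleftrightarrow> p \<in> E0 \<and> mink (shape p) w = 0 \<and> principal_form p w = 0"
proof
  assume "principal_direction E0 p w"
  then obtain U X q A B where X: "local_param_at E0 U X q p" "w = A *\<^sub>R du X q + B *\<^sub>R dv X q"
    "L1 X q * B\<^sup>2 + M1 X q * A * B + N1 X q * A\<^sup>2 = 0"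
    unfolding principal_direction_def by blast
  obtain \<mu> where \<mu>: "\<mu> \<noteq> 0" "mcross (du X q) (dv X q) = \<mu> *\<^sub>R shape p"
    using local_param_mcross[OF X(1)] .
  have "principal_form p w = 0"
    using principal_equation_eq_form[OF X(1) \<mu>(2), of B A] X(2,3) \<mu>(1) axes_pos by simp
  moreover have "mink (shape p) w = 0"
    using parametrization_facts(2,3)[OF X(1)] unfolding X(2)
    by (simp add: bounded_bilinear.add_right[OF bounded_bilinear_mink]
        bounded_bilinear.scaleR_right[OF bounded_bilinear_mink])
  ultimately show "p \<in> E0 \<and> mink (shape p) w = 0 \<and> principal_form p w = 0"
    using parametrization_facts(1)[OF X(1)] by blast
next
  assume A: "p \<in> E0 \<and> mink (shape p) w = 0 \<and> principal_form p w = 0"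
  then obtain U X q A B where X: "local_param_at E0 U X q p" "w = A *\<^sub>R du X q + B *\<^sub>R dv X q"
    using tangent_vector_in_chart by blast
  obtain \<mu> where \<mu>: "\<mu> \<noteq> 0" "mcross (du X q) (dv X q) = \<mu> *\<^sub>R shape p"
    using local_param_mcross[OF X(1)] .
  have "L1 X q * B\<^sup>2 + M1 X q * A * B + N1 X q * A\<^sup>2 = 0"
    using principal_equation_eq_form[OF X(1) \<mu>(2), of B A] X(2) A by simp
  with X show "principal_direction E0 p w" unfolding principal_direction_def by blast
qed

text \<open>At an umbilic point the discriminant vanishes. Conversely, if \<open>y = 0\<close> the form factors as
  \<open>w\<^sub>2 (P z w\<^sub>1 + R x w\<^sub>3)\<close>, and \<open>R (x/a)\<^sup>2 = P (z/c)\<^sup>2\<close> says that the second factor is proportional to the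
  equation of the tangent plane.\<close>

lemma umbilic_iff:
  "umbilic E0 p \<longleftrightarrow> p \<in> E0 \<and> p$2 = 0 \<and> R * (p$1 / a)\<^sup>2 = P * (p$3 / c)\<^sup>2"
proof
  assume "umbilic E0 p"
  then obtain U X q where X: "local_param_at E0 U X q p" "L1 X q = 0" "M1 X q = 0" "N1 X q = 0"
    unfolding umbilic_def by blast
  obtain \<mu> where \<mu>: "\<mu> \<noteq> 0" "mcross (du X q) (dv X q) = \<mu> *\<^sub>R shape p"
    using local_param_mcross[OF X(1)] .
  have "Delta p = 0"
    using principal_discriminant[OF X(1) \<mu>(2)] X \<mu>(1) axes_pos by simp
  then show "p \<in> E0 \<and> p$2 = 0 \<and> R * (p$1 / a)\<^sup>2 = P * (p$3 / c)\<^sup>2"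
    using parametrization_facts(1)[OF X(1)] by (simp add: Delta_eq_0_iff)
next
  assume A: "p \<in> E0 \<and> p$2 = 0 \<and> R * (p$1 / a)\<^sup>2 = P * (p$3 / c)\<^sup>2"
  then obtain U X q where X: "local_param_at E0 U X q p" using ex_local_param by blast
  obtain \<mu> where \<mu>: "\<mu> \<noteq> 0" "mcross (du X q) (dv X q) = \<mu> *\<^sub>R shape p"
    using local_param_mcross[OF X(1)] .
  have form0: "principal_form p w = 0" if "mink (shape p) w = 0" for w
  proof -
    define x z k m where "x = p$1 / a" and "z = p$3 / c" and "k = w$1 / a" and "m = w$3 / c"
    have t: "x * k + z * m = 0"
      using that A by (simp add: tangent_eq x_def z_def k_def m_def power2_eq_square)
    have xz: "R * x\<^sup>2 = P * z\<^sup>2" and s: "x\<^sup>2 + z\<^sup>2 = 1"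
      using A by (auto simp: mem_E0 x_def z_def)
    have "(P * z * k + R * x * m) * x = 0" "(P * z * k + R * x * m) * z = 0" using t xz by algebra+
    then have "P * z * k + R * x * m = 0" using s by fastforce
    moreover have "principal_form p w = w$2 * (a * c) * (P * z * k + R * x * m)"
      using A axes_pos by (simp add: principal_form_def x_def z_def k_def m_def field_simps)
    ultimately show ?thesis by simp
  qed
  have form: "L1 X q * B\<^sup>2 + M1 X q * A * B + N1 X q * A\<^sup>2 = 0" for A B
    using principal_equation_eq_form[OF X(1) \<mu>(2)] parametrization_facts(2,3)[OF X(1)]
    by (simp add: form0 bounded_bilinear.add_right[OF bounded_bilinear_mink]
        bounded_bilinear.scaleR_right[OF bounded_bilinear_mink])
  have "L1 X q = 0" "N1 X q = 0" using form[of 1 0] form[of 0 1] by simp_all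
  moreover from this have "M1 X q = 0" using form[of 1 1] by simp
  ultimately show "umbilic E0 p" using X unfolding umbilic_def by blast
qed

lemma LPL_empty: "LPL E0 = {}"
proof -
  have False if p: "p \<in> LPL E0" for p
  proof -
    obtain U X q where X: "local_param_at E0 U X q p" "(M1 X q)\<^sup>2 - 4 * L1 X q * N1 X q = 0"
      and nu: "\<not> umbilic E0 p"
      using p unfolding LPL_def by blast
    obtain \<mu> where \<mu>: "\<mu> \<noteq> 0" "mcross (du X q) (dv X q) = \<mu> *\<^sub>R shape p"
      using local_param_mcross[OF X(1)] .
    have "Delta p = 0"
      using principal_discriminant[OF X(1) \<mu>(2)] X \<mu>(1) axes_pos by simp
    then show False using nu parametrization_facts(1)[OF X(1)] by (simp add: Delta_eq_0_iff umbilic_iff)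
  qed
  then show ?thesis by blast
qed

lemma spacelike_point_iff: "spacelike_point E0 p \<longleftrightarrow> p \<in> E0 \<and> mink (shape p) (shape p) < 0"
  and tropic_iff: "p \<in> tropic E0 \<longleftrightarrow> p \<in> E0 \<and> mink (shape p) (shape p) = 0"
proof -
  have *: "p \<in> E0 \<and> (\<exists>r>0. metric_disc X q = - (r * mink (shape p) (shape p)))"
    if X: "local_param_at E0 U X q p" for U X q
  proof -
    obtain \<mu> where "\<mu> \<noteq> 0" "mcross (du X q) (dv X q) = \<mu> *\<^sub>R shape p"
      using local_param_mcross[OF X] .
    then show ?thesis
      using metric_disc_eq[OF X] parametrization_facts(1)[OF X]
      by (auto intro!: exI[of _ "\<mu>\<^sup>2"])
  qed
  show "spacelike_point E0 p \<longleftrightarrow> p \<in> E0 \<and> mink (shape p) (shape p) < 0"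
    unfolding spacelike_point_def using * ex_local_param[of p]
    by (smt (verit, ccfv_threshold) mult_pos_neg mult_nonneg_nonneg)
  show "p \<in> tropic E0 \<longleftrightarrow> p \<in> E0 \<and> mink (shape p) (shape p) = 0"
    unfolding tropic_def using * ex_local_param[of p]
    by (smt (verit, ccfv_threshold) mem_Collect_eq mult_eq_0_iff)
qed

lemma velocity_tangent:
  assumes "\<And>t. \<gamma> t \<in> E0" "(\<gamma> has_vector_derivative v) (at t)"
  shows "mink (shape (\<gamma> t)) v = 0"
proof -
  interpret m: bounded_bilinear mink by (rule bounded_bilinear_mink)
  interpret S: bounded_linear shape by (rule bounded_linear_shape)
  have "((\<lambda>t. mink (shape (\<gamma> t)) (\<gamma> t)) has_vector_derivative
      mink (shape (\<gamma> t)) v + mink (shape v) (\<gamma> t)) (at t)"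
    by (intro m.has_vector_derivative S.has_vector_derivative assms(2))
  moreover have "(\<lambda>t. mink (shape (\<gamma> t)) (\<gamma> t)) = (\<lambda>t. 1)"
    using assms(1) mem_E0_shape by auto
  ultimately have "mink (shape (\<gamma> t)) v + mink (shape v) (\<gamma> t) = 0"
    by (metis has_vector_derivative_const vector_derivative_unique_at)
  moreover have "mink (shape v) (\<gamma> t) = mink (shape (\<gamma> t)) v"
    using shape_sym mink_sym by metis
  ultimately show ?thesis by simp
qed

lemma principal_immersionI:
  assumes "smooth_on UNIV \<gamma>" "\<And>t. \<gamma> t \<in> E0" "\<And>t. \<not> umbilic E0 (\<gamma> t)"
    and "\<And>t. (\<gamma> has_vector_derivative \<gamma>' t) (at t)"
    and "\<And>t. \<gamma>' t \<noteq> 0" "\<And>t. principal_form (\<gamma> t) (\<gamma>' t) = 0"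
  shows "principal_immersion E0 \<gamma>"
proof -
  have tan: "mink (shape (\<gamma> t)) (\<gamma>' t) = 0" for t
    by (rule velocity_tangent[OF assms(2,4)])
  have "vector_derivative \<gamma> (at t) = \<gamma>' t" for t using assms(4) by (rule vector_derivative_at)
  then show ?thesis
    unfolding principal_immersion_def using assms tan by (auto simp: principal_direction_iff)
qed

section \<open>The umbilic points are of type D1\<close>

definition zchart :: "real \<Rightarrow> real \<times> real \<Rightarrow> real^3" where
  "zchart \<tau> = graph_chart (a *\<^sub>R axis 1 1) (b *\<^sub>R axis 2 1) ((\<tau> * c) *\<^sub>R axis 3 1)"

text \<open>The power \<open>-3/2\<close> of \<open>1 - u\<^sup>2 - v\<^sup>2 = h\<^sup>2\<close> collects \<open>1 / h\<^sup>2\<close> from the square of the normal factor \<open>\<mu>\<close> and \<open>1 / h\<close>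
  from the third component of the tangent vectors.\<close>

definition zchart_factor :: "real \<Rightarrow> real \<times> real \<Rightarrow> real" where
  "zchart_factor \<tau> q = - (\<tau> * a * b * c) * (1 - (fst q)\<^sup>2 - (snd q)\<^sup>2) powr (-3/2)"

lemma smooth_on_zchart_factor: "smooth_on unit_disc (zchart_factor \<tau>)"
  unfolding zchart_factor_def
  by (intro smooth_on_mult smooth_on_const open_unit_disc smooth_on_powr smooth_on_graph_height)
     (auto simp: unit_disc_def)

lemma zchart_factor_nonzero:
  assumes "\<tau> = 1 \<or> \<tau> = -1" "q \<in> unit_disc" shows "zchart_factor \<tau> q \<noteq> 0"
  using assms axes_pos by (auto simp: zchart_factor_def unit_disc_def)

lemma zchart_coefficients:
  assumes "\<tau> = 1 \<or> \<tau> = -1" and uv: "(u, v) \<in> unit_disc"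
  shows "L1 (zchart \<tau>) (u, v) = zchart_factor \<tau> (u, v) * (- R * u * v)"
    and "M1 (zchart \<tau>) (u, v) = zchart_factor \<tau> (u, v) * (P - Q * u\<^sup>2 + R * v\<^sup>2)"
    and "N1 (zchart \<tau>) (u, v) = zchart_factor \<tau> (u, v) * (Q * u * v)"
proof -
  define h where "h = sqrt (1 - u\<^sup>2 - v\<^sup>2)"
  have pos: "1 - u\<^sup>2 - v\<^sup>2 > 0" using uv by (simp add: unit_disc_def)
  then have h: "h > 0" "h\<^sup>2 = 1 - u\<^sup>2 - v\<^sup>2" by (simp_all add: h_def)
  have \<tau>: "\<tau> * \<tau> = 1" using assms(1) by auto
  define p where "p = zchart \<tau> (u, v)"
  have p: "p = vector [a * u, b * v, \<tau> * c * h]"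
    by (simp add: p_def zchart_def graph_chart_def h_def[symmetric] vec_eq_iff forall_3 axis_def vector_3)
  have du: "du (zchart \<tau>) (u, v) = vector [a, 0, - \<tau> * c * u / h]"
    and dv: "dv (zchart \<tau>) (u, v) = vector [0, b, - \<tau> * c * v / h]"
    unfolding zchart_def graph_chart_partial_derivatives[OF uv] h_def[symmetric]
    by (simp_all add: vec_eq_iff forall_3 axis_def vector_3)
  have "cross3 (a *\<^sub>R axis 1 1) (b *\<^sub>R axis 2 1) \<bullet> ((\<tau> * c) *\<^sub>R axis 3 1) \<noteq> 0"
    using axes_pos \<tau> by (auto simp: cross3_def inner_vec_def sum_3 vector_3 axis_def)
  then have lp: "local_param_at E0 unit_disc (zchart \<tau>) (u, v) p"
    using local_param_graph_chart(1) E0_frames(1)[OF assms(1)] uv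
    by (simp add: local_param_at_def p_def zchart_def)
  have mc: "mcross (du (zchart \<tau>) (u, v)) (dv (zchart \<tau>) (u, v)) = (\<tau> * a * b * c / h) *\<^sub>R shape p"
    using h(1) axes_pos \<tau>
    by (simp add: du dv p mcross_def shape_def vec_eq_iff forall_3 vector_3 field_simps power2_eq_square)
  have "(h\<^sup>2) powr (-3/2) = (h powr 2) powr (-3/2)" using h(1) by simp
  also have "\<dots> = h powr (2 * (-3/2))" by (simp only: powr_powr)
  also have "\<dots> = inverse (h powr 3)" by (simp add: powr_minus[symmetric])
  also have "h powr 3 = h * h * h" using h(1) by (simp add: power3_eq_cube)
  finally have hp: "(h\<^sup>2) powr (-3/2) = 1 / (h * h * h)" by (simp only: inverse_eq_divide)
  have factor: "zchart_factor \<tau> (u, v) = - (\<tau> * a * b * c) / (h * h * h)"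
    unfolding zchart_factor_def fst_conv snd_conv h(2)[symmetric] hp by simp
  have form: "L1 (zchart \<tau>) (u, v) * B\<^sup>2 + M1 (zchart \<tau>) (u, v) * A * B + N1 (zchart \<tau>) (u, v) * A\<^sup>2
      = zchart_factor \<tau> (u, v) * (- R * u * v * B\<^sup>2 + (P - Q * u\<^sup>2 + R * v\<^sup>2) * A * B + Q * u * v * A\<^sup>2)" for A B
  proof -
    have "principal_form p (A *\<^sub>R du (zchart \<tau>) (u, v) + B *\<^sub>R dv (zchart \<tau>) (u, v)) * h =
        (\<tau> * a * b * c) * (P * h\<^sup>2 * A * B + Q * v * A * (u * A + v * B) - R * u * B * (u * A + v * B))"
      using h(1) by (simp add: principal_form_def du dv p vector_3 field_simps power2_eq_square)
    also have "\<dots> = (\<tau> * a * b * c) *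
        (- R * u * v * B\<^sup>2 + (P - Q * u\<^sup>2 + R * v\<^sup>2) * A * B + Q * u * v * A\<^sup>2)"
      unfolding h(2) Q_eq by (simp add: algebra_simps power2_eq_square)
    finally have "principal_form p (A *\<^sub>R du (zchart \<tau>) (u, v) + B *\<^sub>R dv (zchart \<tau>) (u, v)) =
        (\<tau> * a * b * c / h) *
        (- R * u * v * B\<^sup>2 + (P - Q * u\<^sup>2 + R * v\<^sup>2) * A * B + Q * u * v * A\<^sup>2)" (is "_ = _ * ?W")
      using h(1) by (simp add: field_simps)
    moreover have "(\<tau> * a * b * c / h)\<^sup>2 / (a\<^sup>2 * b\<^sup>2 * c\<^sup>2) = 1 / (h * h)"
      using \<tau> axes_pos by (simp add: power2_eq_square)
    ultimately show ?thesis
      using principal_equation_eq_form[OF lp mc, of B A] by (simp add: factor)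
  qed
  show L: "L1 (zchart \<tau>) (u, v) = zchart_factor \<tau> (u, v) * (- R * u * v)"
    and N: "N1 (zchart \<tau>) (u, v) = zchart_factor \<tau> (u, v) * (Q * u * v)"
    using form[of 1 0] form[of 0 1] by simp_all
  show "M1 (zchart \<tau>) (u, v) = zchart_factor \<tau> (u, v) * (P - Q * u\<^sup>2 + R * v\<^sup>2)"
    using form[of 1 1] unfolding L N by (simp add: algebra_simps)
qed

definition lift_domain :: "(real \<times> real \<times> real) set" where
  "lift_domain = {s. (fst s, fst (snd s)) \<in> unit_disc}"

lemma open_lift_domain: "open lift_domain"
proof -
  have "open ((\<lambda>s::real\<times>real\<times>real. (fst s, fst (snd s))) -` unit_disc)"
    by (intro open_vimage open_unit_disc continuous_intros)
  then show ?thesis by (simp add: lift_domain_def vimage_def)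
qed

text \<open>The factor depends on the base point only; at zeros of \<open>W\<close> it merely rescales the derivative of \<open>W\<close>.\<close>

lemma base_scaled_has_derivative:
  fixes W :: "real \<times> real \<times> real \<Rightarrow> real"
  assumes k: "smooth_on unit_disc k" and s: "s \<in> lift_domain" and W: "(W has_derivative W') (at s)"
  defines "q \<equiv> (fst s, fst (snd s))"
  shows "((\<lambda>r. k (fst r, fst (snd r)) * W r) has_derivative
    (\<lambda>w. k q * W' w + (fst w * du k q + fst (snd w) * dv k q) * W s)) (at s)"
proof -
  have q: "q \<in> unit_disc" using s by (simp add: q_def lift_domain_def)
  have "((\<lambda>r. (fst r, fst (snd r))) has_derivative (\<lambda>w. (fst w, fst (snd w)))) (at s)"
    by (intro has_derivative_Pair bounded_linear_imp_has_derivative bounded_linear_fst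
        bounded_linear_fst_comp bounded_linear_snd)
  moreover have "(k has_derivative (\<lambda>w. fst w *\<^sub>R du k q + snd w *\<^sub>R dv k q)) (at (fst s, fst (snd s)))"
    using smooth_has_derivative[OF open_unit_disc k q] by (simp add: q_def)
  ultimately have "((\<lambda>r. k (fst r, fst (snd r))) has_derivative
      (\<lambda>w. fst (fst w, fst (snd w)) *\<^sub>R du k q + snd (fst w, fst (snd w)) *\<^sub>R dv k q)) (at s)"
    by (rule has_derivative_compose)
  from has_derivative_mult[OF this W] show ?thesis by (simp add: q_def)
qed

text \<open>The Lie--Cartan function of the chart without the nonvanishing factor \<open>zchart_factor\<close>.\<close>

definition lift_poly :: "real \<times> real \<times> real \<Rightarrow> real" where
  "lift_poly s = (case s of (u, v, p) \<Rightarrow> - R * u * v * p\<^sup>2 + (P - Q * u\<^sup>2 + R * v\<^sup>2) * p + Q * u * v)"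

lemma has_derivative_lift_poly: "(lift_poly has_derivative (\<lambda>w. (- R * v * p\<^sup>2 - 2 * Q * u * p + Q * v) * fst w
        + (- R * u * p\<^sup>2 + 2 * R * v * p + Q * u) * fst (snd w)
        + (- 2 * R * u * v * p + P - Q * u\<^sup>2 + R * v\<^sup>2) * snd (snd w))) (at (u, v, p))"
proof -
  have 1: "lift_poly = (\<lambda>s. - R * fst s * fst (snd s) * (snd (snd s))\<^sup>2
     + (P - Q * (fst s)\<^sup>2 + R * (fst (snd s))\<^sup>2) * snd (snd s) + Q * fst s * fst (snd s))"
    by (simp add: lift_poly_def case_prod_unfold fun_eq_iff)
  show ?thesis unfolding 1
    by (rule derivative_eq_intros refl)+ (simp add: fun_eq_iff algebra_simps power2_eq_square)
qed

lemma lcF_zchart: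
  assumes "\<tau> = 1 \<or> \<tau> = -1" "s \<in> lift_domain"
  shows "lcF (zchart \<tau>) s = zchart_factor \<tau> (fst s, fst (snd s)) * lift_poly s"
  using assms(2)
  by (cases s) (simp add: lcF_def lift_poly_def lift_domain_def zchart_coefficients[OF assms(1)],
      simp add: algebra_simps)

lemma D3_lcF_zchart:
  assumes \<tau>: "\<tau> = 1 \<or> \<tau> = -1" and s: "(u, v, p) \<in> lift_domain"
  shows "D3 (lcF (zchart \<tau>)) (u, v, p) = (\<lambda>w. zchart_factor \<tau> (u, v) *
      ((- R * v * p\<^sup>2 - 2 * Q * u * p + Q * v) * fst w
        + (- R * u * p\<^sup>2 + 2 * R * v * p + Q * u) * fst (snd w)
        + (- 2 * R * u * v * p + P - Q * u\<^sup>2 + R * v\<^sup>2) * snd (snd w))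
      + (fst w * du (zchart_factor \<tau>) (u, v) + fst (snd w) * dv (zchart_factor \<tau>) (u, v)) * lift_poly (u, v, p))"
  (is "_ = ?D")
proof -
  have "((\<lambda>r. zchart_factor \<tau> (fst r, fst (snd r)) * lift_poly r) has_derivative ?D) (at (u, v, p))"
    using base_scaled_has_derivative[OF smooth_on_zchart_factor s has_derivative_lift_poly] by simp
  then have "(lcF (zchart \<tau>) has_derivative ?D) (at (u, v, p))"
    by (rule has_derivative_transform_within_open[OF _ open_lift_domain s])
       (simp add: lcF_zchart[OF \<tau>])
  then show ?thesis by (rule frechet_derivative_at[symmetric])
qed

lemma lcY_zchart:
  assumes \<tau>: "\<tau> = 1 \<or> \<tau> = -1" and s: "(u, v, p) \<in> lift_domain"
  shows "lcY (zchart \<tau>) (u, v, p) =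
    (zchart_factor \<tau> (u, v) * (- 2 * R * u * v * p + P - Q * u\<^sup>2 + R * v\<^sup>2),
     zchart_factor \<tau> (u, v) * (p * (- 2 * R * u * v * p + P - Q * u\<^sup>2 + R * v\<^sup>2)),
     zchart_factor \<tau> (u, v) * (R * v * p\<^sup>2 + 2 * Q * u * p - Q * v + R * u * p ^ 3 - 2 * R * v * p\<^sup>2 - Q * u * p)
       + du (zchart_factor \<tau>) (u, v) * (- lift_poly (u, v, p)) + dv (zchart_factor \<tau>) (u, v) * (- p * lift_poly (u, v, p)))"
  unfolding lcY_def D3_lcF_zchart[OF assms] Let_def prod.case
  by (simp add: algebra_simps power2_eq_square power3_eq_cube)

text \<open>On the plane spanned by \<open>(1, 0, 0)\<close> and \<open>(0, 0, 1)\<close>, the tangent plane of the Lie--Cartan surface at the singular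
  point, the linear part is diagonal. The derivatives of \<open>zchart_factor\<close> contribute nothing: they multiply the
  components of the field without this factor, which vanish at the point, or \<open>lift_poly\<close>, which vanishes there
  together with its derivative along that plane.\<close>

lemma lcY_zchart_derivative:
  assumes \<tau>: "\<tau> = 1 \<or> \<tau> = -1" and s: "(u, 0, 0) \<in> lift_domain" and u: "Q * u\<^sup>2 = P"
  shows "D3 (lcY (zchart \<tau>)) (u, 0, 0) (x, 0, z) =
    (zchart_factor \<tau> (u, 0) * (- 2 * Q * u * x), 0, zchart_factor \<tau> (u, 0) * (Q * u * z))"
proof -
  let ?q = "\<lambda>s::real\<times>real\<times>real. (fst s, fst (snd s))"
  define F1 where "F1 s = - 2 * R * fst s * fst (snd s) * snd (snd s) + P - Q * (fst s)\<^sup>2 + R * (fst (snd s))\<^sup>2" for s :: "real \<times> real \<times> real"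
  define F2 where "F2 s = snd (snd s) * F1 s" for s
  define F3 where "F3 s = R * fst (snd s) * (snd (snd s))\<^sup>2 + 2 * Q * fst s * snd (snd s) - Q * fst (snd s)
     + R * fst s * snd (snd s) ^ 3 - 2 * R * fst (snd s) * (snd (snd s))\<^sup>2 - Q * fst s * snd (snd s)" for s :: "real \<times> real \<times> real"
  have F1: "(F1 has_derivative (\<lambda>w. - 2 * Q * u * fst w)) (at (u, 0, 0))"
    unfolding F1_def[abs_def]
    by (rule derivative_eq_intros refl)+ (simp add: fun_eq_iff algebra_simps power2_eq_square)
  have F10: "F1 (u, 0, 0) = 0" using u by (simp add: F1_def)
  have F2: "(F2 has_derivative (\<lambda>w. 0)) (at (u, 0, 0))"
    unfolding F2_def[abs_def]
    by (rule derivative_eq_intros refl F1)+ (simp add: fun_eq_iff F10)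
  have F3: "(F3 has_derivative (\<lambda>w. Q * u * snd (snd w) - Q * fst (snd w))) (at (u, 0, 0))"
    unfolding F3_def[abs_def]
    by (rule derivative_eq_intros refl)+ (simp add: fun_eq_iff algebra_simps power2_eq_square)
  have W: "((\<lambda>s. - lift_poly s) has_derivative (\<lambda>w. - (Q * u * fst (snd w)))) (at (u, 0, 0))"
    by (rule has_derivative_eq_rhs[OF has_derivative_minus[OF has_derivative_lift_poly]])
       (use u in \<open>simp add: fun_eq_iff\<close>)
  have W0: "lift_poly (u, 0, 0) = 0" by (simp add: lift_poly_def)
  have pW: "((\<lambda>s. - snd (snd s) * lift_poly s) has_derivative (\<lambda>w. 0)) (at (u, 0, 0))"
    by (rule derivative_eq_intros refl has_derivative_lift_poly)+ (simp add: fun_eq_iff W0)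
  note b = base_scaled_has_derivative[OF _ s]
  note b1 = b[OF smooth_on_zchart_factor[of \<tau>]] and bu = b[OF smooth_on_du_dv(1)[OF open_unit_disc smooth_on_zchart_factor[of \<tau>]]]
    and bv = b[OF smooth_on_du_dv(2)[OF open_unit_disc smooth_on_zchart_factor[of \<tau>]]]
  \<comment> \<open>The components are written as products of a function of the base point with a polynomial.\<close>
  note D = has_derivative_Pair[OF b1[OF F1] has_derivative_Pair[OF b1[OF F2]
     has_derivative_add[OF has_derivative_add[OF b1[OF F3] bu[OF W]] bv[OF pW]]]]
  have eq: "(zchart_factor \<tau> (?q s) * F1 s, zchart_factor \<tau> (?q s) * F2 s,
      zchart_factor \<tau> (?q s) * F3 s + du (zchart_factor \<tau>) (?q s) * (- lift_poly s) + dv (zchart_factor \<tau>) (?q s) * (- snd (snd s) * lift_poly s))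
      = lcY (zchart \<tau>) s" if "s \<in> lift_domain" for s
    using lcY_zchart[OF \<tau>, of "fst s" "fst (snd s)" "snd (snd s)"] that
    by (simp add: F1_def F2_def F3_def)
  note dY = has_derivative_transform_within_open[OF D open_lift_domain s eq]
  from frechet_derivative_at[OF dY, symmetric] show ?thesis
    by (simp add: F10 W0 F2_def F3_def)
qed

lemma lcG_zchart_vertical:
  assumes \<tau>: "\<tau> = 1 \<or> \<tau> = -1" and s: "(u, 0, 0) \<in> lift_domain"
  shows "D3 (lcG (zchart \<tau>)) (u, 0, 0) (0, 1, 0) = zchart_factor \<tau> (u, 0) * (- R * u)"
proof -
  define V where "V s = - R * fst s * fst (snd s) + (P - Q * (fst s)\<^sup>2 + R * (fst (snd s))\<^sup>2) * snd (snd s)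
      + Q * fst s * fst (snd s) * (snd (snd s))\<^sup>2" for s :: "real \<times> real \<times> real"
  have V: "(V has_derivative (\<lambda>w. - R * u * fst (snd w) + (P - Q * u\<^sup>2) * snd (snd w))) (at (u, 0, 0))"
    unfolding V_def[abs_def]
    by (rule derivative_eq_intros refl)+ (simp add: fun_eq_iff algebra_simps power2_eq_square)
  have eq: "zchart_factor \<tau> (fst r, fst (snd r)) * V r = lcG (zchart \<tau>) r" if "r \<in> lift_domain" for r
    using that
    by (cases r) (simp add: lcG_def V_def lift_domain_def zchart_coefficients[OF \<tau>],
        simp add: algebra_simps)
  note dG = has_derivative_transform_within_open[OF
      base_scaled_has_derivative[OF smooth_on_zchart_factor s V] open_lift_domain s eq]
  from frechet_derivative_at[OF dG, symmetric] show ?thesis by (simp add: V_def)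
qed

lemma zchart_mem:
  assumes "p \<in> E0" "p$3 \<noteq> 0"
  defines "\<tau> \<equiv> sgn (p$3)"
  shows "local_param_at E0 unit_disc (zchart \<tau>) (p$1 / a, p$2 / b) p"
proof -
  have nz: "a \<noteq> 0" "b \<noteq> 0" "c \<noteq> 0" using axes_pos by auto
  have \<tau>: "\<tau> = 1 \<or> \<tau> = -1" "\<tau> * \<tau> = 1" "\<tau> * (p$3 / c) > 0" "\<tau> \<noteq> 0"
    using assms(2) c_pos by (auto simp: \<tau>_def sgn_if divide_less_0_iff)
  have ndg: "cross3 (a *\<^sub>R axis 1 1) (b *\<^sub>R axis 2 1) \<bullet> ((\<tau> * c) *\<^sub>R axis 3 1) \<noteq> 0"
    using nz \<tau>(4) by (simp add: cross3_def inner_vec_def sum_3 vector_3 axis_def)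
  show ?thesis
    unfolding zchart_def
  proof (rule graph_chart_at(1)[OF E0_frames(1)[OF \<tau>(1)] ndg _ _ \<tau>(3), of p _ _ 0 0 0 0])
    show "p = (p$1 / a) *\<^sub>R a *\<^sub>R axis 1 1 + (p$2 / b) *\<^sub>R b *\<^sub>R axis 2 1
        + (\<tau> * (p$3 / c)) *\<^sub>R (\<tau> * c) *\<^sub>R axis 3 1"
      using \<tau>(2) nz by (simp add: vec_eq_iff forall_3 axis_def)
    show "(p$1 / a)\<^sup>2 + (p$2 / b)\<^sup>2 + (\<tau> * (p$3 / c))\<^sup>2 = 1"
      using assms(1) \<tau>(1) by (auto simp: mem_E0)
  qed auto
qed

text \<open>Since \<open>Q = P + R\<close>, the umbilic condition and the equation of the ellipse \<open>y = 0\<close> determine both squares.\<close>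

lemma umbilic_coordinates:
  assumes "umbilic E0 p"
  shows "Q * (p$1 / a)\<^sup>2 = P" and "Q * (p$3 / c)\<^sup>2 = R" and "p$2 = 0" and "p$1 \<noteq> 0" and "p$3 \<noteq> 0"
proof -
  have u: "(p$1 / a)\<^sup>2 + (p$3 / c)\<^sup>2 = 1" "p$2 = 0" "R * (p$1 / a)\<^sup>2 = P * (p$3 / c)\<^sup>2"
    using assms by (auto simp: umbilic_iff mem_E0)
  show "p$2 = 0" by (fact u)
  show 1: "Q * (p$1 / a)\<^sup>2 = P" using u(1,3) unfolding Q_eq by algebra
  show 2: "Q * (p$3 / c)\<^sup>2 = R" using u(1,3) unfolding Q_eq by algebra
  show "p$1 \<noteq> 0" "p$3 \<noteq> 0" using 1 2 P_pos R_pos by auto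
qed

text \<open>Over the umbilic point the field is \<open>(0, 0, k u p (Q + R p\<^sup>2))\<close> with \<open>k u \<noteq> 0\<close>, and \<open>Q + R p\<^sup>2 > 0\<close> leaves \<open>p = 0\<close> as
  its only zero. The eigenvalues there are \<open>-2 k Q u\<close> and \<open>k Q u\<close>.\<close>

lemma umbilic_D1:
  assumes "umbilic E0 p"
  defines "\<tau> \<equiv> sgn (p$3)"
  shows "D1_in E0 unit_disc (zchart \<tau>) (p$1 / a) 0 p"
    and "unique_saddle_slope (zchart \<tau>) (p$1 / a) 0 0"
proof -
  define u where "u = p$1 / a"
  note um = umbilic_coordinates[OF assms(1)]
  have \<tau>: "\<tau> = 1 \<or> \<tau> = -1" using um(5) by (auto simp: \<tau>_def sgn_if)
  have u: "Q * u\<^sup>2 = P" "u \<noteq> 0" using um a_pos by (auto simp: u_def)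
  have "p \<in> E0" using assms(1) by (simp add: umbilic_iff)
  then have lp: "local_param_at E0 unit_disc (zchart \<tau>) (u, 0) p"
    using zchart_mem[of p] um by (simp add: \<tau>_def u_def)
  then have uU: "(u, 0) \<in> unit_disc" by (simp add: local_param_at_def)
  then have dom: "(u, 0, r) \<in> lift_domain" for r by (simp add: lift_domain_def)
  define k where "k = zchart_factor \<tau> (u, 0)"
  have k: "k \<noteq> 0" using zchart_factor_nonzero[OF \<tau> uU] by (simp add: k_def)
  have W0: "lift_poly (u, 0, r) = 0" for r using u(1) by (simp add: lift_poly_def)
  have "D3 (lcF (zchart \<tau>)) (u, 0, r) \<noteq> (\<lambda>_. 0)" for r
  proof
    assume "D3 (lcF (zchart \<tau>)) (u, 0, r) = (\<lambda>_. 0)"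
    then have "D3 (lcF (zchart \<tau>)) (u, 0, r) (1, 0, 0) = 0" "D3 (lcF (zchart \<tau>)) (u, 0, r) (0, 1, 0) = 0"
      by auto
    then have "r = 0" "- R * u * r\<^sup>2 + Q * u = 0"
      using k u(2) Q_pos unfolding D3_lcF_zchart[OF \<tau> dom] by (auto simp: W0 k_def)
    then show False using u(2) Q_pos by simp
  qed
  moreover have G: "D3 (lcG (zchart \<tau>)) (u, 0, 0) (0, 1, 0) \<noteq> 0"
    using lcG_zchart_vertical[OF \<tau> dom] k u(2) R_pos by (simp add: k_def)
  ultimately have reg: "regular_along_fibre (zchart \<tau>) u 0"
    unfolding regular_along_fibre_def by auto
  have Y: "lcY (zchart \<tau>) (u, 0, r) = (0, 0, k * (u * r * (Q + R * r\<^sup>2)))" for r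
    unfolding lcY_zchart[OF \<tau> dom] W0 using u(1)
    by (simp add: k_def algebra_simps power2_eq_square power3_eq_cube)
  have "Q + R * r\<^sup>2 > 0" for r using Q_pos R_pos by (simp add: add_pos_nonneg)
  then have zeros: "{r. lcY (zchart \<tau>) (u, 0, r) = 0} = {0}"
    using k u(2) by (auto simp: Y zero_prod_def) (metis less_irrefl)
  have Z: "lcZ (zchart \<tau>) (u, 0, 0) \<noteq> 0"
    using G by (simp add: lcZ_def Let_def zero_prod_def)
  have ker: "D3 (lcF (zchart \<tau>)) (u, 0, 0) (x, 0, z) = 0" for x z
    unfolding D3_lcF_zchart[OF \<tau> dom] W0 using u(1) by simp
  define w1 w3 :: "real \<times> real \<times> real" where "w1 = (1, 0, 0)" and "w3 = (0, 0, 1)"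
  have e1: "D3 (lcY (zchart \<tau>)) (u, 0, 0) w1 = (k * (- 2 * Q * u)) *\<^sub>R w1"
    and e3: "D3 (lcY (zchart \<tau>)) (u, 0, 0) w3 = (k * (Q * u)) *\<^sub>R w3"
    using lcY_zchart_derivative[OF \<tau> dom u(1), of 1 0] lcY_zchart_derivative[OF \<tau> dom u(1), of 0 1]
    by (simp_all add: w1_def w3_def k_def)
  have nzw: "w1 \<noteq> 0" "w3 \<noteq> 0" by (simp_all add: w1_def w3_def zero_prod_def)
  have kerw: "D3 (lcF (zchart \<tau>)) (u, 0, 0) w1 = 0" "D3 (lcF (zchart \<tau>)) (u, 0, 0) w3 = 0"
    using ker by (simp_all add: w1_def w3_def)
  have ku: "k * (Q * u) \<noteq> 0" "k * (- 2 * Q * u) = - 2 * (k * (Q * u))" using k u Q_pos by auto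
  have "\<exists>w1 w2 m1 m2. m1 < 0 \<and> 0 < m2 \<and> w1 \<noteq> 0 \<and> w2 \<noteq> 0 \<and>
        D3 (lcF (zchart \<tau>)) (u, 0, 0) w1 = 0 \<and> D3 (lcF (zchart \<tau>)) (u, 0, 0) w2 = 0 \<and>
        D3 (lcY (zchart \<tau>)) (u, 0, 0) w1 = m1 *\<^sub>R w1 \<and> D3 (lcY (zchart \<tau>)) (u, 0, 0) w2 = m2 *\<^sub>R w2"
  proof (cases "k * (Q * u) > 0")
    case True
    then have "k * (- 2 * Q * u) < 0" using ku(2) by linarith
    then show ?thesis using True nzw kerw e1 e3 by blast
  next
    case False
    then have "k * (- 2 * Q * u) > 0" "k * (Q * u) < 0" using ku by linarith+
    then show ?thesis using nzw kerw e1 e3 by blast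
  qed
  then have "hyperbolic_saddle_on (lcF (zchart \<tau>)) (lcY (zchart \<tau>)) (u, 0, 0)"
    unfolding hyperbolic_saddle_on_def
    using lcF_zchart[OF \<tau> dom] W0 zeros by auto
  then show S: "unique_saddle_slope (zchart \<tau>) (p$1 / a) 0 0"
    unfolding unique_saddle_slope_def u_def[symmetric] using zeros Z by blast
  have "L1 (zchart \<tau>) (u, 0) = 0" "M1 (zchart \<tau>) (u, 0) = 0" "N1 (zchart \<tau>) (u, 0) = 0"
    using zchart_coefficients[OF \<tau> uU] u(1) by simp_all
  then show "D1_in E0 unit_disc (zchart \<tau>) (p$1 / a) 0 p"
    unfolding D1_in_def u_def[symmetric] using lp reg S[folded u_def] by blast
qed

section \<open>Principal lines meeting the plane y = 0\<close>

text \<open>Dividing by the semi-axes turns the ellipsoid into the unit sphere; the semi-axes then disappear from the tangency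
  condition and enter the principal equation only through \<open>P\<close>, \<open>Q\<close> and \<open>R\<close>.\<close>

lemma principal_immersion_coordinates:
  assumes "principal_immersion E0 \<gamma>"
  obtains X Y Z X' Y' Z' :: "real \<Rightarrow> real" where
    "\<And>t. X t = \<gamma> t $ 1 / a" "\<And>t. Y t = \<gamma> t $ 2 / b" "\<And>t. Z t = \<gamma> t $ 3 / c"
    "\<And>t. (X has_real_derivative X' t) (at t)" "\<And>t. (Y has_real_derivative Y' t) (at t)"
    "\<And>t. (Z has_real_derivative Z' t) (at t)"
    "continuous_on UNIV X'" "continuous_on UNIV Y'" "continuous_on UNIV Z'"
    "\<And>t. (X t)\<^sup>2 + (Y t)\<^sup>2 + (Z t)\<^sup>2 = 1"
    "\<And>t. X t * X' t + Y t * Y' t + Z t * Z' t = 0"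
    "\<And>t. P * Z t * X' t * Y' t - Q * Y t * X' t * Z' t + R * X t * Y' t * Z' t = 0"
    "\<And>t. X' t \<noteq> 0 \<or> Y' t \<noteq> 0 \<or> Z' t \<noteq> 0"
    "\<And>t. Y t \<noteq> 0 \<or> R * (X t)\<^sup>2 \<noteq> P * (Z t)\<^sup>2"
proof -
  have nz: "a \<noteq> 0" "b \<noteq> 0" "c \<noteq> 0" using axes_pos by auto
  have sm: "smooth_on UNIV \<gamma>" using assms by (simp add: principal_immersion_def)
  define \<gamma>' where "\<gamma>' t = vector_derivative \<gamma> (at t)" for t
  note D = smooth_on_UNIV_vector_derivative[OF sm, folded \<gamma>'_def]
  have comp: "((\<lambda>t. \<gamma> t $ i / d) has_real_derivative \<gamma>' t $ i / d) (at t)" for t i and d :: real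
  proof -
    have "((\<lambda>t. \<gamma> t $ i) has_vector_derivative \<gamma>' t $ i) (at t)"
      by (rule bounded_linear.has_vector_derivative[OF bounded_linear_vec_nth D(1)])
    then have "((\<lambda>t. \<gamma> t $ i) has_real_derivative \<gamma>' t $ i) (at t)"
      by (simp add: has_real_derivative_iff_has_vector_derivative)
    then show ?thesis by (rule DERIV_cdivide)
  qed
  have cont: "continuous_on UNIV (\<lambda>t. \<gamma>' t $ i / d)" for i and d :: real
    unfolding divide_inverse by (intro continuous_intros D(2))
  have pr: "\<gamma>' t \<noteq> 0" "\<gamma> t \<in> E0" "\<not> umbilic E0 (\<gamma> t)" "mink (shape (\<gamma> t)) (\<gamma>' t) = 0"
    "principal_form (\<gamma> t) (\<gamma>' t) = 0" for t
    using assms unfolding principal_immersion_def principal_direction_iff \<gamma>'_def by auto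
  show ?thesis
  proof (rule that)
    show "(\<gamma> t $ 1 / a)\<^sup>2 + (\<gamma> t $ 2 / b)\<^sup>2 + (\<gamma> t $ 3 / c)\<^sup>2 = 1" for t
      using pr(2) by (simp add: mem_E0)
    show "\<gamma> t $ 1 / a * (\<gamma>' t $ 1 / a) + \<gamma> t $ 2 / b * (\<gamma>' t $ 2 / b) + \<gamma> t $ 3 / c * (\<gamma>' t $ 3 / c) = 0" for t
      using pr(4)[of t] by (simp add: tangent_eq power2_eq_square)
    show "P * (\<gamma> t $ 3 / c) * (\<gamma>' t $ 1 / a) * (\<gamma>' t $ 2 / b) - Q * (\<gamma> t $ 2 / b) * (\<gamma>' t $ 1 / a) * (\<gamma>' t $ 3 / c)
        + R * (\<gamma> t $ 1 / a) * (\<gamma>' t $ 2 / b) * (\<gamma>' t $ 3 / c) = 0" for t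
    proof -
      have "P * (\<gamma> t $ 3 / c) * (\<gamma>' t $ 1 / a) * (\<gamma>' t $ 2 / b) - Q * (\<gamma> t $ 2 / b) * (\<gamma>' t $ 1 / a) * (\<gamma>' t $ 3 / c)
        + R * (\<gamma> t $ 1 / a) * (\<gamma>' t $ 2 / b) * (\<gamma>' t $ 3 / c) = principal_form (\<gamma> t) (\<gamma>' t) / (a * b * c)"
        using nz by (simp add: principal_form_def field_simps)
      then show ?thesis using pr(5) by simp
    qed
    show "\<gamma>' t $ 1 / a \<noteq> 0 \<or> \<gamma>' t $ 2 / b \<noteq> 0 \<or> \<gamma>' t $ 3 / c \<noteq> 0" for t
      using pr(1)[of t] nz by (auto simp: vec_eq_iff forall_3)
    show "\<gamma> t $ 2 / b \<noteq> 0 \<or> R * (\<gamma> t $ 1 / a)\<^sup>2 \<noteq> P * (\<gamma> t $ 3 / c)\<^sup>2" for t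
      using pr(2,3)[of t] nz by (auto simp: umbilic_iff)
  qed (rule refl comp cont)+
qed

text \<open>The equation of principal lines is \<open>Y' (P Z X' + R X Z') = Q X' Z' Y\<close>. Where \<open>Y = Y' = 0\<close>, the velocity is tangent to
  the section \<open>y = 0\<close>, and then \<open>P Z X' + R X Z' = 0\<close> would make the point umbilic.\<close>

lemma cy_invariant:
  assumes "principal_immersion E0 \<gamma>" and "\<gamma> t0 $ 2 = 0" "vector_derivative \<gamma> (at t0) $ 2 = 0"
  shows "\<gamma> t $ 2 = 0"
proof -
  obtain X Y Z X' Y' Z' :: "real \<Rightarrow> real" where
    c: "\<And>t. X t = \<gamma> t $ 1 / a" "\<And>t. Y t = \<gamma> t $ 2 / b" "\<And>t. Z t = \<gamma> t $ 3 / c"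
    and d: "\<And>t. (X has_real_derivative X' t) (at t)" "\<And>t. (Y has_real_derivative Y' t) (at t)"
      "\<And>t. (Z has_real_derivative Z' t) (at t)"
    and cont: "continuous_on UNIV X'" "continuous_on UNIV Y'" "continuous_on UNIV Z'"
    and e: "\<And>t. (X t)\<^sup>2 + (Y t)\<^sup>2 + (Z t)\<^sup>2 = 1"
      "\<And>t. X t * X' t + Y t * Y' t + Z t * Z' t = 0"
      "\<And>t. P * Z t * X' t * Y' t - Q * Y t * X' t * Z' t + R * X t * Y' t * Z' t = 0"
    and nz: "\<And>t. X' t \<noteq> 0 \<or> Y' t \<noteq> 0 \<or> Z' t \<noteq> 0" "\<And>t. Y t \<noteq> 0 \<or> R * (X t)\<^sup>2 \<noteq> P * (Z t)\<^sup>2"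
    using principal_immersion_coordinates[OF assms(1)] by blast
  have ct: "continuous_on UNIV X" "continuous_on UNIV Y" "continuous_on UNIV Z"
    using d by (auto intro!: continuous_at_imp_continuous_on DERIV_isCont)
  have "Y t0 = 0" using assms(2) c by simp
  have "(\<gamma> has_vector_derivative vector_derivative \<gamma> (at t0)) (at t0)"
    using assms(1) smooth_on_UNIV_vector_derivative(1) by (auto simp: principal_immersion_def)
  then have "((\<lambda>t. \<gamma> t $ 2) has_real_derivative 0) (at t0)"
    using bounded_linear.has_vector_derivative[OF bounded_linear_vec_nth, of \<gamma> _ "at t0" 2] assms(3)
    by (metis has_real_derivative_iff_has_vector_derivative)
  then have "((\<lambda>t. \<gamma> t $ 2 / b) has_real_derivative 0 / b) (at t0)" by (rule DERIV_cdivide)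
  moreover have "(\<lambda>t. \<gamma> t $ 2 / b) = Y" using c(2) by auto
  ultimately have "Y' t0 = 0" using DERIV_unique[OF d(2)[of t0]] by simp
  have "Y t = 0"
  proof (rule first_order_zero_propagation[of UNIV t0 Y Y' "\<lambda>t. P * Z t * X' t + R * X t * Z' t" "\<lambda>t. Q * X' t * Z' t"])
    show "Y' t * (P * Z t * X' t + R * X t * Z' t) = Q * X' t * Z' t * Y t" for t
      using e(3)[of t] by (simp add: algebra_simps)
    show "P * Z t * X' t + R * X t * Z' t \<noteq> 0" if "Y t = 0" "Y' t = 0" for t
    proof
      assume g: "P * Z t * X' t + R * X t * Z' t = 0"
      have t: "X t * X' t + Z t * Z' t = 0" using e(2)[of t] that by simp
      have "X' t * (R * (X t)\<^sup>2 - P * (Z t)\<^sup>2) = 0" "Z' t * (R * (X t)\<^sup>2 - P * (Z t)\<^sup>2) = 0"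
        using g t by algebra+
      then show False using nz[of t] that by auto
    qed
  qed (use \<open>Y t0 = 0\<close> \<open>Y' t0 = 0\<close> d(2) in \<open>auto intro!: continuous_intros cont ct\<close>)
  then show ?thesis using c(2) b_pos by simp
qed

text \<open>In the functions \<open>\<tau>\<close> and \<open>v = r p y\<^sup>2\<close>, whose values are the sum and minus the product of two confocal parameters, the
  conclusion multiplied by \<open>r p y\<close> is \<open>v'\<^sup>2 + \<tau> \<tau>' v' - v \<tau>'\<^sup>2 = 0\<close>, Clairaut's equation. Modulo the first two
  hypotheses, the left-hand side of the conclusion is a multiple of \<open>x z\<close> times the principal form.\<close>

lemma clairaut_identity:
  fixes x y z x' y' z' p r :: real
  assumes "x\<^sup>2 + y\<^sup>2 + z\<^sup>2 = 1" "x * x' + y * y' + z * z' = 0"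
    and "p * z * x' * y' - (p + r) * y * x' * z' + r * x * y' * z' = 0"
  defines "\<tau> \<equiv> p * x\<^sup>2 - r * z\<^sup>2 + (r - p)" and "\<tau>' \<equiv> 2 * p * x * x' - 2 * r * z * z'"
  shows "4 * (r * p) * y * y'\<^sup>2 + 2 * \<tau> * \<tau>' * y' - y * \<tau>'\<^sup>2 = 0"
  using assms(1-3) unfolding \<tau>_def \<tau>'_def by algebra

text \<open>Suppose \<open>Y \<noteq> 0\<close> at some late time. Through the corresponding point of the \<open>(\<tau>, k Y\<^sup>2)\<close>-plane pass two lines
  \<open>r\<^sup>2 - r \<tau> - k Y\<^sup>2 = 0\<close>, both with \<open>r \<noteq> 0\<close>, and Clairaut's equation says that the curve is tangent to one of them.
  Then \<open>f = r\<^sup>2 - r \<tau> - k Y\<^sup>2\<close> has a double zero, so it vanishes at all late times, whereas it tends to \<open>r\<^sup>2\<close>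
  at the umbilic point. Near the umbilic point \<open>x z \<noteq> 0\<close>, so \<open>\<tau>\<close> and \<open>Y\<close> are coordinates, which excludes the
  degenerate case of the propagation principle.\<close>

lemma limit_umbilic_imp_cy:
  assumes im: "principal_immersion E0 \<gamma>" and um: "umbilic E0 p" and lim: "(\<gamma> \<longlongrightarrow> p) at_top"
  shows "\<gamma> t $ 2 = 0"
proof -
  obtain X Y Z X' Y' Z' :: "real \<Rightarrow> real" where
    c: "\<And>t. X t = \<gamma> t $ 1 / a" "\<And>t. Y t = \<gamma> t $ 2 / b" "\<And>t. Z t = \<gamma> t $ 3 / c"
    and d: "\<And>t. (X has_real_derivative X' t) (at t)" "\<And>t. (Y has_real_derivative Y' t) (at t)"
      "\<And>t. (Z has_real_derivative Z' t) (at t)"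
    and cont: "continuous_on UNIV X'" "continuous_on UNIV Y'" "continuous_on UNIV Z'"
    and e: "\<And>t. (X t)\<^sup>2 + (Y t)\<^sup>2 + (Z t)\<^sup>2 = 1"
      "\<And>t. X t * X' t + Y t * Y' t + Z t * Z' t = 0"
      "\<And>t. P * Z t * X' t * Y' t - Q * Y t * X' t * Z' t + R * X t * Y' t * Z' t = 0"
    and nz: "\<And>t. X' t \<noteq> 0 \<or> Y' t \<noteq> 0 \<or> Z' t \<noteq> 0" "\<And>t. Y t \<noteq> 0 \<or> R * (X t)\<^sup>2 \<noteq> P * (Z t)\<^sup>2"
    using principal_immersion_coordinates[OF im] by blast
  have ct: "continuous_on A X" "continuous_on A Y" "continuous_on A Z" for A
    using d by (auto intro!: continuous_at_imp_continuous_on DERIV_isCont)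
  note cont' = continuous_on_subset[OF cont(1)] continuous_on_subset[OF cont(2)] continuous_on_subset[OF cont(3)]
  define x0 z0 where "x0 = p$1 / a" and "z0 = p$3 / c"
  note uc = umbilic_coordinates[OF um, folded x0_def z0_def]
  have "((\<lambda>t. \<gamma> t $ i / r) \<longlongrightarrow> p $ i / r) at_top" for i and r :: real
    unfolding divide_inverse by (intro tendsto_intros lim)
  from this[of 1 a] this[of 2 b] this[of 3 c]
  have limX: "(X \<longlongrightarrow> x0) at_top" and limY: "(Y \<longlongrightarrow> 0) at_top" and limZ: "(Z \<longlongrightarrow> z0) at_top"
    using uc(3) by (simp_all add: c[symmetric] x0_def z0_def)
  have "x0 \<noteq> 0" "z0 \<noteq> 0" using uc axes_pos by (auto simp: x0_def z0_def)
  then have "\<forall>\<^sub>F t in at_top. X t \<noteq> 0 \<and> Z t \<noteq> 0"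
    using tendsto_imp_eventually_ne[OF limX] tendsto_imp_eventually_ne[OF limZ] eventually_conj by blast
  then obtain T where T: "\<And>t. t \<ge> T \<Longrightarrow> X t \<noteq> 0 \<and> Z t \<noteq> 0"
    by (auto simp: eventually_at_top_linorder)
  define \<tau> where "\<tau> t = P * (X t)\<^sup>2 - R * (Z t)\<^sup>2 + (R - P)" for t
  define \<tau>' where "\<tau>' t = 2 * P * X t * X' t - 2 * R * Z t * Z' t" for t
  have d\<tau>: "(\<tau> has_real_derivative \<tau>' t) (at t)" for t
    unfolding \<tau>_def[abs_def] \<tau>'_def by (auto intro!: derivative_eq_intros d simp: algebra_simps)
  define k where "k = R * P"
  have k: "k > 0" using P_pos R_pos by (simp add: k_def)
  have K: "4 * k * Y t * (Y' t)\<^sup>2 + 2 * \<tau> t * \<tau>' t * Y' t - Y t * (\<tau>' t)\<^sup>2 = 0" for t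
    using clairaut_identity[OF e(1,2) e(3)[unfolded Q_eq]] unfolding k_def \<tau>_def \<tau>'_def .
  have "Y t0 = 0" if t0: "t0 > T" for t0
  proof (rule ccontr)
    assume Y0: "Y t0 \<noteq> 0"
    define s where "s = sqrt ((\<tau> t0)\<^sup>2 + 4 * k * (Y t0)\<^sup>2)"
    have s2: "s * s = (\<tau> t0)\<^sup>2 + 4 * k * (Y t0)\<^sup>2"
      unfolding s_def using k by (simp add: add_nonneg_nonneg)
    \<comment> \<open>The parameters of the two lines through the point; they are nonzero because their product is \<open>- k Y\<^sup>2\<close>.\<close>
    define r1 r2 where "r1 = (\<tau> t0 + s) / 2" and "r2 = (\<tau> t0 - s) / 2"
    have r: "r1 + r2 = \<tau> t0" "r1 * r2 = - k * (Y t0)\<^sup>2"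
      using s2 by (auto simp: r1_def r2_def field_simps power2_eq_square)
    have "(r1 * \<tau>' t0 + 2 * k * Y t0 * Y' t0) * (r2 * \<tau>' t0 + 2 * k * Y t0 * Y' t0) =
        r1 * r2 * (\<tau>' t0)\<^sup>2 + (r1 + r2) * (2 * k * Y t0 * Y' t0 * \<tau>' t0) + (2 * k * Y t0 * Y' t0)\<^sup>2"
      by (simp add: algebra_simps power2_eq_square)
    also have "\<dots> = k * Y t0 * (4 * k * Y t0 * (Y' t0)\<^sup>2 + 2 * \<tau> t0 * \<tau>' t0 * Y' t0 - Y t0 * (\<tau>' t0)\<^sup>2)"
      unfolding r by (simp add: algebra_simps power2_eq_square)
    finally have "(r1 * \<tau>' t0 + 2 * k * Y t0 * Y' t0) * (r2 * \<tau>' t0 + 2 * k * Y t0 * Y' t0) = 0"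
      by (simp add: K)
    moreover have "r1 \<noteq> 0" "r2 \<noteq> 0" using r(2) k Y0 by auto
    moreover have "r1\<^sup>2 - r1 * \<tau> t0 - k * (Y t0)\<^sup>2 = 0" "r2\<^sup>2 - r2 * \<tau> t0 - k * (Y t0)\<^sup>2 = 0"
    proof -
      have kY: "k * (Y t0)\<^sup>2 = - (r1 * r2)" using r(2) by simp
      show "r1\<^sup>2 - r1 * \<tau> t0 - k * (Y t0)\<^sup>2 = 0" "r2\<^sup>2 - r2 * \<tau> t0 - k * (Y t0)\<^sup>2 = 0"
        unfolding kY r(1)[symmetric] by (simp_all add: algebra_simps power2_eq_square)
    qed
    ultimately obtain r where r: "r \<noteq> 0" "r\<^sup>2 - r * \<tau> t0 - k * (Y t0)\<^sup>2 = 0"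
        "r * \<tau>' t0 + 2 * k * Y t0 * Y' t0 = 0"
      by (metis mult_eq_0_iff)
    define f where "f t = r\<^sup>2 - r * \<tau> t - k * (Y t)\<^sup>2" for t
    define f' where "f' t = - (r * \<tau>' t + 2 * k * Y t * Y' t)" for t
    have f0: "f t = 0" if "t > T" for t
    proof (rule first_order_zero_propagation[of "{T<..}" t0 f f' "\<lambda>t. 2 * r * Y' t - Y t * \<tau>' t" "\<lambda>t. - 2 * \<tau>' t * Y' t"])
      show "(f has_real_derivative f' t) (at t)" for t
        unfolding f_def[abs_def] f'_def
        by (auto intro!: derivative_eq_intros d d\<tau> simp: algebra_simps)
      show "f' t * (2 * r * Y' t - Y t * \<tau>' t) = - 2 * \<tau>' t * Y' t * f t" for t
        using K[of t] unfolding f_def f'_def by algebra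
      show "2 * r * Y' t - Y t * \<tau>' t \<noteq> 0" if "t \<in> {T<..}" "f t = 0" "f' t = 0" for t
      proof
        assume g: "2 * r * Y' t - Y t * \<tau>' t = 0"
        have h: "r * \<tau>' t = - 2 * k * Y t * Y' t" using that(3) by (simp add: f'_def)
        have "(r\<^sup>2 + k * (Y t)\<^sup>2) * Y' t = 0" using g h by algebra
        moreover have "r\<^sup>2 + k * (Y t)\<^sup>2 > 0" using r(1) k by (simp add: add_pos_nonneg)
        ultimately have "Y' t = 0" by auto
        then have "\<tau>' t = 0" using h r(1) by simp
        have 1: "X t * X' t + Z t * Z' t = 0" using e(2)[of t] \<open>Y' t = 0\<close> by simp
        moreover have "P * (X t * X' t) = R * (Z t * Z' t)" using \<open>\<tau>' t = 0\<close> by (simp add: \<tau>'_def)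
        ultimately have "Q * (X t * X' t) = 0" unfolding Q_eq by algebra
        then have "X t * X' t = 0" using Q_pos by simp
        then have "X' t = 0" "Z' t = 0" using 1 T[of t] that(1) by auto
        then show False using nz(1)[of t] \<open>Y' t = 0\<close> by simp
      qed
      show "continuous_on {T<..} f'"
        unfolding f'_def \<tau>'_def by (intro continuous_intros ct cont') auto
      show "continuous_on {T<..} (\<lambda>t. 2 * r * Y' t - Y t * \<tau>' t)"
        unfolding \<tau>'_def by (intro continuous_intros ct cont') auto
      show "continuous_on {T<..} (\<lambda>t. - 2 * \<tau>' t * Y' t)"
        unfolding \<tau>'_def by (intro continuous_intros ct cont') auto
      show "f t0 = 0" "f' t0 = 0" using r by (simp_all add: f_def f'_def)
    qed (use t0 that in auto)
    have "(f \<longlongrightarrow> r\<^sup>2 - r * (P * x0\<^sup>2 - R * z0\<^sup>2 + (R - P)) - k * 0\<^sup>2) at_top"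
      unfolding f_def[abs_def] \<tau>_def by (intro tendsto_intros limX limY limZ)
    moreover have "P * x0\<^sup>2 - R * z0\<^sup>2 + (R - P) = 0"
    proof -
      have "Q * (P * x0\<^sup>2 - R * z0\<^sup>2 + (R - P)) = P * (Q * x0\<^sup>2) - R * (Q * z0\<^sup>2) + Q * (R - P)"
        by (simp add: algebra_simps)
      also have "\<dots> = 0" unfolding uc(1,2) by (simp add: Q_eq algebra_simps)
      finally show ?thesis using Q_pos by simp
    qed
    moreover have "\<forall>\<^sub>F t in at_top. f t = 0"
      by (rule eventually_mono[OF eventually_gt_at_top[of T]]) (rule f0)
    then have "(f \<longlongrightarrow> 0) at_top" by (rule tendsto_eventually)
    ultimately have "r\<^sup>2 = 0" using tendsto_unique[of at_top f] by fastforce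
    then show False using r(1) by simp
  qed
  then have y0: "\<gamma> t $ 2 = 0" if "t > T" for t using that c(2)[of t] b_pos by simp
  have "((\<lambda>t. \<gamma> t $ 2) has_vector_derivative vector_derivative \<gamma> (at (T + 1)) $ 2) (at (T + 1))"
    by (rule bounded_linear.has_vector_derivative[OF bounded_linear_vec_nth smooth_on_UNIV_vector_derivative(1)])
       (use im in \<open>simp add: principal_immersion_def\<close>)
  then have "((\<lambda>t. 0) has_vector_derivative vector_derivative \<gamma> (at (T + 1)) $ 2) (at (T + 1))"
    by (rule has_vector_derivative_transform_within_open[of _ _ _ "{T<..}"]) (use y0 in auto)
  then have "vector_derivative \<gamma> (at (T + 1)) $ 2 = 0"
    by (metis has_vector_derivative_const vector_derivative_unique_at)
  with cy_invariant[OF im y0[of "T + 1"]] show ?thesis by simp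
qed

section \<open>The coordinate sections x = 0 and z = 0\<close>

lemma not_umbilicI: "p$1 = 0 \<or> p$3 = 0 \<Longrightarrow> \<not> umbilic E0 p"
  using umbilic_coordinates(4,5) by blast

lemma principal_line_cx: "principal_line E0 ({p. p$1 = 0} \<inter> E0)"
proof -
  define \<gamma> :: "real \<Rightarrow> real^3" where "\<gamma> t = vector [0, b * cos t, c * sin t]" for t
  have nz: "b \<noteq> 0" "c \<noteq> 0" using axes_pos by auto
  have "principal_immersion E0 \<gamma>"
  proof (rule principal_immersionI)
    show "smooth_on UNIV \<gamma>"
      unfolding \<gamma>_def[abs_def]
      by (intro smooth_on_vector_3 smooth_on_mult smooth_on_const smooth_on_cos smooth_on_sin open_UNIV)
    show "\<gamma> t \<in> E0" for t using nz by (simp add: mem_E0 \<gamma>_def vector_3)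
    show "\<not> umbilic E0 (\<gamma> t)" for t by (rule not_umbilicI) (simp add: \<gamma>_def vector_3)
    show "(\<gamma> has_vector_derivative vector [0, - b * sin t, c * cos t]) (at t)" for t
      unfolding \<gamma>_def[abs_def] by (intro has_vector_derivative_vector_3 DERIV_const cos_sin_derivatives)
    show "(vector [0, - b * sin t, c * cos t] :: real^3) \<noteq> 0" for t
      using sin_zero_abs_cos_one[of t] nz by (auto simp: vec_eq_iff forall_3 vector_3)
    show "principal_form (\<gamma> t) (vector [0, - b * sin t, c * cos t]) = 0" for t
      by (simp add: principal_form_def \<gamma>_def vector_3)
  qed
  moreover have "{p. p$1 = 0} \<inter> E0 = range \<gamma>"
  proof (intro equalityI subsetI)
    fix p assume "p \<in> {p. p$1 = 0} \<inter> E0"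
    then have "p$1 = 0" "(p$2 / b)\<^sup>2 + (p$3 / c)\<^sup>2 = 1" by (auto simp: mem_E0)
    then obtain t where "p$2 / b = cos t" "p$3 / c = sin t" using sincos_total_2pi by metis
    then have "p = \<gamma> t" using nz \<open>p$1 = 0\<close> by (simp add: \<gamma>_def vec_eq_iff forall_3 vector_3 field_simps)
    then show "p \<in> range \<gamma>" by blast
  qed (use nz in \<open>auto simp: mem_E0 \<gamma>_def vector_3\<close>)
  ultimately show ?thesis unfolding principal_line_def by blast
qed

lemma principal_line_cz: "principal_line E0 ({p. p$3 = 0} \<inter> E0)"
proof -
  define \<gamma> :: "real \<Rightarrow> real^3" where "\<gamma> t = vector [a * cos t, b * sin t, 0]" for t
  have nz: "a \<noteq> 0" "b \<noteq> 0" using axes_pos by auto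
  have "principal_immersion E0 \<gamma>"
  proof (rule principal_immersionI)
    show "smooth_on UNIV \<gamma>"
      unfolding \<gamma>_def[abs_def]
      by (intro smooth_on_vector_3 smooth_on_mult smooth_on_const smooth_on_cos smooth_on_sin open_UNIV)
    show "\<gamma> t \<in> E0" for t using nz by (simp add: mem_E0 \<gamma>_def vector_3)
    show "\<not> umbilic E0 (\<gamma> t)" for t by (rule not_umbilicI) (simp add: \<gamma>_def vector_3)
    show "(\<gamma> has_vector_derivative vector [- a * sin t, b * cos t, 0]) (at t)" for t
      unfolding \<gamma>_def[abs_def] by (intro has_vector_derivative_vector_3 DERIV_const cos_sin_derivatives)
    show "(vector [- a * sin t, b * cos t, 0] :: real^3) \<noteq> 0" for t
      using sin_zero_abs_cos_one[of t] nz by (auto simp: vec_eq_iff forall_3 vector_3)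
    show "principal_form (\<gamma> t) (vector [- a * sin t, b * cos t, 0]) = 0" for t
      by (simp add: principal_form_def \<gamma>_def vector_3)
  qed
  moreover have "{p. p$3 = 0} \<inter> E0 = range \<gamma>"
  proof (intro equalityI subsetI)
    fix p assume "p \<in> {p. p$3 = 0} \<inter> E0"
    then have "p$3 = 0" "(p$1 / a)\<^sup>2 + (p$2 / b)\<^sup>2 = 1" by (auto simp: mem_E0)
    then obtain t where "p$1 / a = cos t" "p$2 / b = sin t" using sincos_total_2pi by metis
    then have "p = \<gamma> t" using nz \<open>p$3 = 0\<close> by (simp add: \<gamma>_def vec_eq_iff forall_3 vector_3 field_simps)
    then show "p \<in> range \<gamma>" by blast
  qed (use nz in \<open>auto simp: mem_E0 \<gamma>_def vector_3\<close>)
  ultimately show ?thesis unfolding principal_line_def by blast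
qed

section \<open>The four umbilic points\<close>

text \<open>Multiplied by \<open>Q\<close>, the value is \<open>P / a\<^sup>2 - R / c\<^sup>2 = - b\<^sup>2 / a\<^sup>2 - b\<^sup>2 / c\<^sup>2\<close>.\<close>

lemma umbilic_spacelike:
  assumes "umbilic E0 p" shows "mink (shape p) (shape p) < 0"
proof -
  note u = umbilic_coordinates[OF assms]
  define x z where "x = (p$1 / a)\<^sup>2" and "z = (p$3 / c)\<^sup>2"
  have "Q * (x / a\<^sup>2 - z / c\<^sup>2) = P / a\<^sup>2 - R / c\<^sup>2"
    using u(1,2) by (simp add: x_def z_def right_diff_distrib)
  also have "\<dots> = - (b\<^sup>2 / a\<^sup>2 + b\<^sup>2 / c\<^sup>2)"
    using axes_pos by (simp add: P_def R_def diff_divide_distrib add_divide_distrib)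
  also have "\<dots> < 0"
  proof -
    have "b\<^sup>2 / a\<^sup>2 > 0" "b\<^sup>2 / c\<^sup>2 > 0" using axes_pos by simp_all
    then show ?thesis by linarith
  qed
  finally have "x / a\<^sup>2 - z / c\<^sup>2 < 0" using Q_pos by (simp add: mult_less_0_iff)
  moreover have "mink (shape p) (shape p) = x / a\<^sup>2 - z / c\<^sup>2"
    using u(3) by (simp add: mink_def shape_def vector_3 x_def z_def power2_eq_square)
  ultimately show ?thesis by simp
qed

lemma umbilic_spacelike_iff: "umbilic E0 p \<and> spacelike_point E0 p \<longleftrightarrow> umbilic E0 p"
  using umbilic_spacelike by (auto simp: spacelike_point_iff umbilic_iff)

lemma umbilics_eq:
  "{p. umbilic E0 p} = {vector [\<sigma> * (a * sqrt (P / Q)), 0, \<tau> * (c * sqrt (R / Q))] | \<sigma> \<tau>.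
     \<sigma> \<in> {-1, 1} \<and> \<tau> \<in> {-1, 1}}" (is "?L = ?M")
proof (intro equalityI subsetI)
  have nz: "a \<noteq> 0" "b \<noteq> 0" "c \<noteq> 0" "Q \<noteq> 0" using axes_pos Q_pos by auto
  fix p :: "real^3"
  {
    assume "p \<in> ?L"
    then have "umbilic E0 p" by simp
    note u = umbilic_coordinates[OF this]
    have "(p$1 / a)\<^sup>2 = P / Q" "(p$3 / c)\<^sup>2 = R / Q" using u(1,2) nz by (simp_all add: field_simps)
    then have "p$1 / a = sqrt (P / Q) \<or> p$1 / a = - sqrt (P / Q)" "p$3 / c = sqrt (R / Q) \<or> p$3 / c = - sqrt (R / Q)"
      using sq_root_cases by blast+
    then obtain \<sigma> \<tau> where st: "\<sigma> \<in> {-1, 1}" "\<tau> \<in> {-1, 1}" "p$1 / a = \<sigma> * sqrt (P / Q)" "p$3 / c = \<tau> * sqrt (R / Q)"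
      by (metis insertI1 insertI2 mult_1 mult_minus1)
    then have "p$1 = \<sigma> * (a * sqrt (P / Q))" "p$3 = \<tau> * (c * sqrt (R / Q))"
      using nz by (simp_all add: field_simps)
    then have "p = vector [\<sigma> * (a * sqrt (P / Q)), 0, \<tau> * (c * sqrt (R / Q))]"
      using u(3) by (simp add: vec_eq_iff forall_3 vector_3)
    then show "p \<in> ?M" using st by blast
  next
    assume "p \<in> ?M"
    then obtain \<sigma> \<tau> where st: "\<sigma> \<in> {-1, 1}" "\<tau> \<in> {-1, 1}"
      "p = vector [\<sigma> * (a * sqrt (P / Q)), 0, \<tau> * (c * sqrt (R / Q))]" by blast
    have "\<sigma>\<^sup>2 = 1" "\<tau>\<^sup>2 = 1" using st by auto
    then have c: "(p$1 / a)\<^sup>2 = P / Q" "(p$3 / c)\<^sup>2 = R / Q" "p$2 = 0"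
      using st(3) nz P_pos Q_pos R_pos by (simp_all add: vector_3 power_mult_distrib)
    have "P / Q + R / Q = 1" using nz by (simp add: Q_eq add_divide_distrib[symmetric])
    then show "p \<in> ?L" using c by (simp add: umbilic_iff mem_E0)
  }
qed

lemma card_umbilics: "card {p. umbilic E0 p} = 4"
proof -
  define f :: "real \<times> real \<Rightarrow> real^3" where
    "f = (\<lambda>(\<sigma>, \<tau>). vector [\<sigma> * (a * sqrt (P / Q)), 0, \<tau> * (c * sqrt (R / Q))])"
  have "{p. umbilic E0 p} = f ` ({-1, 1} \<times> {-1, 1})"
  proof (intro equalityI subsetI)
    fix p assume "p \<in> {p. umbilic E0 p}"
    then obtain \<sigma> \<tau> where "\<sigma> \<in> {-1, 1}" "\<tau> \<in> {-1, 1}" "p = f (\<sigma>, \<tau>)"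
      unfolding umbilics_eq f_def by auto
    then show "p \<in> f ` ({-1, 1} \<times> {-1, 1})" by blast
  next
    fix p assume "p \<in> f ` ({-1, 1} \<times> {-1, 1})"
    then obtain \<sigma> \<tau> where "\<sigma> \<in> {-1, 1}" "\<tau> \<in> {-1, 1}" "p = f (\<sigma>, \<tau>)" by blast
    then show "p \<in> {p. umbilic E0 p}" unfolding umbilics_eq f_def prod.case by blast
  qed
  moreover have "inj_on f ({-1, 1} \<times> {-1, 1})"
    using axes_pos P_pos Q_pos R_pos
    by (auto simp: inj_on_def f_def vec_eq_iff forall_3 vector_3)
  ultimately have "card {p. umbilic E0 p} = card ({-1, 1::real} \<times> {-1, 1::real})"
    by (simp only: card_image)
  then show ?thesis by (simp add: card_cartesian_product)
qed

section \<open>The tropic\<close>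

text \<open>Along the curve \<open>\<langle>\<xi>, \<xi>\<rangle> = 0\<close> for \<open>\<xi> = shape (\<gamma> t)\<close>, so \<open>\<xi>\<close> is orthogonal to the velocity \<open>w\<close>, to \<open>shape w\<close> and to itself;
  hence \<open>w \<times> shape w\<close> is a multiple of \<open>\<xi>\<close> and orthogonal to \<open>\<xi>\<close>.\<close>

lemma tropic_curve_principal:
  assumes sm: "smooth_on UNIV \<gamma>" and tr: "\<And>t. \<gamma> t \<in> tropic E0"
    and d: "\<And>t. (\<gamma> has_vector_derivative \<gamma>' t) (at t)" and nz: "\<And>t. \<gamma>' t \<noteq> 0"
  shows "principal_immersion E0 \<gamma>"
proof (rule principal_immersionI[OF sm _ _ d nz])
  interpret m: bounded_bilinear mink by (rule bounded_bilinear_mink)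
  interpret S: bounded_linear shape by (rule bounded_linear_shape)
  fix t
  have on: "\<gamma> t \<in> E0" and light: "mink (shape (\<gamma> t)) (shape (\<gamma> t)) = 0" for t
    using tr[of t] by (auto simp: tropic_iff)
  show "\<gamma> t \<in> E0" by (rule on)
  show "\<not> umbilic E0 (\<gamma> t)" using light[of t] umbilic_spacelike by fastforce
  have t1: "mink (shape (\<gamma> t)) (\<gamma>' t) = 0" by (rule velocity_tangent[OF on d])
  have "((\<lambda>t. mink (shape (\<gamma> t)) (shape (\<gamma> t))) has_vector_derivative
      mink (shape (\<gamma> t)) (shape (\<gamma>' t)) + mink (shape (\<gamma>' t)) (shape (\<gamma> t))) (at t)"
    by (intro m.has_vector_derivative S.has_vector_derivative d)
  moreover have "(\<lambda>t. mink (shape (\<gamma> t)) (shape (\<gamma> t))) = (\<lambda>t. 0)" using light by auto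
  ultimately have "mink (shape (\<gamma> t)) (shape (\<gamma>' t)) + mink (shape (\<gamma>' t)) (shape (\<gamma> t)) = 0"
    by (metis has_vector_derivative_const vector_derivative_unique_at)
  then have t2: "mink (shape (\<gamma> t)) (shape (\<gamma>' t)) = 0" by (simp add: mink_sym)
  have "mink (shape (\<gamma> t)) (mcross (\<gamma>' t) (shape (\<gamma>' t))) = 0"
  proof (cases "cross3 (\<gamma>' t) (shape (\<gamma>' t)) = 0")
    case True
    then have "mcross (\<gamma>' t) (shape (\<gamma>' t)) = 0"
      by (simp add: mcross_def cross3_def vec_eq_iff forall_3 vector_3)
    then show ?thesis by (simp add: m.zero_right)
  next
    case False
    then obtain \<mu> where "mcross (\<gamma>' t) (shape (\<gamma>' t)) = \<mu> *\<^sub>R shape (\<gamma> t)"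
      using mcross_parallel_shape[OF on t1 t2] by blast
    then show ?thesis using light[of t] by (simp add: m.scaleR_right)
  qed
  then show "principal_form (\<gamma> t) (\<gamma>' t) = 0" using axes_pos by (simp add: mink_shape_mcross_shape)
qed

text \<open>Eliminating \<open>z\<close> from the equations of the ellipsoid and of the tropic leaves the ellipse
  \<open>Q x\<^sup>2 / a\<^sup>4 + R y\<^sup>2 / b\<^sup>4 = 1\<close>, over which the component is a graph.\<close>

lemma tropic_component:
  assumes \<sigma>: "\<sigma> = 1 \<or> \<sigma> = -1"
  defines "C \<equiv> {p \<in> tropic E0. \<sigma> * p$3 > 0}"
  shows "regular_closed_curve C" and "principal_line E0 C"
proof -
  have nz: "a \<noteq> 0" "b \<noteq> 0" "c \<noteq> 0" "Q \<noteq> 0" "R \<noteq> 0" using axes_pos Q_pos R_pos by auto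
  \<comment> \<open>The semi-axes of the ellipse in the \<open>xy\<close>-plane over which the component lies.\<close>
  define A B where "A = a\<^sup>2 / sqrt Q" and "B = b\<^sup>2 / sqrt R"
  have AB: "A \<noteq> 0" "B \<noteq> 0" "A\<^sup>2 = a\<^sup>2 * a\<^sup>2 / Q" "B\<^sup>2 = b\<^sup>2 * b\<^sup>2 / R"
    using nz Q_pos R_pos by (simp_all add: A_def B_def power_divide power2_eq_square)
  \<comment> \<open>By the equation of the tropic, \<open>(z/c\<^sup>2)\<^sup>2\<close> equals this function on the ellipse.\<close>
  define m where "m t = (1 / Q) * (cos t * cos t) + (1 / R) * (sin t * sin t)" for t
  have m: "m t > 0" for t
  proof -
    have "cos t \<noteq> 0 \<or> sin t \<noteq> 0" using sin_zero_abs_cos_one[of t] by auto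
    then have "0 < cos t * cos t \<or> 0 < sin t * sin t" "0 \<le> cos t * cos t" "0 \<le> sin t * sin t"
      by (simp_all add: zero_less_mult_iff linorder_neq_iff) linarith
    then show ?thesis unfolding m_def using Q_pos R_pos
      by (auto intro: add_pos_nonneg add_nonneg_pos)
  qed
  define \<gamma> :: "real \<Rightarrow> real^3" where "\<gamma> t = vector [A * cos t, B * sin t, (\<sigma> * c\<^sup>2) * sqrt (m t)]" for t
  have sm_m: "smooth_on UNIV (\<lambda>t. sqrt (m t))"
    unfolding m_def
    by (intro smooth_on_sqrt smooth_on_add smooth_on_mult smooth_on_const smooth_on_cos smooth_on_sin open_UNIV)
       (use m in \<open>simp add: m_def\<close>)
  have sm: "smooth_on UNIV \<gamma>"
    unfolding \<gamma>_def[abs_def]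
    by (intro smooth_on_vector_3 smooth_on_mult smooth_on_const smooth_on_cos smooth_on_sin sm_m open_UNIV)
  obtain m' where m': "\<And>t. ((\<lambda>t. sqrt (m t)) has_real_derivative m' t) (at t)"
    using smooth_on_real_derivative[OF sm_m] by blast
  define \<gamma>' :: "real \<Rightarrow> real^3" where "\<gamma>' t = vector [- A * sin t, B * cos t, (\<sigma> * c\<^sup>2) * m' t]" for t
  have d: "(\<gamma> has_vector_derivative \<gamma>' t) (at t)" for t
    unfolding \<gamma>_def[abs_def] \<gamma>'_def
    by (intro has_vector_derivative_vector_3 cos_sin_derivatives DERIV_cmult m')
  have d0: "\<gamma>' t \<noteq> 0" for t
    using sin_zero_abs_cos_one[of t] AB by (auto simp: \<gamma>'_def vec_eq_iff forall_3 vector_3)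
  have s2: "\<sigma>\<^sup>2 = 1" "\<sigma> \<noteq> 0" "\<sigma> * \<sigma> = 1" using \<sigma> by auto
  have tropic_eq: "p \<in> tropic E0 \<longleftrightarrow> (p$1 / a)\<^sup>2 + (p$2 / b)\<^sup>2 + (p$3 / c)\<^sup>2 = 1 \<and>
      (p$1 / a\<^sup>2)\<^sup>2 + (p$2 / b\<^sup>2)\<^sup>2 = (p$3 / c\<^sup>2)\<^sup>2" for p
    by (simp add: tropic_iff mem_E0 mink_def shape_def vector_3 power2_eq_square)
  have on: "\<gamma> t \<in> C" for t
  proof -
    have "(A * cos t / a\<^sup>2)\<^sup>2 = (1 / Q) * (cos t * cos t)" "(B * sin t / b\<^sup>2)\<^sup>2 = (1 / R) * (sin t * sin t)"
      using nz by (simp_all add: power_divide power_mult_distrib AB) (simp_all add: power2_eq_square)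
    moreover have "((\<sigma> * c\<^sup>2) * sqrt (m t) / c\<^sup>2)\<^sup>2 = m t"
      using nz m[of t] s2 by (simp add: power_divide power_mult_distrib)
    ultimately have 2: "(A * cos t / a\<^sup>2)\<^sup>2 + (B * sin t / b\<^sup>2)\<^sup>2 = ((\<sigma> * c\<^sup>2) * sqrt (m t) / c\<^sup>2)\<^sup>2"
      by (simp add: m_def)
    have "(A * cos t / a)\<^sup>2 = a\<^sup>2 / Q * (cos t)\<^sup>2" "(B * sin t / b)\<^sup>2 = b\<^sup>2 / R * (sin t)\<^sup>2"
      using nz by (simp_all add: power_divide power_mult_distrib AB)
        (simp_all add: power2_eq_square power4_eq_xxxx mult_ac)
    moreover have "((\<sigma> * c\<^sup>2) * sqrt (m t) / c)\<^sup>2 = c\<^sup>2 / Q * (cos t)\<^sup>2 + c\<^sup>2 / R * (sin t)\<^sup>2"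
    proof -
      have "(\<sigma> * c\<^sup>2 * sqrt (m t) / c)\<^sup>2 = c\<^sup>2 * m t"
        using nz m[of t] s2 by (simp add: power_divide power_mult_distrib)
          (simp add: power2_eq_square power4_eq_xxxx mult_ac)
      also have "\<dots> = c\<^sup>2 / Q * (cos t)\<^sup>2 + c\<^sup>2 / R * (sin t)\<^sup>2"
        by (simp add: m_def power2_eq_square distrib_left)
      finally show ?thesis .
    qed
    moreover have "a\<^sup>2 / Q + c\<^sup>2 / Q = 1" "b\<^sup>2 / R + c\<^sup>2 / R = 1"
      using nz by (simp_all add: Q_def R_def add_divide_distrib[symmetric])
    then have "(a\<^sup>2 / Q + c\<^sup>2 / Q) * (cos t)\<^sup>2 + (b\<^sup>2 / R + c\<^sup>2 / R) * (sin t)\<^sup>2 = 1" by simp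
    ultimately have 1: "(A * cos t / a)\<^sup>2 + (B * sin t / b)\<^sup>2 + ((\<sigma> * c\<^sup>2) * sqrt (m t) / c)\<^sup>2 = 1"
      by (simp add: algebra_simps)
    have eq: "\<sigma> * (\<sigma> * c\<^sup>2 * sqrt (m t)) = c\<^sup>2 * sqrt (m t)" using s2(3) by (metis mult.assoc mult_1)
    have "\<sigma> * (\<sigma> * c\<^sup>2 * sqrt (m t)) > 0" unfolding eq using m[of t] c_pos by simp
    then show ?thesis using 1 2 by (simp add: C_def tropic_eq \<gamma>_def vector_3)
  qed
  have rng: "C = range \<gamma>"
  proof (intro equalityI subsetI)
    fix p assume "p \<in> C"
    then have p: "(p$1 / a)\<^sup>2 + (p$2 / b)\<^sup>2 + (p$3 / c)\<^sup>2 = 1"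
      "(p$1 / a\<^sup>2)\<^sup>2 + (p$2 / b\<^sup>2)\<^sup>2 = (p$3 / c\<^sup>2)\<^sup>2" "\<sigma> * p$3 > 0"
      by (auto simp: C_def tropic_eq)
    have "(p$1 / A)\<^sup>2 + (p$2 / B)\<^sup>2 = Q * (p$1 / a\<^sup>2)\<^sup>2 + R * (p$2 / b\<^sup>2)\<^sup>2"
      using nz by (simp add: power_divide AB; simp add: power2_eq_square power4_eq_xxxx mult_ac)
    also have "\<dots> = (p$1 / a)\<^sup>2 + (p$2 / b)\<^sup>2 + c\<^sup>2 * ((p$1 / a\<^sup>2)\<^sup>2 + (p$2 / b\<^sup>2)\<^sup>2)"
      using nz by (simp add: Q_def R_def distrib_left distrib_right power_divide;
          simp add: power2_eq_square power4_eq_xxxx mult_ac add_divide_distrib)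
    also have "\<dots> = 1" unfolding p(2) using p(1) nz by (simp add: power_divide; simp add: power2_eq_square power4_eq_xxxx mult_ac)
    finally obtain t where t: "p$1 / A = cos t" "p$2 / B = sin t" using sincos_total_2pi by metis
    then have t': "p$1 = A * cos t" "p$2 = B * sin t" using AB by (simp_all add: field_simps)
    have "(p$3 / c\<^sup>2)\<^sup>2 = m t"
      unfolding p(2)[symmetric] t' m_def using nz
      by (simp add: power_divide power_mult_distrib AB; simp add: power2_eq_square power4_eq_xxxx mult_ac)
    then have "(\<sigma> * p$3 / c\<^sup>2)\<^sup>2 = m t" using s2 by (simp add: power_divide power_mult_distrib)
    moreover have "\<sigma> * p$3 / c\<^sup>2 > 0" using p(3) nz by simp
    ultimately have "\<sigma> * p$3 / c\<^sup>2 = sqrt (m t)" by (metis less_imp_le real_sqrt_unique)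
    then have "\<sigma> * (\<sigma> * p$3) = \<sigma> * c\<^sup>2 * sqrt (m t)" using nz by (simp add: field_simps)
    then have "p$3 = \<sigma> * c\<^sup>2 * sqrt (m t)" using s2(3) by (metis mult.assoc mult_1)
    then have "p = \<gamma> t" using t' by (simp add: \<gamma>_def vec_eq_iff forall_3 vector_3)
    then show "p \<in> range \<gamma>" by blast
  qed (use on in auto)
  have "\<gamma> t \<in> tropic E0" for t using on[of t] by (simp add: C_def)
  then have "principal_immersion E0 \<gamma>" by (rule tropic_curve_principal[OF sm _ d d0])
  then show "principal_line E0 C" unfolding principal_line_def rng by blast
  have inj: "inj_on \<gamma> {0..<2 * pi}"
  proof (rule inj_onI)
    fix x y assume xy: "x \<in> {0..<2 * pi}" "y \<in> {0..<2 * pi}" "\<gamma> x = \<gamma> y"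
    then have "sin y = sin x \<and> cos y = cos x"
      using AB by (simp add: \<gamma>_def vec_eq_iff forall_3 vector_3)
    then obtain n :: int where n: "y = x + 2 * pi * n" by (auto simp: sin_cos_eq_iff)
    have "2 * pi * n < 2 * pi" "- (2 * pi) < 2 * pi * n"
      using xy(1,2) n unfolding atLeastLessThan_iff by linarith+
    then have "2 * pi * (n - 1) < 0" "0 < 2 * pi * (n + 1)" by (simp_all add: algebra_simps)
    then have "n - 1 < 0" "0 < n + 1"
      using pi_gt_zero by (simp_all add: mult_less_0_iff zero_less_mult_iff)
    then have "n = 0" by linarith
    then show "x = y" using n by simp
  qed
  have "\<gamma> (t + 2 * pi) = \<gamma> t" for t by (simp add: \<gamma>_def m_def)
  moreover have "vector_derivative \<gamma> (at t) \<noteq> 0" for t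
    using d0[of t] vector_derivative_at[OF d[of t]] by simp
  ultimately show "regular_closed_curve C"
    unfolding regular_closed_curve_def rng using sm inj by (intro exI[of _ \<gamma>] exI[of _ "2 * pi"]) auto
qed

lemma tropic_decomposition:
  "\<exists>T1 T2. tropic E0 = T1 \<union> T2 \<and> T1 \<inter> T2 = {} \<and>
     regular_closed_curve T1 \<and> regular_closed_curve T2 \<and> principal_line E0 T1 \<and> principal_line E0 T2"
proof (intro exI conjI)
  let ?T = "\<lambda>\<sigma>. {p \<in> tropic E0. \<sigma> * p$3 > 0}"
  show "regular_closed_curve (?T 1)" "regular_closed_curve (?T (-1))"
    "principal_line E0 (?T 1)" "principal_line E0 (?T (-1))"
    by (rule tropic_component; simp)+
  show "?T 1 \<inter> ?T (-1) = {}" by auto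
  have "p$3 \<noteq> 0" if "p \<in> tropic E0" for p
  proof
    assume z: "p$3 = 0"
    have "p \<in> E0" "mink (shape p) (shape p) = 0" using that by (auto simp: tropic_iff)
    then have "(p$1 / a)\<^sup>2 + (p$2 / b)\<^sup>2 = 1" "(p$1 / a\<^sup>2)\<^sup>2 + (p$2 / b\<^sup>2)\<^sup>2 = 0"
      using z by (simp_all add: mem_E0 mink_def shape_def vector_3 power2_eq_square)
    then show False using axes_pos by (simp add: sum_power2_eq_zero_iff)
  qed
  then show "tropic E0 = ?T 1 \<union> ?T (-1)" by force
qed

section \<open>The arcs of the section y = 0\<close>

text \<open>On the section \<open>y = 0\<close> the umbilic points are the zeros of this function; its sign tells the arcs around the
  \<open>x\<close>-axis from those around the \<open>z\<close>-axis.\<close>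

definition umbilic_gap :: "real^3 \<Rightarrow> real" where
  "umbilic_gap p = R * (p$1 / a)\<^sup>2 - P * (p$3 / c)\<^sup>2"

definition x_arc :: "real \<Rightarrow> (real^3) set" where
  "x_arc \<sigma> = {p \<in> E0. p$2 = 0 \<and> umbilic_gap p > 0 \<and> \<sigma> * p$1 > 0}"

definition z_arc :: "real \<Rightarrow> (real^3) set" where
  "z_arc \<sigma> = {p \<in> E0. p$2 = 0 \<and> umbilic_gap p < 0 \<and> \<sigma> * p$3 > 0}"

definition arcs :: "(real^3) set set" where
  "arcs = {x_arc 1, x_arc (-1), z_arc 1, z_arc (-1)}"

lemma umbilic_gap_cy:
  assumes "p \<in> E0" "p$2 = 0"
  shows "umbilic_gap p = R - Q * (p$3 / c)\<^sup>2" and "umbilic_gap p = Q * (p$1 / a)\<^sup>2 - P"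
proof -
  have "(p$1 / a)\<^sup>2 + (p$3 / c)\<^sup>2 = 1" using assms by (simp add: mem_E0)
  then show "umbilic_gap p = R - Q * (p$3 / c)\<^sup>2" "umbilic_gap p = Q * (p$1 / a)\<^sup>2 - P"
    unfolding umbilic_gap_def Q_eq by algebra+
qed

lemma umbilic_iff_gap: "umbilic E0 p \<longleftrightarrow> p \<in> E0 \<and> p$2 = 0 \<and> umbilic_gap p = 0"
  by (auto simp: umbilic_iff umbilic_gap_def)

lemma gap_coordinates_nonzero:
  shows "umbilic_gap p > 0 \<Longrightarrow> p$1 \<noteq> 0" and "umbilic_gap p < 0 \<Longrightarrow> p$3 \<noteq> 0"
proof -
  have "P * (p$3 / c)\<^sup>2 \<ge> 0" "R * (p$1 / a)\<^sup>2 \<ge> 0" using P_pos R_pos by simp_all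
  then show "umbilic_gap p > 0 \<Longrightarrow> p$1 \<noteq> 0" "umbilic_gap p < 0 \<Longrightarrow> p$3 \<noteq> 0"
    by (auto simp: umbilic_gap_def)
qed

lemma Union_arcs: "\<Union>arcs = {p. p$2 = 0} \<inter> E0 - {p. umbilic E0 p}"
proof (intro equalityI subsetI)
  fix p assume p: "p \<in> {p. p$2 = 0} \<inter> E0 - {p. umbilic E0 p}"
  then have "umbilic_gap p > 0 \<or> umbilic_gap p < 0" by (auto simp: umbilic_iff_gap)
  then show "p \<in> \<Union>arcs"
    using gap_coordinates_nonzero[of p] p by (auto simp: arcs_def x_arc_def z_arc_def)
qed (auto simp: arcs_def x_arc_def z_arc_def umbilic_iff_gap)

lemma arcs_disjoint: "A \<in> arcs \<Longrightarrow> B \<in> arcs \<Longrightarrow> p \<in> A \<Longrightarrow> p \<in> B \<Longrightarrow> A = B"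
  by (auto simp: arcs_def x_arc_def z_arc_def)

text \<open>The signs that distinguish the arcs are constant along the curve, since \<open>umbilic_gap\<close> has no zero on it and, given its
  sign, neither has the relevant coordinate.\<close>

lemma immersion_in_cy_within_arc:
  assumes im: "principal_immersion E0 \<gamma>" and y: "\<And>t. \<gamma> t $ 2 = 0"
  obtains A where "A \<in> arcs" "range \<gamma> \<subseteq> A"
proof -
  have sm: "smooth_on UNIV \<gamma>" and on: "\<And>t. \<gamma> t \<in> E0" and nu: "\<And>t. \<not> umbilic E0 (\<gamma> t)"
    using im by (auto simp: principal_immersion_def)
  have cg: "continuous_on UNIV \<gamma>" using sm unfolding smooth_on_def by (metis ck_on.simps(1))
  have gap: "umbilic_gap (\<gamma> t) \<noteq> 0" for t using on nu y by (auto simp: umbilic_iff_gap)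
  have cgap: "continuous_on UNIV (\<lambda>t. umbilic_gap (\<gamma> t))" "continuous_on UNIV (\<lambda>t. \<sigma> * \<gamma> t $ i)" for \<sigma> i
    unfolding umbilic_gap_def divide_inverse by (intro continuous_intros cg)+
  have "\<gamma> 0 \<in> \<Union>arcs" using on y nu by (auto simp: Union_arcs)
  then obtain A where A: "A \<in> arcs" "\<gamma> 0 \<in> A" by blast
  then consider \<sigma> where "\<sigma> = 1 \<or> \<sigma> = -1" "A = x_arc \<sigma>" | \<sigma> where "\<sigma> = 1 \<or> \<sigma> = -1" "A = z_arc \<sigma>"
    by (auto simp: arcs_def)
  then have "range \<gamma> \<subseteq> A"
  proof cases
    case 1
    have pos: "umbilic_gap (\<gamma> t) > 0" for t
      by (rule nonvanishing_same_sign[OF cgap(1) gap, of 0]) (use A(2) 1 in \<open>simp add: x_arc_def\<close>)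
    have "\<sigma> * \<gamma> t $ 1 > 0" for t
      by (rule nonvanishing_same_sign[OF cgap(2), of \<sigma> 1 0])
         (use gap_coordinates_nonzero(1)[OF pos] A(2) 1 in \<open>auto simp: x_arc_def\<close>)
    with pos on y 1 show ?thesis by (auto simp: x_arc_def)
  next
    case 2
    have "- umbilic_gap (\<gamma> t) > 0" for t
      by (rule nonvanishing_same_sign[OF continuous_on_minus[OF cgap(1)], of 0])
         (use gap A(2) 2 in \<open>simp_all add: z_arc_def\<close>)
    then have neg: "umbilic_gap (\<gamma> t) < 0" for t by simp
    have "\<sigma> * \<gamma> t $ 3 > 0" for t
      by (rule nonvanishing_same_sign[OF cgap(2), of \<sigma> 3 0])
         (use gap_coordinates_nonzero(2)[OF neg] A(2) 2 in \<open>auto simp: z_arc_def\<close>)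
    with neg on y 2 show ?thesis by (auto simp: z_arc_def)
  qed
  with A(1) that show ?thesis by blast
qed

lemma arc_immersion:
  assumes sm: "smooth_on UNIV f" "smooth_on UNIV g"
    and d: "\<And>t. (f has_real_derivative f' t) (at t)" "\<And>t. (g has_real_derivative g' t) (at t)"
    and nz: "\<And>t. f' t \<noteq> 0 \<or> g' t \<noteq> 0"
    and on: "\<And>t. vector [f t, 0, g t] \<in> \<Union>arcs"
  shows "principal_immersion E0 (\<lambda>t. vector [f t, 0, g t])"
proof (rule principal_immersionI)
  show "smooth_on UNIV (\<lambda>t. vector [f t, 0, g t] :: real^3)"
    by (intro smooth_on_vector_3 sm smooth_on_const open_UNIV)
  show "((\<lambda>t. vector [f t, 0, g t] :: real^3) has_vector_derivative vector [f' t, 0, g' t]) (at t)" for t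
    by (intro has_vector_derivative_vector_3 d DERIV_const)
  show "(vector [f' t, 0, g' t] :: real^3) \<noteq> 0" for t
    using nz[of t] by (auto simp: vec_eq_iff forall_3 vector_3)
qed (use on in \<open>auto simp: Union_arcs principal_form_def vector_3\<close>)

text \<open>Any tangent vector \<open>(w\<^sub>1, 0, w\<^sub>3)\<close> at a point with \<open>y = 0\<close> is principal. The arc around the \<open>x\<close>-axis is parametrized by
  \<open>z/c\<close>, which runs through \<open>|z/c| < sqrt(R/Q)\<close>, the arc around the \<open>z\<close>-axis by \<open>x/a\<close> with
  \<open>|x/a| < sqrt(P/Q)\<close>.\<close>

lemma arc_parametrization:
  assumes "A \<in> arcs"
  obtains \<gamma> p where "principal_immersion E0 \<gamma>" "A = range \<gamma>" "umbilic E0 p" "(\<gamma> \<longlongrightarrow> p) at_top"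
proof -
  have nz: "a \<noteq> 0" "b \<noteq> 0" "c \<noteq> 0" "Q \<noteq> 0" using axes_pos Q_pos by auto
  have ratio: "0 < P / Q" "P / Q < 1" "0 < R / Q" "R / Q < 1" "1 - P / Q = R / Q" "1 - R / Q = P / Q"
    using P_pos Q_pos R_pos by (auto simp: Q_eq field_simps)
  from assms consider \<sigma> where "\<sigma> \<in> {-1, 1}" "A = x_arc \<sigma>" | \<sigma> where "\<sigma> \<in> {-1, 1}" "A = z_arc \<sigma>"
    by (auto simp: arcs_def)
  then show ?thesis
  proof cases
    case 1
    have \<sigma>: "\<sigma>\<^sup>2 = 1" "\<sigma> * \<sigma> = 1" using 1 by auto
    define r where "r = sqrt (R / Q)"
    have r: "0 < r" "r < 1" "r\<^sup>2 = R / Q" using ratio by (simp_all add: r_def)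
    obtain s w s' w' where sw: "smooth_on UNIV s" "smooth_on UNIV w"
      "\<And>t. (s has_real_derivative s' t) (at t)" "\<And>t. (w has_real_derivative w' t) (at t)"
      "\<And>t. s' t \<noteq> 0" "\<And>t. (s t)\<^sup>2 + (w t)\<^sup>2 = 1" "\<And>t. w t > 0"
      "range s = {-r<..<r}" "(s \<longlongrightarrow> r) at_top" "(w \<longlongrightarrow> sqrt (1 - r\<^sup>2)) at_top"
      using arc_functions[OF r(1,2)] by metis
    define \<gamma> :: "real \<Rightarrow> real^3" where "\<gamma> t = vector [(\<sigma> * a) * w t, 0, c * s t]" for t
    have mem: "\<gamma> t \<in> E0" "\<gamma> t $ 2 = 0" "\<gamma> t $ 3 = c * s t" "\<gamma> t $ 1 = \<sigma> * a * w t" for t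
      using sw(6)[of t] nz \<sigma> by (simp_all add: \<gamma>_def mem_E0 vector_3 power_mult_distrib add.commute)
    have on: "\<gamma> t \<in> A" for t
    proof -
      have "s t \<in> {-r<..<r}" using sw(8) by blast
      then have "(s t)\<^sup>2 < R / Q" using r(1) r(3) abs_le_square_iff[of r "s t"] by auto
      then have "Q * (s t)\<^sup>2 < R" using Q_pos by (simp add: field_simps)
      then have "umbilic_gap (\<gamma> t) > 0"
        using nz by (simp add: umbilic_gap_cy(1)[OF mem(1,2)] mem(3))
      moreover have "\<sigma> * (\<sigma> * a * w t) > 0"
        using \<sigma>(2) a_pos sw(7)[of t] by (metis mult.assoc mult_1 mult_pos_pos)
      ultimately show ?thesis using mem[of t] by (simp add: 1 x_arc_def)
    qed
    have im: "principal_immersion E0 \<gamma>"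
      unfolding \<gamma>_def[abs_def]
    proof (rule arc_immersion)
      show "smooth_on UNIV (\<lambda>t. \<sigma> * a * w t)" "smooth_on UNIV (\<lambda>t. c * s t)"
        by (intro smooth_on_mult smooth_on_const sw open_UNIV)+
      show "((\<lambda>t. \<sigma> * a * w t) has_real_derivative \<sigma> * a * w' t) (at t)"
        "((\<lambda>t. c * s t) has_real_derivative c * s' t) (at t)" for t
        by (intro DERIV_cmult sw)+
      show "\<sigma> * a * w' t \<noteq> 0 \<or> c * s' t \<noteq> 0" for t using sw(5) nz by simp
      show "vector [\<sigma> * a * w t, 0, c * s t] \<in> \<Union>arcs" for t
        using on[of t] assms by (auto simp: \<gamma>_def)
    qed
    have rng: "A = range \<gamma>"
    proof (intro equalityI subsetI)
      fix p assume "p \<in> A"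
      then have p: "p \<in> E0" "p$2 = 0" "umbilic_gap p > 0" "\<sigma> * p$1 > 0" by (auto simp: 1 x_arc_def)
      have "(p$3 / c)\<^sup>2 < R / Q" using p(3) Q_pos by (simp add: umbilic_gap_cy(1)[OF p(1,2)] field_simps)
      then have "\<bar>p$3 / c\<bar> < r" using r abs_le_square_iff[of r "p$3 / c"] by auto
      then have "p$3 / c \<in> {-r<..<r}" unfolding abs_less_iff greaterThanLessThan_iff by linarith
      then obtain t where t: "p$3 / c = s t" using sw(8) by (metis imageE)
      then have t3: "p$3 = c * s t" using nz by (simp add: field_simps)
      have "(\<sigma> * (p$1 / a))\<^sup>2 = (w t)\<^sup>2"
        unfolding power_mult_distrib \<sigma>(1) using p(1,2) sw(6)[of t] t by (simp add: mem_E0)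
      moreover have "\<sigma> * (p$1 / a) > 0" using p(4) a_pos by (simp add: zero_less_mult_iff zero_less_divide_iff)
      ultimately have "\<sigma> * (p$1 / a) = w t" using sw(7)[of t] by (simp add: power2_eq_iff)
      then have "\<sigma> * p$1 = a * w t" using nz by (simp add: field_simps)
      then have "p$1 = \<sigma> * a * w t" using \<sigma>(2) by (metis mult.assoc mult_1)
      then have "p = \<gamma> t" using t3 p(2) by (simp add: \<gamma>_def vec_eq_iff forall_3 vector_3)
      then show "p \<in> range \<gamma>" by blast
    qed (use on in auto)
    define p0 :: "real^3" where "p0 = vector [\<sigma> * a * sqrt (P / Q), 0, c * sqrt (R / Q)]"
    have "(\<gamma> \<longlongrightarrow> p0) at_top"
      unfolding \<gamma>_def[abs_def] p0_def using sw(9,10) r(3) ratio(6)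
      by (intro tendsto_vector_3 tendsto_intros) (simp_all add: r_def)
    moreover have "umbilic E0 p0"
    proof -
      have "p0 = vector [\<sigma> * (a * sqrt (P / Q)), 0, 1 * (c * sqrt (R / Q))]" by (simp add: p0_def mult.assoc)
      then have "p0 \<in> {p. umbilic E0 p}" unfolding umbilics_eq using 1(1) by blast
      then show ?thesis by simp
    qed
    ultimately show ?thesis using that im rng by blast
  next
    case 2
    have \<sigma>: "\<sigma>\<^sup>2 = 1" "\<sigma> * \<sigma> = 1" using 2 by auto
    define r where "r = sqrt (P / Q)"
    have r: "0 < r" "r < 1" "r\<^sup>2 = P / Q" using ratio by (simp_all add: r_def)
    obtain s w s' w' where sw: "smooth_on UNIV s" "smooth_on UNIV w"
      "\<And>t. (s has_real_derivative s' t) (at t)" "\<And>t. (w has_real_derivative w' t) (at t)"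
      "\<And>t. s' t \<noteq> 0" "\<And>t. (s t)\<^sup>2 + (w t)\<^sup>2 = 1" "\<And>t. w t > 0"
      "range s = {-r<..<r}" "(s \<longlongrightarrow> r) at_top" "(w \<longlongrightarrow> sqrt (1 - r\<^sup>2)) at_top"
      using arc_functions[OF r(1,2)] by metis
    define \<gamma> :: "real \<Rightarrow> real^3" where "\<gamma> t = vector [a * s t, 0, (\<sigma> * c) * w t]" for t
    have mem: "\<gamma> t \<in> E0" "\<gamma> t $ 2 = 0" "\<gamma> t $ 1 = a * s t" "\<gamma> t $ 3 = \<sigma> * c * w t" for t
      using sw(6)[of t] nz \<sigma> by (simp_all add: \<gamma>_def mem_E0 vector_3 power_mult_distrib)
    have on: "\<gamma> t \<in> A" for t
    proof -
      have "s t \<in> {-r<..<r}" using sw(8) by blast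
      then have "(s t)\<^sup>2 < P / Q" using r(1) r(3) abs_le_square_iff[of r "s t"] by auto
      then have "Q * (s t)\<^sup>2 < P" using Q_pos by (simp add: field_simps)
      then have "umbilic_gap (\<gamma> t) < 0"
        using nz by (simp add: umbilic_gap_cy(2)[OF mem(1,2)] mem(3))
      moreover have "\<sigma> * (\<sigma> * c * w t) > 0"
        using \<sigma>(2) c_pos sw(7)[of t] by (metis mult.assoc mult_1 mult_pos_pos)
      ultimately show ?thesis using mem[of t] by (simp add: 2 z_arc_def)
    qed
    have im: "principal_immersion E0 \<gamma>"
      unfolding \<gamma>_def[abs_def]
    proof (rule arc_immersion)
      show "smooth_on UNIV (\<lambda>t. a * s t)" "smooth_on UNIV (\<lambda>t. \<sigma> * c * w t)"
        by (intro smooth_on_mult smooth_on_const sw open_UNIV)+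
      show "((\<lambda>t. a * s t) has_real_derivative a * s' t) (at t)"
        "((\<lambda>t. \<sigma> * c * w t) has_real_derivative \<sigma> * c * w' t) (at t)" for t
        by (intro DERIV_cmult sw)+
      show "a * s' t \<noteq> 0 \<or> \<sigma> * c * w' t \<noteq> 0" for t using sw(5) nz by simp
      show "vector [a * s t, 0, \<sigma> * c * w t] \<in> \<Union>arcs" for t
        using on[of t] assms by (auto simp: \<gamma>_def)
    qed
    have rng: "A = range \<gamma>"
    proof (intro equalityI subsetI)
      fix p assume "p \<in> A"
      then have p: "p \<in> E0" "p$2 = 0" "umbilic_gap p < 0" "\<sigma> * p$3 > 0" by (auto simp: 2 z_arc_def)
      have "(p$1 / a)\<^sup>2 < P / Q" using p(3) Q_pos by (simp add: umbilic_gap_cy(2)[OF p(1,2)] field_simps)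
      then have "\<bar>p$1 / a\<bar> < r" using r abs_le_square_iff[of r "p$1 / a"] by auto
      then have "p$1 / a \<in> {-r<..<r}" unfolding abs_less_iff greaterThanLessThan_iff by linarith
      then obtain t where t: "p$1 / a = s t" using sw(8) by (metis imageE)
      then have t1: "p$1 = a * s t" using nz by (simp add: field_simps)
      have "(\<sigma> * (p$3 / c))\<^sup>2 = (w t)\<^sup>2"
        unfolding power_mult_distrib \<sigma>(1) using p(1,2) sw(6)[of t] t by (simp add: mem_E0)
      moreover have "\<sigma> * (p$3 / c) > 0" using p(4) c_pos by (simp add: zero_less_mult_iff zero_less_divide_iff)
      ultimately have "\<sigma> * (p$3 / c) = w t" using sw(7)[of t] by (simp add: power2_eq_iff)
      then have "\<sigma> * p$3 = c * w t" using nz by (simp add: field_simps)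
      then have "p$3 = \<sigma> * c * w t" using \<sigma>(2) by (metis mult.assoc mult_1)
      then have "p = \<gamma> t" using t1 p(2) by (simp add: \<gamma>_def vec_eq_iff forall_3 vector_3)
      then show "p \<in> range \<gamma>" by blast
    qed (use on in auto)
    define p0 :: "real^3" where "p0 = vector [a * sqrt (P / Q), 0, \<sigma> * c * sqrt (R / Q)]"
    have "(\<gamma> \<longlongrightarrow> p0) at_top"
      unfolding \<gamma>_def[abs_def] p0_def using sw(9,10) r(3) ratio(5)
      by (intro tendsto_vector_3 tendsto_intros) (simp_all add: r_def)
    moreover have "umbilic E0 p0"
    proof -
      have "p0 = vector [1 * (a * sqrt (P / Q)), 0, \<sigma> * (c * sqrt (R / Q))]" by (simp add: p0_def mult.assoc)
      then have "p0 \<in> {p. umbilic E0 p}" unfolding umbilics_eq using 2(1) by blast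
      then show ?thesis by simp
    qed
    ultimately show ?thesis using that im rng by blast
  qed
qed

section \<open>Separatrices\<close>

lemma principal_line_uncountable:
  assumes "principal_line E0 C" shows "uncountable C"
proof -
  obtain \<gamma> where im: "principal_immersion E0 \<gamma>" and C: "C = range \<gamma>"
    using assms unfolding principal_line_def by blast
  have sm: "smooth_on UNIV \<gamma>" using im by (simp add: principal_immersion_def)
  then have "continuous_on UNIV \<gamma>" unfolding smooth_on_def by (metis ck_on.simps(1))
  then have "connected C" unfolding C by (intro connected_continuous_image) auto
  moreover have "\<exists>t. \<gamma> t \<noteq> \<gamma> 0"
  proof (rule ccontr)
    assume "\<not> (\<exists>t. \<gamma> t \<noteq> \<gamma> 0)"
    then have "\<gamma> = (\<lambda>_. \<gamma> 0)" by auto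
    then have "(\<gamma> has_vector_derivative 0) (at 0)" by (metis has_vector_derivative_const)
    then have "vector_derivative \<gamma> (at 0) = 0" by (rule vector_derivative_at)
    then show False using im by (auto simp: principal_immersion_def)
  qed
  ultimately show ?thesis using connected_uncountable C by blast
qed

lemma immersion_tangent_to_cy:
  assumes im: "principal_immersion E0 \<gamma>" and unc: "uncountable (range \<gamma> \<inter> {p. p$2 = 0})"
  shows "\<gamma> t $ 2 = 0"
proof -
  have sm: "smooth_on UNIV \<gamma>" using im by (simp add: principal_immersion_def)
  have d: "((\<lambda>t. \<gamma> t $ 2) has_real_derivative vector_derivative \<gamma> (at t) $ 2) (at t)" for t
    unfolding has_real_derivative_iff_has_vector_derivative
    by (rule bounded_linear.has_vector_derivative[OF bounded_linear_vec_nth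
          smooth_on_UNIV_vector_derivative(1)[OF sm]])
  have "range \<gamma> \<inter> {p. p$2 = 0} = \<gamma> ` {t. \<gamma> t $ 2 = 0}" by auto
  then have "uncountable {t. \<gamma> t $ 2 = 0}" using unc by (metis countable_image)
  then obtain t0 where "\<gamma> t0 $ 2 = 0" "vector_derivative \<gamma> (at t0) $ 2 = 0"
    using countable_simple_zeros[OF d] by blast
  then show ?thesis by (rule cy_invariant[OF im])
qed

lemma arc_principal_line: "A \<in> arcs \<Longrightarrow> principal_line E0 A"
  using arc_parametrization unfolding principal_line_def by metis

text \<open>A principal line containing the arc meets the plane \<open>y = 0\<close> in uncountably many points, hence lies in it, and by
  connectedness it stays within one arc.\<close>

lemma arc_maximal:
  assumes A: "A \<in> arcs" shows "maximal_principal_line E0 A"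
  unfolding maximal_principal_line_def
proof (intro conjI allI impI)
  show "principal_line E0 A" using A by (rule arc_principal_line)
  fix C assume C: "principal_line E0 C \<and> A \<subseteq> C"
  then obtain \<gamma> where im: "principal_immersion E0 \<gamma>" and rng: "C = range \<gamma>"
    unfolding principal_line_def by blast
  have "A \<subseteq> range \<gamma> \<inter> {p. p$2 = 0}"
    using A C rng Union_arcs by blast
  then have "uncountable (range \<gamma> \<inter> {p. p$2 = 0})"
    using principal_line_uncountable[OF arc_principal_line[OF A]] countable_subset by blast
  then obtain B where B: "B \<in> arcs" "C \<subseteq> B"
    using immersion_in_cy_within_arc[OF im immersion_tangent_to_cy[OF im]] rng by blast
  have "A \<noteq> {}" using principal_line_uncountable[OF arc_principal_line[OF A]] by auto
  then have "A = B" using arcs_disjoint[OF A B(1)] B(2) C by blast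
  then show "C = A" using B(2) C by blast
qed

text \<open>In the chart such a curve has \<open>v = 0\<close>, so its lift has slope \<open>p = 0\<close>, which is the slope of the saddle.\<close>

lemma lift_of_cy_curve_tends_to_saddle:
  assumes im: "principal_immersion E0 \<gamma>" and y: "\<And>t. \<gamma> t $ 2 = 0"
    and um: "umbilic E0 p" and lim: "(\<gamma> \<longlongrightarrow> p) at_top"
  shows "lift_tends_to_saddle unit_disc (zchart (sgn (p$3))) (p$1 / a) 0 \<gamma>"
proof -
  define \<tau> where "\<tau> = sgn (p$3)"
  let ?X = "zchart \<tau>"
  have sm: "smooth_on UNIV \<gamma>" and on: "\<And>t. \<gamma> t \<in> E0"
    and nz: "\<And>t. vector_derivative \<gamma> (at t) \<noteq> 0"
    using im by (auto simp: principal_immersion_def)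
  define u where "u t = \<gamma> t $ 1 / a" for t
  define u' where "u' t = vector_derivative \<gamma> (at t) $ 1 / a" for t
  note D = smooth_on_UNIV_vector_derivative(1)[OF sm]
  have du: "(u has_vector_derivative u' t) (at t)" for t
    unfolding u_def[abs_def] u'_def divide_inverse
    by (intro has_vector_derivative_mult_left bounded_linear.has_vector_derivative[OF bounded_linear_vec_nth D])
  have "((\<lambda>t. \<gamma> t $ 3) \<longlongrightarrow> p$3) at_top" by (intro tendsto_intros lim)
  then have "((\<lambda>t. \<tau> * \<gamma> t $ 3) \<longlongrightarrow> \<tau> * p$3) at_top" by (rule tendsto_mult_left)
  moreover have "\<tau> * p$3 > 0" using umbilic_coordinates(5)[OF um] by (auto simp: \<tau>_def sgn_if)
  ultimately have ev: "\<forall>\<^sub>F t in at_top. \<tau> * \<gamma> t $ 3 > 0" by (rule order_tendstoD(1))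
  have \<tau>: "\<tau> = 1 \<or> \<tau> = -1" using umbilic_coordinates(5)[OF um] by (auto simp: \<tau>_def sgn_if)
  have chart: "(u t, 0) \<in> unit_disc" "\<gamma> t = ?X (u t, 0)" if "\<tau> * \<gamma> t $ 3 > 0" for t
  proof -
    have "\<gamma> t $ 3 \<noteq> 0" "sgn (\<gamma> t $ 3) = \<tau>" using that \<tau> by (auto simp: sgn_if)
    then have "local_param_at E0 unit_disc ?X (u t, 0) (\<gamma> t)"
      using zchart_mem[OF on, of t] y[of t] by (simp add: u_def)
    then show "(u t, 0) \<in> unit_disc" "\<gamma> t = ?X (u t, 0)" by (simp_all add: local_param_at_def)
  qed
  have cg: "continuous_on UNIV \<gamma>" using sm unfolding smooth_on_def by (metis ck_on.simps(1))
  have opn: "open {t. \<tau> * \<gamma> t $ 3 > 0}"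
    by (intro open_Collect_less continuous_intros cg)
  have vel: "vector_derivative \<gamma> (at t) = u' t *\<^sub>R du ?X (u t, 0) + 0 *\<^sub>R dv ?X (u t, 0)"
    if t: "\<tau> * \<gamma> t $ 3 > 0" for t
  proof -
    have "(?X has_derivative (\<lambda>w. fst w *\<^sub>R du ?X (u t, 0) + snd w *\<^sub>R dv ?X (u t, 0))) (at (u t, 0))"
      by (rule smooth_has_derivative[OF open_unit_disc _ chart(1)[OF t]])
         (simp add: zchart_def smooth_on_graph_chart)
    moreover have "((\<lambda>t. (u t, 0::real)) has_derivative (\<lambda>h. (h *\<^sub>R u' t, 0))) (at t)"
      using du[of t] unfolding has_vector_derivative_def by (intro has_derivative_Pair has_derivative_const)
    ultimately have "((\<lambda>t. ?X (u t, 0)) has_derivative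
        (\<lambda>h. fst (h *\<^sub>R u' t, 0::real) *\<^sub>R du ?X (u t, 0) + snd (h *\<^sub>R u' t, 0::real) *\<^sub>R dv ?X (u t, 0))) (at t)"
      using has_derivative_compose[of "\<lambda>t. (u t, 0::real)"] by blast
    then have "((\<lambda>t. ?X (u t, 0)) has_vector_derivative u' t *\<^sub>R du ?X (u t, 0)) (at t)"
      by (simp add: has_vector_derivative_def)
    then have "(\<gamma> has_vector_derivative u' t *\<^sub>R du ?X (u t, 0)) (at t)"
      by (rule has_vector_derivative_transform_within_open[OF _ opn]) (use t chart(2) in auto)
    then show ?thesis by (simp add: vector_derivative_at)
  qed
  have limu: "(u \<longlongrightarrow> p$1 / a) at_top"
    unfolding u_def[abs_def] divide_inverse by (intro tendsto_intros lim)
  show ?thesis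
    unfolding lift_tends_to_saddle_def \<tau>_def[symmetric]
  proof (rule exI[of _ u], rule exI[of _ "\<lambda>_. 0"], rule exI[of _ u'], rule exI[of _ "\<lambda>_. 0"],
      intro conjI disjI1 exI[of _ 0])
    show "\<forall>\<^sub>F t in at_top. (u t, 0) \<in> unit_disc \<and> \<gamma> t = ?X (u t, 0) \<and>
        vector_derivative \<gamma> (at t) = u' t *\<^sub>R du ?X (u t, 0) + 0 *\<^sub>R dv ?X (u t, 0)"
      by (rule eventually_mono[OF ev]) (use chart vel in blast)
    show "unique_saddle_slope ?X (p$1 / a) 0 0" unfolding \<tau>_def by (rule umbilic_D1(2)[OF um])
    show "\<forall>\<^sub>F t in at_top. u' t \<noteq> 0"
    proof (rule eventually_mono[OF ev])
      fix t assume "\<tau> * \<gamma> t $ 3 > 0"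
      from vel[OF this] nz[of t] show "u' t \<noteq> 0" by auto
    qed
    show "((\<lambda>t. (u t, 0, 0 / u' t)) \<longlongrightarrow> (p$1 / a, 0, 0)) at_top"
      by (simp, intro tendsto_intros limu)
  qed
qed

lemma arc_saddle_separatrix:
  assumes "A \<in> arcs"
  shows "\<exists>p. umbilic E0 p \<and> saddle_separatrix E0 p A"
proof -
  obtain \<gamma> p where g: "principal_immersion E0 \<gamma>" "A = range \<gamma>" "umbilic E0 p" "(\<gamma> \<longlongrightarrow> p) at_top"
    using arc_parametrization[OF assms] .
  have y: "\<gamma> t $ 2 = 0" for t using g(2) assms Union_arcs by blast
  have "lift_tends_to_saddle unit_disc (zchart (sgn (p$3))) (p$1 / a) 0 \<gamma>"
    by (rule lift_of_cy_curve_tends_to_saddle[OF g(1) y g(3,4)])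
  then show ?thesis
    unfolding saddle_separatrix_def using arc_maximal[OF assms] umbilic_D1(1)[OF g(3)] g by blast
qed

text \<open>Forgetting the slope, convergence of the lift gives convergence of the curve.\<close>

lemma saddle_separatrix_imp_separatrix:
  assumes "saddle_separatrix E0 p C" shows "separatrix E0 p C"
proof -
  obtain U X u0 v0 \<gamma> where X: "maximal_principal_line E0 C" "D1_in E0 U X u0 v0 p"
    "principal_immersion E0 \<gamma>" "C = range \<gamma>" "lift_tends_to_saddle U X u0 v0 \<gamma>"
    using assms unfolding saddle_separatrix_def by blast
  obtain u v where uv: "\<forall>\<^sub>F t in at_top. \<gamma> t = X (u t, v t)" "((\<lambda>t. (u t, v t)) \<longlongrightarrow> (u0, v0)) at_top"
  proof -
    obtain u v and aa bb :: "real \<Rightarrow> real" where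
      1: "\<forall>\<^sub>F t in at_top. (u t, v t) \<in> U \<and> \<gamma> t = X (u t, v t) \<and>
           vector_derivative \<gamma> (at t) = aa t *\<^sub>R du X (u t, v t) + bb t *\<^sub>R dv X (u t, v t)"
      and 2: "(\<exists>r. ((\<lambda>t. (u t, v t, bb t / aa t)) \<longlongrightarrow> (u0, v0, r)) at_top) \<or>
           ((\<lambda>t. (u t, v t, aa t / bb t)) \<longlongrightarrow> (u0, v0, 0)) at_top"
      using X(5) unfolding lift_tends_to_saddle_def by blast
    have base: "((\<lambda>t. (u t, v t)) \<longlongrightarrow> (u0, v0)) at_top"
      if "((\<lambda>t. (u t, v t, m t)) \<longlongrightarrow> (u0, v0, r)) at_top" for m and r :: real
      using tendsto_Pair[OF tendsto_fst[OF that] tendsto_fst[OF tendsto_snd[OF that]]] by simp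
    have "\<forall>\<^sub>F t in at_top. \<gamma> t = X (u t, v t)" using 1 by (rule eventually_mono) blast
    moreover have "((\<lambda>t. (u t, v t)) \<longlongrightarrow> (u0, v0)) at_top" using 2 base[of "\<lambda>t. bb t / aa t"] base[of "\<lambda>t. aa t / bb t"] by (elim disjE exE)
    ultimately show ?thesis by (rule that)
  qed
  have lp: "open U" "smooth_on U X" "(u0, v0) \<in> U" "X (u0, v0) = p"
    using X(2) by (auto simp: D1_in_def local_param_at_def local_param_def)
  have "isCont X (u0, v0)"
    using has_derivative_continuous[OF smooth_has_derivative[OF lp(1-3)]] .
  then have "((\<lambda>t. X (u t, v t)) \<longlongrightarrow> X (u0, v0)) at_top"
    using uv(2) by (rule isCont_tendsto_compose)
  then have "(\<gamma> \<longlongrightarrow> X (u0, v0)) at_top"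
    by (rule Lim_transform_eventually) (rule eventually_mono[OF uv(1)], simp)
  then have "(\<gamma> \<longlongrightarrow> p) at_top" unfolding lp(4) .
  moreover have "type_D1 E0 p" using X(2) unfolding type_D1_def by blast
  ultimately show ?thesis unfolding separatrix_def using X by blast
qed

text \<open>Such a curve lies in the section \<open>y = 0\<close>, so within an arc; the arc is a principal line, and maximality gives equality.\<close>

lemma separatrix_is_arc:
  assumes "umbilic E0 p" "separatrix E0 p C" shows "C \<in> arcs"
proof -
  obtain \<gamma> where g: "maximal_principal_line E0 C" "principal_immersion E0 \<gamma>" "C = range \<gamma>" "(\<gamma> \<longlongrightarrow> p) at_top"
    using assms(2) unfolding separatrix_def by blast
  obtain A where A: "A \<in> arcs" "C \<subseteq> A"
    using immersion_in_cy_within_arc[OF g(2) limit_umbilic_imp_cy[OF g(2) assms(1) g(4)]] g(3) by blast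
  then have "A = C" using g(1) arc_principal_line unfolding maximal_principal_line_def by blast
  then show ?thesis using A by simp
qed

lemma arcs_eq_separatrices:
  "arcs = {C. \<exists>p. umbilic E0 p \<and> separatrix E0 p C}"
  "arcs = {C. \<exists>p. umbilic E0 p \<and> saddle_separatrix E0 p C}"
  using arc_saddle_separatrix saddle_separatrix_imp_separatrix separatrix_is_arc by blast+

end

theorem proposition3p1:
  fixes a b c :: real
  assumes "a > b" and "b > 0" and "c > 0"
  defines "E0 \<equiv> ellipsoid a b c"
  defines "cx \<equiv> {p. p$1 = 0} \<inter> E0"
    and "cy \<equiv> {p. p$2 = 0} \<inter> E0"
    and "cz \<equiv> {p. p$3 = 0} \<inter> E0"
  shows
    \<comment> \<open>(a)\<close>
    "(principal_line E0 cx \<and> principal_line E0 cz) \<and>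
    \<comment> \<open>(b)\<close>
     ({p. umbilic E0 p \<and> spacelike_point E0 p} =
        {vector [\<sigma> * (a * sqrt ((a\<^sup>2 - b\<^sup>2) / (a\<^sup>2 + c\<^sup>2))), 0,
                 \<tau> * (c * sqrt ((b\<^sup>2 + c\<^sup>2) / (a\<^sup>2 + c\<^sup>2)))] | \<sigma> \<tau>.
           \<sigma> \<in> {-1, 1} \<and> \<tau> \<in> {-1, 1}} \<and>
      card {p. umbilic E0 p \<and> spacelike_point E0 p} = 4) \<and>
    \<comment> \<open>(c)\<close>
     (\<forall>p. umbilic E0 p \<longrightarrow> type_D1 E0 p) \<and>
    \<comment> \<open>(d)\<close>
     (\<exists>\<L>. cy - {p. umbilic E0 p} = \<Union>\<L> \<and>
        (\<forall>C\<in>\<L>. principal_line E0 C) \<and>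
        \<L> = {C. \<exists>p. umbilic E0 p \<and> separatrix E0 p C} \<and>
        \<L> = {C. \<exists>p. umbilic E0 p \<and> saddle_separatrix E0 p C}) \<and>
    \<comment> \<open>(e)\<close>
     (\<exists>T1 T2. tropic E0 = T1 \<union> T2 \<and> T1 \<inter> T2 = {} \<and>
        regular_closed_curve T1 \<and> regular_closed_curve T2 \<and>
        principal_line E0 T1 \<and> principal_line E0 T2) \<and>
    \<comment> \<open>(f)\<close>
     LPL E0 = {}"
proof -
  interpret mink_ellipsoid a b c using assms(1-3) by unfold_locales
  have E: "E0 = ellipsoid a b c" by (simp add: E0_def)
  show ?thesis
    unfolding cx_def cy_def cz_def E
  proof (intro conjI)
    show "principal_line (ellipsoid a b c) ({p. p$1 = 0} \<inter> ellipsoid a b c)"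
      by (rule principal_line_cx)
    show "principal_line (ellipsoid a b c) ({p. p$3 = 0} \<inter> ellipsoid a b c)"
      by (rule principal_line_cz)
    show "{p. umbilic (ellipsoid a b c) p \<and> spacelike_point (ellipsoid a b c) p} =
        {vector [\<sigma> * (a * sqrt ((a\<^sup>2 - b\<^sup>2) / (a\<^sup>2 + c\<^sup>2))), 0,
                 \<tau> * (c * sqrt ((b\<^sup>2 + c\<^sup>2) / (a\<^sup>2 + c\<^sup>2)))] | \<sigma> \<tau>.
           \<sigma> \<in> {-1, 1} \<and> \<tau> \<in> {-1, 1}}"
      unfolding umbilic_spacelike_iff umbilics_eq P_def Q_def R_def ..
    show "card {p. umbilic (ellipsoid a b c) p \<and> spacelike_point (ellipsoid a b c) p} = 4"
      unfolding umbilic_spacelike_iff by (rule card_umbilics)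
    show "\<forall>p. umbilic (ellipsoid a b c) p \<longrightarrow> type_D1 (ellipsoid a b c) p"
      using umbilic_D1(1) unfolding type_D1_def by blast
    show "\<exists>\<L>. {p. p$2 = 0} \<inter> ellipsoid a b c - {p. umbilic (ellipsoid a b c) p} = \<Union>\<L> \<and>
        (\<forall>C\<in>\<L>. principal_line (ellipsoid a b c) C) \<and>
        \<L> = {C. \<exists>p. umbilic (ellipsoid a b c) p \<and> separatrix (ellipsoid a b c) p C} \<and>
        \<L> = {C. \<exists>p. umbilic (ellipsoid a b c) p \<and> saddle_separatrix (ellipsoid a b c) p C}"
      using Union_arcs arc_principal_line arcs_eq_separatrices by (intro exI[of _ arcs]) blast
    show "\<exists>T1 T2. tropic (ellipsoid a b c) = T1 \<union> T2 \<and> T1 \<inter> T2 = {} \<and>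
        regular_closed_curve T1 \<and> regular_closed_curve T2 \<and>
        principal_line (ellipsoid a b c) T1 \<and> principal_line (ellipsoid a b c) T2"
      by (rule tropic_decomposition)
    show "LPL (ellipsoid a b c) = {}" by (rule LPL_empty)
  qed
qed

end
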